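(* Let $\nu\geq 1$ be an integer and let $V\in L^1_{\mathrm{loc}}(\mathbb{R}^\nu)$ with $V\geq 0$. For $M>0$ let $\Omega_M=\{x\in\mathbb{R}^\nu\mid 0\leq V(x)<M\}$. Suppose that for any $M$ there is an $r>0$ so that $\Omega_M$ is $r$-polynomially thin. Then the Schrödinger operator $H=-\Delta+V$ on $L^2(\mathbb{R}^\nu)$ has purely discrete spectrum.
   Context: Given a (measurable) set $\Omega\subset\mathbb{R}^\nu$, define for any $x\in\mathbb{R}^\nu$ and any $\ell>0$ $$\omega_x^\ell(\Omega)=|\Omega\cap\{y\mid |y-x|\leq \ell\}|,$$ where $|\cdot|$ of a set is Lebesgue measure. For $r>0$, the set $\Omega$ is called $r$-polynomially thin if $$\int_{x\in\Omega}\omega_x^\ell(\Omega)^r\,d^\nu x<\infty$$ for all $\ell>0$. $H=-\Delta+V$ is the selfadjoint operator on $L^2(\mathbb{R}^\nu)$ defined as a form sum, i.e. the operator associated with the closed quadratic form $u\mapsto \int |\nabla u|^2\,d^\nu x+\int V|u|^2\,d^\nu x$ with form domain $\{u\in H^1(\mathbb{R}^\nu)\mid \int V|u|^2\,d^\nu x<\infty\}$. A selfadjoint operator $H$ has purely discrete spectrum if its essential spectrum $\sigma_{\mathrm{ess}}(H)$ is empty; for nonnegative $H$, this is equivalent to compactness of $(H+1)^{-1}$, or of $e^{-sH}$ for any (and so all) $s>0$. *)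

theory Defs
  imports "HOL-Analysis.Analysis"
begin

section \<open>Polynomially thin sets\<close>

definition omega :: "real \<Rightarrow> 'a::euclidean_space set \<Rightarrow> 'a \<Rightarrow> real" where
  "omega l \<Omega> x = measure lebesgue (\<Omega> \<inter> cball x l)"

definition polynomially_thin :: "real \<Rightarrow> 'a::euclidean_space set \<Rightarrow> bool" where
  "polynomially_thin r \<Omega> \<longleftrightarrow> \<Omega> \<in> sets lebesgue \<and>
     (\<forall>l>0. (\<integral>\<^sup>+x\<in>\<Omega>. ennreal (omega l \<Omega> x powr r) \<partial>lebesgue) < \<infinity>)"

section \<open>Complex \<open>L\<^sup>2\<close>\<close>

text \<open>Elements of \<open>L\<^sup>2\<close> are represented by functions; equality in \<open>L\<^sup>2\<close> is equality
  almost everywhere and is written out wherever it matters.\<close>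

definition L2 :: "('a::euclidean_space \<Rightarrow> complex) set" where
  "L2 = {f \<in> borel_measurable lebesgue. integrable lebesgue (\<lambda>x. (cmod (f x))\<^sup>2)}"

definition inner_L2 :: "('a::euclidean_space \<Rightarrow> complex) \<Rightarrow> ('a \<Rightarrow> complex) \<Rightarrow> complex" where
  "inner_L2 f g = (LINT x|lebesgue. cnj (f x) * g x)"

definition norm_L2 :: "('a::euclidean_space \<Rightarrow> complex) \<Rightarrow> real" where
  "norm_L2 f = sqrt (LINT x|lebesgue. (cmod (f x))\<^sup>2)"

definition locally_L1 :: "('a::euclidean_space \<Rightarrow> real) \<Rightarrow> bool" where
  "locally_L1 V \<longleftrightarrow> (\<forall>K. compact K \<longrightarrow> V absolutely_integrable_on K)"

section \<open>The Sobolev space \<open>H\<^sup>1\<close>\<close>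

definition partial_deriv ::
    "'a::euclidean_space \<Rightarrow> ('a \<Rightarrow> 'b::real_normed_vector) \<Rightarrow> 'a \<Rightarrow> 'b" where
  "partial_deriv i f x = frechet_derivative f (at x) i"

primrec Ck :: "nat \<Rightarrow> ('a::euclidean_space \<Rightarrow> 'b::real_normed_vector) \<Rightarrow> bool" where
  "Ck 0 f \<longleftrightarrow> continuous_on UNIV f"
| "Ck (Suc k) f \<longleftrightarrow> (\<forall>x. f differentiable at x) \<and> (\<forall>i\<in>Basis. Ck k (partial_deriv i f))"

definition test_function :: "('a::euclidean_space \<Rightarrow> complex) \<Rightarrow> bool" where
  "test_function \<phi> \<longleftrightarrow> (\<forall>k. Ck k \<phi>) \<and> compact (closure {x. \<phi> x \<noteq> 0})"

definition has_weak_partial ::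
    "'a::euclidean_space \<Rightarrow> ('a \<Rightarrow> complex) \<Rightarrow> ('a \<Rightarrow> complex) \<Rightarrow> bool" where
  "has_weak_partial i u g \<longleftrightarrow>
     (\<forall>\<phi>. test_function \<phi> \<longrightarrow>
        (LINT x|lebesgue. u x * partial_deriv i \<phi> x) = - (LINT x|lebesgue. g x * \<phi> x))"

definition H1 :: "('a::euclidean_space \<Rightarrow> complex) set" where
  "H1 = {u \<in> L2. \<forall>i\<in>Basis. \<exists>g\<in>L2. has_weak_partial i u g}"

text \<open>Weak derivatives are unique up to null sets, so the choice below does not affect
  the form.\<close>

definition weak_partial :: "'a::euclidean_space \<Rightarrow> ('a \<Rightarrow> complex) \<Rightarrow> 'a \<Rightarrow> complex" where
  "weak_partial i u = (SOME g. g \<in> L2 \<and> has_weak_partial i u g)"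

section \<open>The form sum \<open>-\<Delta> + V\<close>\<close>

definition form_dom :: "('a::euclidean_space \<Rightarrow> real) \<Rightarrow> ('a \<Rightarrow> complex) set" where
  "form_dom V = {u \<in> H1. integrable lebesgue (\<lambda>x. V x * (cmod (u x))\<^sup>2)}"

definition schroedinger_form ::
    "('a::euclidean_space \<Rightarrow> real) \<Rightarrow> ('a \<Rightarrow> complex) \<Rightarrow> ('a \<Rightarrow> complex) \<Rightarrow> complex" where
  "schroedinger_form V u v =
     (\<Sum>i\<in>Basis. inner_L2 (weak_partial i u) (weak_partial i v))
     + (LINT x|lebesgue. complex_of_real (V x) * (cnj (u x) * v x))"

text \<open>Operators in \<open>L\<^sup>2\<close> are given by their graphs. The operator associated with the form
  has \<open>u\<close> in its domain, with value \<open>f\<close>, iff \<open>f\<close> represents the functional that the form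
  defines at \<open>u\<close>.\<close>

definition schroedinger_operator ::
    "('a::euclidean_space \<Rightarrow> real) \<Rightarrow> (('a \<Rightarrow> complex) \<times> ('a \<Rightarrow> complex)) set" where
  "schroedinger_operator V =
     {(u, f). u \<in> form_dom V \<and> f \<in> L2 \<and>
        (\<forall>v\<in>form_dom V. schroedinger_form V v u = inner_L2 v f)}"

section \<open>Spectrum\<close>

text \<open>The estimate says that \<open>T - z\<close> is injective with bounded inverse.\<close>

definition resolvent_set ::
    "(('a::euclidean_space \<Rightarrow> complex) \<times> ('a \<Rightarrow> complex)) set \<Rightarrow> complex set" where
  "resolvent_set T =
     {z. (\<forall>g\<in>L2. \<exists>(u, f)\<in>T. AE x in lebesgue. f x - z * u x = g x) \<and>
         (\<exists>C. \<forall>(u, f)\<in>T. norm_L2 u \<le> C * norm_L2 (\<lambda>x. f x - z * u x))}"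

definition spectrum ::
    "(('a::euclidean_space \<Rightarrow> complex) \<times> ('a \<Rightarrow> complex)) set \<Rightarrow> complex set" where
  "spectrum T = - resolvent_set T"

definition eigenspace ::
    "(('a::euclidean_space \<Rightarrow> complex) \<times> ('a \<Rightarrow> complex)) set \<Rightarrow> complex \<Rightarrow> ('a \<Rightarrow> complex) set"
  where
  "eigenspace T z = {u. \<exists>f. (u, f) \<in> T \<and> (AE x in lebesgue. f x = z * u x)}"

definition is_eigenvalue ::
    "(('a::euclidean_space \<Rightarrow> complex) \<times> ('a \<Rightarrow> complex)) set \<Rightarrow> complex \<Rightarrow> bool" where
  "is_eigenvalue T z \<longleftrightarrow> (\<exists>u\<in>eigenspace T z. \<not> (AE x in lebesgue. u x = 0))"

definition finite_multiplicity ::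
    "(('a::euclidean_space \<Rightarrow> complex) \<times> ('a \<Rightarrow> complex)) set \<Rightarrow> complex \<Rightarrow> bool" where
  "finite_multiplicity T z \<longleftrightarrow>
     (\<exists>S. finite S \<and> S \<subseteq> eigenspace T z \<and>
        (\<forall>u\<in>eigenspace T z. \<exists>c. AE x in lebesgue. u x = (\<Sum>s\<in>S. c s * s x)))"

text \<open>For selfadjoint \<open>T\<close>, the discrete spectrum consists of the isolated eigenvalues of
  finite multiplicity, and the essential spectrum is the rest of the spectrum.\<close>

definition discrete_spectrum ::
    "(('a::euclidean_space \<Rightarrow> complex) \<times> ('a \<Rightarrow> complex)) set \<Rightarrow> complex set" where
  "discrete_spectrum T =
     {z. z isolated_in spectrum T \<and> is_eigenvalue T z \<and> finite_multiplicity T z}"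

definition essential_spectrum ::
    "(('a::euclidean_space \<Rightarrow> complex) \<times> ('a \<Rightarrow> complex)) set \<Rightarrow> complex set" where
  "essential_spectrum T = spectrum T - discrete_spectrum T"

definition purely_discrete_spectrum ::
    "(('a::euclidean_space \<Rightarrow> complex) \<times> ('a \<Rightarrow> complex)) set \<Rightarrow> bool" where
  "purely_discrete_spectrum T \<longleftrightarrow> essential_spectrum T = {}"

end

theory Submission
  imports Defs "HOL-Complex_Analysis.Great_Picard" "HOL-Computational_Algebra.Polynomial"
    "HOL-Library.Diagonal_Subsequence"
begin

text \<open>The form domain of \<open>- \<Delta> + V\<close> embeds compactly into \<open>L\<^sup>2\<close>, and a nonnegative closed
  form with this property has an operator with purely discrete spectrum.

  For the compactness, let \<open>u\<close> have energy at most \<open>1\<close>. On the set where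
  \<open>V \<ge> M\<close> the function \<open>u\<close> has mass at most \<open>1 / M\<close>, so only the set \<open>\<Omega>\<close> where
  \<open>V < M\<close> matters. There \<open>u\<close> is compared with its mean over balls of radius \<open>s\<close>. A function in
  \<open>H\<^sup>1\<close> changes under a shift by \<open>h\<close> by at most \<open>|h|\<close> times the norms of its weak
  derivatives (\<open>translation_estimate\<close>), so the means differ from \<open>u\<close> by \<open>O(s)\<close> in
  \<open>L\<^sup>2\<close>. For fixed \<open>s\<close>, the means of functions with bounded energy are uniformly bounded and uniformly
  Lipschitz, and Arzela--Ascoli makes them precompact on every bounded ball. Far out, the mass of
  the means on \<open>\<Omega>\<close> is at most the mass of \<open>u\<close> times the largest fraction of a ball of
  radius \<open>s\<close> that the distant part of \<open>\<Omega>\<close> occupies (\<open>ball_avg_thin\<close>). This is where thinness enters: if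
  the part of \<open>\<Omega>\<close> in some ball of radius \<open>s\<close> has measure \<open>m\<close>, then each of its points
  sees at least measure \<open>m\<close> of \<open>\<Omega>\<close> within distance \<open>2 s\<close>, so this part contributes
  at least \<open>m\<close> to the power \<open>r + 1\<close> to the integral of \<open>omega (2 * s) \<Omega>\<close> to the power
  \<open>r\<close>. The tails of that integral vanish, so \<open>m\<close> tends to \<open>0\<close> as the ball moves to
  infinity (\<open>polynomially_thin_tail\<close>). Together this gives \<open>compact_embedding_if_thin\<close>.

  The form is defined with arbitrarily chosen weak derivatives. They are unique almost everywhere by
  the fundamental lemma of the calculus of variations, for which the test functions must approximate
  the indicators of boxes; products of rescaled functions \<open>exp (- 1 / t)\<close> do this. With uniqueness the form is sesquilinear, and completeness of the form domain follows from
  completeness of \<open>L\<^sup>2\<close> and Fatou's lemma (\<open>form_complete\<close>).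

  For the spectrum, the operator is treated through its graph. The Riesz representation in the form
  domain shows that \<open>H + 1\<close> is onto. Compactness shows that bounded sequences of
  pairs in the graph whose residuals \<open>f - z u\<close> converge subconverge within the graph
  (\<open>operator_limit\<close>). Hence, if \<open>z\<close> is not an eigenvalue, then \<open>H - z\<close> is bounded below and has closed
  range, and the range is everything because its orthogonal complement consists of eigenvectors for the
  conjugate of \<open>z\<close>. The same limit principle, applied to orthogonal eigenvectors, shows that
  eigenvalues are isolated and have finite multiplicity.\<close>

section \<open>Semi-inner products on spaces of functions\<close>

text \<open>The discriminant bound for a nonnegative quadratic in a complex variable. It is used twice: for
  the Cauchy--Schwarz inequality and, in the Riesz representation, to turn the near-minimality of a
  point into near-vanishing of the first variation there.\<close>

lemma quadratic_nonneg_imp_discriminant: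
  fixes z :: complex
  assumes nn: "\<And>c. 0 \<le> a + 2 * Re (c * z) + (cmod c)\<^sup>2 * b" and b: "0 \<le> b"
  shows "(cmod z)\<^sup>2 \<le> a * b"
proof (cases "b = 0")
  case True
  have "z = 0"
  proof (rule ccontr)
    assume "z \<noteq> 0"
    then have p: "(cmod z)\<^sup>2 > 0" by simp
    \<comment> \<open>Without a quadratic term, a large \<open>c\<close> in the direction of \<open>- cnj z\<close> makes the linear term beat \<open>a\<close>.\<close>
    have "0 \<le> a + 2 * Re (of_real (- (\<bar>a\<bar> + 1) / (cmod z)\<^sup>2) * cnj z * z)"
      using nn[of "of_real (- (\<bar>a\<bar> + 1) / (cmod z)\<^sup>2) * cnj z"] True by simp
    also have "of_real (- (\<bar>a\<bar> + 1) / (cmod z)\<^sup>2) * cnj z * z = of_real (- (\<bar>a\<bar> + 1) / (cmod z)\<^sup>2) * of_real ((cmod z)\<^sup>2)"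
      by (simp only: mult.assoc complex_mod_sqrt_Re_mult_cnj) (metis complex_norm_square mult.commute complex_mod_sqrt_Re_mult_cnj)
    also have "\<dots> = of_real (- (\<bar>a\<bar> + 1))"
      unfolding of_real_mult[symmetric] using p by simp
    finally show False by simp
  qed
  then show ?thesis using True by simp
next
  case False
  then have b: "b > 0" using b by simp
  \<comment> \<open>The minimizer of the quadratic is \<open>c = - cnj z / b\<close>.\<close>
  have zz: "cnj z * z = of_real ((cmod z)\<^sup>2)"
    by (metis complex_norm_square mult.commute)
  have "Re (of_real (- 1 / b) * cnj z * z) = - (cmod z)\<^sup>2 / b"
    by (simp only: mult.assoc zz flip: of_real_mult) simp
  moreover have "(cmod (of_real (- 1 / b) * cnj z))\<^sup>2 * b = (cmod z)\<^sup>2 / b"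
    using b by (simp add: norm_mult norm_divide power_mult_distrib power_divide power2_eq_square)
  ultimately have "0 \<le> a + 2 * (- (cmod z)\<^sup>2 / b) + (cmod z)\<^sup>2 / b"
    using nn[of "of_real (- 1 / b) * cnj z"] by (simp only:)
  then show ?thesis using b by (simp add: field_simps)
qed

text \<open>Elements of \<open>L\<^sup>2\<close> are functions and not classes of functions, so every inner product that
  occurs is only positive semidefinite. The locale is instantiated with \<open>L\<^sup>2\<close>, with the
  form domain under two different forms, and with the range of \<open>H - z\<close>.\<close>

locale semi_inner =
  fixes S :: "('a \<Rightarrow> complex) set" and B :: "('a \<Rightarrow> complex) \<Rightarrow> ('a \<Rightarrow> complex) \<Rightarrow> complex"
  assumes zero_mem: "(\<lambda>_. 0) \<in> S"
    and lincomb_mem: "\<And>u v c. u \<in> S \<Longrightarrow> v \<in> S \<Longrightarrow> (\<lambda>x. u x + c * v x) \<in> S"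
    and lin: "\<And>w u v c. w \<in> S \<Longrightarrow> u \<in> S \<Longrightarrow> v \<in> S \<Longrightarrow> B w (\<lambda>x. u x + c * v x) = B w u + c * B w v"
    and herm: "\<And>u v. u \<in> S \<Longrightarrow> v \<in> S \<Longrightarrow> B u v = cnj (B v u)"
    and pos: "\<And>u. u \<in> S \<Longrightarrow> 0 \<le> Re (B u u)"
begin

definition nrm :: "('a \<Rightarrow> complex) \<Rightarrow> real" where
  "nrm u = sqrt (Re (B u u))"

lemma diff_mem: "u \<in> S \<Longrightarrow> v \<in> S \<Longrightarrow> (\<lambda>x. u x - v x) \<in> S"
  using lincomb_mem[of u v "-1"] by simp

lemma add_mem: "u \<in> S \<Longrightarrow> v \<in> S \<Longrightarrow> (\<lambda>x. u x + v x) \<in> S"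
  using lincomb_mem[of u v 1] by simp

lemma scale_mem: "v \<in> S \<Longrightarrow> (\<lambda>x. c * v x) \<in> S"
  using lincomb_mem[OF zero_mem, of v c] by simp

lemma sum_mem: "(\<And>i. i \<in> I \<Longrightarrow> f i \<in> S) \<Longrightarrow> (\<lambda>x. \<Sum>i\<in>I. c i * f i x) \<in> S"
  by (induction I rule: infinite_finite_induct) (auto simp: zero_mem intro!: add_mem scale_mem)

lemma lin_diff: "w \<in> S \<Longrightarrow> u \<in> S \<Longrightarrow> v \<in> S \<Longrightarrow> B w (\<lambda>x. u x - v x) = B w u - B w v"
  using lin[of w u v "-1"] by simp

lemma lin_add: "w \<in> S \<Longrightarrow> u \<in> S \<Longrightarrow> v \<in> S \<Longrightarrow> B w (\<lambda>x. u x + v x) = B w u + B w v"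
  using lin[of w u v 1] by simp

lemma lin_zero: "w \<in> S \<Longrightarrow> B w (\<lambda>_. 0) = 0"
  using lin_diff[of w "\<lambda>_. 0" "\<lambda>_. 0"] zero_mem by simp

lemma lin_scale: "w \<in> S \<Longrightarrow> v \<in> S \<Longrightarrow> B w (\<lambda>x. c * v x) = c * B w v"
  using lin[OF _ zero_mem, of w v c] by (simp add: lin_zero)

lemma lin_sum:
  assumes "w \<in> S" "\<And>i. i \<in> I \<Longrightarrow> f i \<in> S"
  shows "B w (\<lambda>x. \<Sum>i\<in>I. c i * f i x) = (\<Sum>i\<in>I. c i * B w (f i))"
  using assms(2)
proof (induction I rule: infinite_finite_induct)
  case (insert i I)
  then show ?case
    using lin_add[OF assms(1) scale_mem[of "f i" "c i"] sum_mem[of I f c]] assms(1) by (simp add: lin_scale)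
qed (use assms(1) in \<open>simp_all add: lin_zero\<close>)

lemma antilin: "w \<in> S \<Longrightarrow> u \<in> S \<Longrightarrow> v \<in> S \<Longrightarrow> B (\<lambda>x. u x + c * v x) w = B u w + cnj c * B v w"
  using lin[of w u v c] herm[of w u] herm[of w v] herm[of "\<lambda>x. u x + c * v x" w] lincomb_mem[of u v c]
  by simp

lemma antilin_diff: "w \<in> S \<Longrightarrow> u \<in> S \<Longrightarrow> v \<in> S \<Longrightarrow> B (\<lambda>x. u x - v x) w = B u w - B v w"
  using antilin[of w u v "-1"] by simp

lemma antilin_scale: "w \<in> S \<Longrightarrow> v \<in> S \<Longrightarrow> B (\<lambda>x. c * v x) w = cnj c * B v w"
  using lin_scale[of w v c] herm[of w v] herm[of "\<lambda>x. c * v x" w] scale_mem[of v c] by simp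

lemma nrm_sq: "u \<in> S \<Longrightarrow> (nrm u)\<^sup>2 = Re (B u u)"
  using pos[of u] by (simp add: nrm_def)

lemma nrm_nonneg: "u \<in> S \<Longrightarrow> 0 \<le> nrm u"
  using pos[of u] by (simp add: nrm_def)

lemma expand:
  assumes "u \<in> S" "v \<in> S"
  shows "Re (B (\<lambda>x. u x + c * v x) (\<lambda>x. u x + c * v x)) = Re (B u u) + 2 * Re (c * B u v) + (cmod c)\<^sup>2 * Re (B v v)"
proof -
  have "B (\<lambda>x. u x + c * v x) (\<lambda>x. u x + c * v x) = B u u + cnj c * B v u + c * B u v + (cnj c * c) * B v v"
    using assms by (simp add: lin lincomb_mem antilin algebra_simps)
  moreover have "cnj c * c = of_real ((cmod c)\<^sup>2)"
    by (metis complex_norm_square mult.commute)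
  moreover have "cnj c * B v u = cnj (c * B u v)"
    using herm[OF assms(2,1)] by simp
  ultimately show ?thesis by simp
qed

lemma cauchy_schwarz_sq:
  assumes "u \<in> S" "v \<in> S"
  shows "(cmod (B u v))\<^sup>2 \<le> Re (B u u) * Re (B v v)"
proof (rule quadratic_nonneg_imp_discriminant)
  show "0 \<le> Re (B u u) + 2 * Re (c * B u v) + (cmod c)\<^sup>2 * Re (B v v)" for c
    unfolding expand[OF assms, symmetric] by (rule pos[OF lincomb_mem[OF assms]])
qed (rule pos[OF assms(2)])

lemma cauchy_schwarz:
  assumes "u \<in> S" "v \<in> S"
  shows "cmod (B u v) \<le> nrm u * nrm v"
  using cauchy_schwarz_sq[OF assms] assms nrm_nonneg
  by (intro power2_le_imp_le[of "cmod (B u v)"]) (simp_all add: power_mult_distrib nrm_sq)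

lemma nrm_scale: "v \<in> S \<Longrightarrow> nrm (\<lambda>x. c * v x) = cmod c * nrm v"
proof -
  assume v: "v \<in> S"
  have "B (\<lambda>x. c * v x) (\<lambda>x. c * v x) = (cnj c * c) * B v v"
    using v by (simp add: lin_scale antilin_scale scale_mem)
  also have "cnj c * c = of_real ((cmod c)\<^sup>2)"
    by (metis complex_norm_square mult.commute)
  finally show ?thesis by (simp add: nrm_def real_sqrt_mult)
qed

lemma triangle: assumes "u \<in> S" "v \<in> S" shows "nrm (\<lambda>x. u x + v x) \<le> nrm u + nrm v"
proof (rule power2_le_imp_le)
  have "Re (B u v) \<le> nrm u * nrm v"
    using cauchy_schwarz[OF assms] complex_Re_le_cmod[of "B u v"] by linarith
  then show "(nrm (\<lambda>x. u x + v x))\<^sup>2 \<le> (nrm u + nrm v)\<^sup>2"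
    using expand[OF assms, of 1] assms by (simp add: nrm_sq add_mem power2_sum)
qed (use assms nrm_nonneg in auto)

lemma nrm_diff_commute: assumes "u \<in> S" "v \<in> S" shows "nrm (\<lambda>x. u x - v x) = nrm (\<lambda>x. v x - u x)"
proof -
  have "(\<lambda>x. - 1 * (u x - v x)) = (\<lambda>x. v x - u x)" by simp
  then show ?thesis using nrm_scale[OF diff_mem[OF assms], of "-1"] by (simp only: norm_minus_cancel norm_one mult_1_left)
qed

lemma triangle_diff:
  assumes "u \<in> S" "v \<in> S" "w \<in> S"
  shows "nrm (\<lambda>x. u x - w x) \<le> nrm (\<lambda>x. u x - v x) + nrm (\<lambda>x. v x - w x)"
proof -
  have "(\<lambda>x. (u x - v x) + (v x - w x)) = (\<lambda>x. u x - w x)" by simp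
  then show ?thesis using triangle[OF diff_mem[OF assms(1,2)] diff_mem[OF assms(2,3)]] by (simp only:)
qed

lemma triangle_minus: assumes "u \<in> S" "v \<in> S" shows "nrm (\<lambda>x. u x - v x) \<le> nrm u + nrm v"
  using triangle[OF assms(1) scale_mem[OF assms(2), of "-1"]] nrm_scale[OF assms(2), of "-1"] by simp

lemma nrm_le_diff: assumes "u \<in> S" "v \<in> S" shows "nrm u \<le> nrm v + nrm (\<lambda>x. u x - v x)"
  using triangle[OF assms(2) diff_mem[OF assms]] by simp

lemma parallelogram:
  assumes "u \<in> S" "v \<in> S"
  shows "Re (B (\<lambda>x. u x - v x) (\<lambda>x. u x - v x)) + Re (B (\<lambda>x. u x + v x) (\<lambda>x. u x + v x)) = 2 * Re (B u u) + 2 * Re (B v v)"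
  using expand[OF assms, of 1] expand[OF assms, of "-1"] by simp

definition cauchy :: "(nat \<Rightarrow> 'a \<Rightarrow> complex) \<Rightarrow> bool" where
  "cauchy f \<longleftrightarrow> (\<forall>n. f n \<in> S) \<and> (\<forall>e>0. \<exists>N. \<forall>m\<ge>N. \<forall>n\<ge>N. nrm (\<lambda>x. f m x - f n x) < e)"

definition complete :: bool where
  "complete \<longleftrightarrow> (\<forall>f. cauchy f \<longrightarrow> (\<exists>u\<in>S. (\<lambda>n. nrm (\<lambda>x. f n x - u x)) \<longlonglongrightarrow> 0))"

lemma B_tendsto:
  assumes "\<And>n. f n \<in> S" "u \<in> S" "w \<in> S" "(\<lambda>n. nrm (\<lambda>x. f n x - u x)) \<longlonglongrightarrow> 0"
  shows "(\<lambda>n. B w (f n)) \<longlonglongrightarrow> B w u"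
proof (rule LIM_zero_cancel, rule Lim_null_comparison)
  show "\<forall>\<^sub>F n in sequentially. cmod (B w (f n) - B w u) \<le> nrm w * nrm (\<lambda>x. f n x - u x)"
    using cauchy_schwarz[OF assms(3) diff_mem[OF assms(1,2)]] assms by (simp add: lin_diff)
  show "(\<lambda>n. nrm w * nrm (\<lambda>x. f n x - u x)) \<longlonglongrightarrow> 0"
    using tendsto_mult_right_zero[OF assms(4)] by simp
qed

lemma B_tendsto_left:
  assumes "\<And>n. f n \<in> S" "u \<in> S" "w \<in> S" "(\<lambda>n. nrm (\<lambda>x. f n x - u x)) \<longlonglongrightarrow> 0"
  shows "(\<lambda>n. B (f n) w) \<longlonglongrightarrow> B u w"
proof -
  have "(\<lambda>n. B (f n) w) = (\<lambda>n. cnj (B w (f n)))" using herm[OF assms(1) assms(3)] by (rule ext)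
  then show ?thesis using tendsto_cnj[OF B_tendsto[OF assms]] herm[OF assms(2) assms(3)] by (simp only:)
qed

text \<open>The functional \<open>v \<mapsto> B v v - 2 Re (L v)\<close> is bounded below. By the parallelogram law a
  minimizing sequence is Cauchy, and its limit represents \<open>L\<close>. The values along the minimizing
  sequence suffice: if \<open>J (f n)\<close> exceeds the infimum by \<open>\<delta>\<close>, then
  \<open>B (f n) v - L v\<close> is at most the square root of \<open>\<delta> B v v\<close>.\<close>

theorem riesz_representation:
  assumes cpl: complete
    and Llin: "\<And>u v c. u \<in> S \<Longrightarrow> v \<in> S \<Longrightarrow> L (\<lambda>x. u x + c * v x) = L u + c * L v"
    and Lbd: "\<And>v. v \<in> S \<Longrightarrow> cmod (L v) \<le> K * nrm v"
  shows "\<exists>u\<in>S. \<forall>v\<in>S. B u v = L v"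
proof -
  define J where "J v = Re (B v v) - 2 * Re (L v)" for v
  have Jexp: "J (\<lambda>x. u x + c * v x) = J u + 2 * Re (c * (B u v - L v)) + (cmod c)\<^sup>2 * Re (B v v)"
    if "u \<in> S" "v \<in> S" for u v c
    unfolding J_def expand[OF that] Llin[OF that] by (simp add: algebra_simps)
  have low: "- K\<^sup>2 \<le> J v" if v: "v \<in> S" for v
  proof -
    have "Re (L v) \<le> K * nrm v" using Lbd[OF v] complex_Re_le_cmod[of "L v"] by linarith
    moreover have "0 \<le> (nrm v - K)\<^sup>2" by simp
    ultimately show ?thesis using nrm_sq[OF v] by (simp add: J_def power2_diff mult.commute)
  qed
  have bdd: "bdd_below (J ` S)" using low by (auto intro!: bdd_belowI)
  \<comment> \<open>The minimum is approached by points \<open>f n\<close>, whose excess over \<open>d\<close> controls both their distances and the first variation.\<close>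
  define d where "d = Inf (J ` S)"
  have dle: "d \<le> J v" if "v \<in> S" for v unfolding d_def using bdd that by (auto intro: cInf_lower)
  have "\<exists>v\<in>S. J v < d + 1 / real (Suc n)" for n
  proof -
    have "Inf (J ` S) < d + 1 / real (Suc n)" unfolding d_def by simp
    then show ?thesis using cInf_less_iff[OF _ bdd] zero_mem by auto
  qed
  then obtain f where fS: "\<And>n. f n \<in> S" and fJ: "\<And>n. J (f n) < d + 1 / real (Suc n)" by metis
  have key: "(nrm (\<lambda>x. f m x - f n x))\<^sup>2 \<le> 2 / real (Suc m) + 2 / real (Suc n)" for m n
  proof -
    define s where "s = (\<lambda>x. f m x + f n x)"
    have sS: "s \<in> S" and dS: "(\<lambda>x. f m x - f n x) \<in> S" and hS: "(\<lambda>x. (1/2) * s x) \<in> S"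
      unfolding s_def by (intro add_mem diff_mem scale_mem fS)+
    have "L (\<lambda>x. (1/2) * s x) = (1/2) * L s"
      using Llin[OF zero_mem sS, of "1/2"] Llin[OF zero_mem zero_mem, of 1] by simp
    moreover have "L s = L (f m) + L (f n)" unfolding s_def using Llin[OF fS fS, of m 1 n] by simp
    ultimately have "L (\<lambda>x. (1/2) * s x) = (1/2) * (L (f m) + L (f n))" by simp
    then have Lh: "Re (L (\<lambda>x. (1/2) * s x)) = (Re (L (f m)) + Re (L (f n))) / 2"
      by (simp only:) simp
    have "(nrm (\<lambda>x. (1/2) * s x))\<^sup>2 = (nrm s)\<^sup>2 / 4"
      unfolding nrm_scale[OF sS] by (simp add: power_divide)
    then have "Re (B (\<lambda>x. (1/2) * s x) (\<lambda>x. (1/2) * s x)) = Re (B s s) / 4"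
      by (simp only: nrm_sq[OF hS] nrm_sq[OF sS])
    then have "4 * d \<le> Re (B s s) - 4 * Re (L (f m)) - 4 * Re (L (f n))"
    proof -
      have arith: "4 * d \<le> c - 4 * a - 4 * b" if "Y = (a + b) / 2" "X = c / 4" "d \<le> X - 2 * Y" for a b c X Y :: real
        using that by simp
      show ?thesis by (rule arith[OF Lh \<open>Re (B (\<lambda>x. (1/2) * s x) (\<lambda>x. (1/2) * s x)) = Re (B s s) / 4\<close> dle[OF hS, unfolded J_def]])
    qed
    then have "Re (B (\<lambda>x. f m x - f n x) (\<lambda>x. f m x - f n x)) \<le> 2 * J (f m) + 2 * J (f n) - 4 * d"
      using parallelogram[OF fS fS, of m n] unfolding s_def J_def by simp
    also have "\<dots> \<le> 2 / real (Suc m) + 2 / real (Suc n)" using fJ[of m] fJ[of n] by simp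
    finally show ?thesis using dS by (simp add: nrm_sq)
  qed
  have "cauchy f" unfolding cauchy_def
  proof (intro conjI allI impI fS)
    fix e :: real assume e: "e > 0"
    obtain N where N: "4 / e\<^sup>2 < real N" using reals_Archimedean2 by blast
    have "nrm (\<lambda>x. f m x - f n x) < e" if "m \<ge> N" "n \<ge> N" for m n
    proof (rule power2_less_imp_less)
      have N': "real (Suc N) > 0" "4 / e\<^sup>2 < real (Suc N)" using N by auto
      have "2 / real (Suc m) \<le> 2 / real (Suc N)" "2 / real (Suc n) \<le> 2 / real (Suc N)"
        using that by (auto intro!: divide_left_mono)
      then have "(nrm (\<lambda>x. f m x - f n x))\<^sup>2 \<le> 4 / real (Suc N)" using key[of m n] by linarith
      also have "\<dots> < e\<^sup>2" using N' e by (simp add: field_simps)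
      finally show "(nrm (\<lambda>x. f m x - f n x))\<^sup>2 < e\<^sup>2" .
    qed (use e in simp)
    then show "\<exists>N. \<forall>m\<ge>N. \<forall>n\<ge>N. nrm (\<lambda>x. f m x - f n x) < e" by blast
  qed
  then obtain u where u: "u \<in> S" and lim: "(\<lambda>n. nrm (\<lambda>x. f n x - u x)) \<longlonglongrightarrow> 0"
    using cpl unfolding complete_def by blast
  have "B u v = L v" if v: "v \<in> S" for v
  proof -
    have le: "(cmod (B (f n) v - L v))\<^sup>2 \<le> (J (f n) - d) * Re (B v v)" for n
    proof (rule quadratic_nonneg_imp_discriminant)
      show "0 \<le> J (f n) - d + 2 * Re (c * (B (f n) v - L v)) + (cmod c)\<^sup>2 * Re (B v v)" for c
        using dle[OF lincomb_mem[OF fS v, of n c]] Jexp[OF fS v, of n c] by simp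
    qed (rule pos[OF v])
    have "(\<lambda>n. (cmod (B (f n) v - L v))\<^sup>2) \<longlonglongrightarrow> (cmod (B u v - L v))\<^sup>2"
      by (intro tendsto_intros B_tendsto_left fS u v lim)
    moreover have "(\<lambda>n. (cmod (B (f n) v - L v))\<^sup>2) \<longlonglongrightarrow> 0"
    proof (rule tendsto_sandwich[OF always_eventually always_eventually tendsto_const])
      show "\<forall>n. (cmod (B (f n) v - L v))\<^sup>2 \<le> 1 / real (Suc n) * Re (B v v)"
      proof
        fix n
        have "(J (f n) - d) * Re (B v v) \<le> 1 / real (Suc n) * Re (B v v)"
          using fJ[of n] pos[OF v] by (intro mult_right_mono) linarith+
        with le[of n] show "(cmod (B (f n) v - L v))\<^sup>2 \<le> 1 / real (Suc n) * Re (B v v)" by (rule order_trans)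
      qed
      show "(\<lambda>n. 1 / real (Suc n) * Re (B v v)) \<longlonglongrightarrow> 0"
        using tendsto_mult_left_zero[OF LIMSEQ_inverse_real_of_nat] by (simp add: inverse_eq_divide)
    qed simp
    ultimately have "(cmod (B u v - L v))\<^sup>2 = 0" by (rule LIMSEQ_unique)
    then show ?thesis by simp
  qed
  with u show ?thesis by blast
qed

end

section \<open>The space \<open>L\<^sup>2\<close>\<close>

text \<open>Fatou's lemma in the form in which it passes a bound on integrals to an almost everywhere limit.
  It serves both for the completeness of \<open>L\<^sup>2\<close> and for the potential term of the form.\<close>

lemma fatou_bound:
  fixes g :: "'a \<Rightarrow> real"
  assumes int: "\<And>i. integrable M (h i)" and nn: "\<And>i. AE x in M. 0 \<le> h i x"
    and lim: "AE x in M. (\<lambda>i. h i x) \<longlonglongrightarrow> g x" and g: "g \<in> borel_measurable M"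
    and bd: "\<forall>\<^sub>F i in sequentially. (LINT x|M. h i x) \<le> c"
  shows "integrable M g" "(LINT x|M. g x) \<le> c"
proof -
  have nn': "AE x in M. \<forall>i. 0 \<le> h i x" using nn by (simp add: AE_all_countable)
  have g0: "AE x in M. 0 \<le> g x"
    using nn' lim by eventually_elim (auto intro: LIMSEQ_le_const)
  obtain i where "(LINT x|M. h i x) \<le> c" using eventually_happens'[OF _ bd] by auto
  then have c: "0 \<le> c" using integral_nonneg_AE[OF nn[of i]] by linarith
  have [measurable]: "h i \<in> borel_measurable M" for i using int by auto
  have "(\<integral>\<^sup>+x. ennreal (g x) \<partial>M) = (\<integral>\<^sup>+x. liminf (\<lambda>i. ennreal (h i x)) \<partial>M)"
  proof (rule nn_integral_cong_AE, use lim in eventually_elim)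
    fix x assume "(\<lambda>i. h i x) \<longlonglongrightarrow> g x"
    then have "(\<lambda>i. ennreal (h i x)) \<longlonglongrightarrow> ennreal (g x)" by (rule tendsto_ennrealI)
    then show "ennreal (g x) = liminf (\<lambda>i. ennreal (h i x))"
      by (simp add: lim_imp_Liminf)
  qed
  also have "\<dots> \<le> liminf (\<lambda>i. \<integral>\<^sup>+x. ennreal (h i x) \<partial>M)"
    by (rule nn_integral_liminf) simp
  also have "\<dots> \<le> limsup (\<lambda>i. \<integral>\<^sup>+x. ennreal (h i x) \<partial>M)" by (rule Liminf_le_Limsup) simp
  also have "\<dots> \<le> ennreal c"
    by (rule Limsup_bounded, rule eventually_mono[OF bd])
      (simp add: nn_integral_eq_integral[OF int nn] ennreal_leI)
  finally have le: "(\<integral>\<^sup>+x. ennreal (g x) \<partial>M) \<le> ennreal c" .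
  have "(\<integral>\<^sup>+x. ennreal (norm (g x)) \<partial>M) = (\<integral>\<^sup>+x. ennreal (g x) \<partial>M)"
    by (rule nn_integral_cong_AE, use g0 in eventually_elim) simp
  then show I: "integrable M g"
    using le g by (auto intro!: integrableI_bounded intro: le_less_trans[OF _ ennreal_less_top])
  show "(LINT x|M. g x) \<le> c"
    using le nn_integral_eq_integral[OF I g0] c by simp
qed

lemma L2D: "u \<in> L2 \<Longrightarrow> u \<in> borel_measurable lebesgue" "u \<in> L2 \<Longrightarrow> integrable lebesgue (\<lambda>x. (cmod (u x))\<^sup>2)"
  by (auto simp: L2_def)

lemma norm_mult_le_sum_squares: "cmod p * cmod q \<le> (cmod p)\<^sup>2 + (cmod q)\<^sup>2"
  using sum_squares_bound[of "cmod p" "cmod q"] mult_nonneg_nonneg[OF norm_ge_zero norm_ge_zero, of p q] by linarith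

lemma norm_add_square_le: "(cmod (p + q))\<^sup>2 \<le> 2 * (cmod p)\<^sup>2 + 2 * (cmod q)\<^sup>2"
proof -
  have "(cmod (p + q))\<^sup>2 \<le> (cmod p + cmod q)\<^sup>2"
    by (rule power_mono[OF norm_triangle_ineq]) simp
  also have "\<dots> \<le> 2 * (cmod p)\<^sup>2 + 2 * (cmod q)\<^sup>2"
    using sum_squares_bound[of "cmod p" "cmod q"] by (simp add: power2_sum)
  finally show ?thesis .
qed

lemma L2_mult_integrable:
  assumes "u \<in> L2" "v \<in> L2"
  shows "integrable lebesgue (\<lambda>x. u x * v x)"
proof (rule Bochner_Integration.integrable_bound)
  show "integrable lebesgue (\<lambda>x. (cmod (u x))\<^sup>2 + (cmod (v x))\<^sup>2)"
    using assms by (intro Bochner_Integration.integrable_add L2D)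
  show "(\<lambda>x. u x * v x) \<in> borel_measurable lebesgue"
    using assms[THEN L2D(1)] by measurable
  have "cmod (u x * v x) \<le> (cmod (u x))\<^sup>2 + (cmod (v x))\<^sup>2" for x
    unfolding norm_mult by (rule norm_mult_le_sum_squares)
  then show "AE x in lebesgue. norm (u x * v x) \<le> norm ((cmod (u x))\<^sup>2 + (cmod (v x))\<^sup>2)"
    by (simp add: abs_of_nonneg)
qed

lemma L2_cnj: "u \<in> L2 \<Longrightarrow> (\<lambda>x. cnj (u x)) \<in> L2"
  by (auto simp: L2_def intro: measurable_compose[OF _ borel_measurable_continuous_onI[OF continuous_on_cnj[OF continuous_on_id]]])

lemma L2_lincomb:
  assumes "u \<in> L2" "v \<in> L2"
  shows "(\<lambda>x. u x + c * v x) \<in> L2"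
  unfolding L2_def mem_Collect_eq
proof
  show meas: "(\<lambda>x. u x + c * v x) \<in> borel_measurable lebesgue"
    using assms[THEN L2D(1)] by measurable
  show "integrable lebesgue (\<lambda>x. (cmod (u x + c * v x))\<^sup>2)"
  proof (rule Bochner_Integration.integrable_bound)
    show "integrable lebesgue (\<lambda>x. 2 * (cmod (u x))\<^sup>2 + 2 * (cmod c)\<^sup>2 * (cmod (v x))\<^sup>2)"
      using assms by (intro Bochner_Integration.integrable_add integrable_mult_right L2D)
    have "(cmod (u x + c * v x))\<^sup>2 \<le> 2 * (cmod (u x))\<^sup>2 + 2 * (cmod c)\<^sup>2 * (cmod (v x))\<^sup>2" for x
      using norm_add_square_le[of "u x" "c * v x"] by (simp add: norm_mult power_mult_distrib)
    then show "AE x in lebesgue. norm ((cmod (u x + c * v x))\<^sup>2) \<le> norm (2 * (cmod (u x))\<^sup>2 + 2 * (cmod c)\<^sup>2 * (cmod (v x))\<^sup>2)"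
      by (simp add: abs_of_nonneg)
  qed (use meas in measurable)
qed

lemma inner_L2_self: "inner_L2 u u = complex_of_real (LINT x|lebesgue. (cmod (u x))\<^sup>2)"
proof -
  have "inner_L2 u u = (LINT x|lebesgue. complex_of_real ((cmod (u x))\<^sup>2))"
    unfolding inner_L2_def by (intro Bochner_Integration.integral_cong refl) (metis complex_norm_square mult.commute)
  also have "\<dots> = complex_of_real (LINT x|lebesgue. (cmod (u x))\<^sup>2)" by (rule integral_complex_of_real)
  finally show ?thesis .
qed

interpretation L2: semi_inner L2 inner_L2
  rewrites "semi_inner.nrm inner_L2 = norm_L2"
proof -
  show "semi_inner L2 (inner_L2 :: ('a \<Rightarrow> complex) \<Rightarrow> _)"
  proof
    show "(\<lambda>_::'a. 0) \<in> L2" by (simp add: L2_def)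
    show "(\<lambda>x. u x + c * v x) \<in> L2" if "u \<in> L2" "v \<in> L2" for u v :: "'a \<Rightarrow> complex" and c
      using that by (rule L2_lincomb)
    show "inner_L2 w (\<lambda>x. u x + c * v x) = inner_L2 w u + c * inner_L2 w v"
      if "w \<in> L2" "u \<in> L2" "v \<in> L2" for w u v :: "'a \<Rightarrow> complex" and c
    proof -
      have "inner_L2 w (\<lambda>x. u x + c * v x) = (LINT x|lebesgue. cnj (w x) * u x + c * (cnj (w x) * v x))"
        unfolding inner_L2_def by (simp add: algebra_simps)
      also have "\<dots> = inner_L2 w u + c * inner_L2 w v"
        unfolding inner_L2_def using L2_mult_integrable[OF L2_cnj] that
        by (subst Bochner_Integration.integral_add) auto
      finally show ?thesis .
    qed
    show "inner_L2 u v = cnj (inner_L2 v u)" if "u \<in> L2" "v \<in> L2" for u v :: "'a \<Rightarrow> complex"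
    proof -
      have "inner_L2 u v = (LINT x|lebesgue. cnj (cnj (v x) * u x))"
        unfolding inner_L2_def by (simp add: mult.commute)
      then show ?thesis by (simp only: Bochner_Integration.integral_cnj inner_L2_def)
    qed
    show "0 \<le> Re (inner_L2 u u)" if "u \<in> L2" for u :: "'a \<Rightarrow> complex"
      by (simp add: inner_L2_self)
  qed
  then show "semi_inner.nrm inner_L2 = (norm_L2 :: ('a \<Rightarrow> complex) \<Rightarrow> _)"
    by (simp add: fun_eq_iff semi_inner.nrm_def inner_L2_self norm_L2_def)
qed

lemma norm_L2_sq: "(norm_L2 u)\<^sup>2 = (LINT x|lebesgue. (cmod (u x))\<^sup>2)"
  by (simp add: norm_L2_def)

lemma norm_L2_nonneg: "0 \<le> norm_L2 u"
  by (simp add: norm_L2_def)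

lemma norm_L2_cong_AE:
  assumes "u \<in> borel_measurable lebesgue" "v \<in> borel_measurable lebesgue" "AE x in lebesgue. u x = v x"
  shows "norm_L2 u = norm_L2 v"
  unfolding norm_L2_def using assms by (intro arg_cong[of _ _ sqrt] integral_cong_AE) auto

lemma L2_cong_AE:
  assumes "u \<in> L2" "v \<in> borel_measurable lebesgue" "AE x in lebesgue. u x = v x"
  shows "v \<in> L2"
proof -
  have "integrable lebesgue (\<lambda>x. (cmod (v x))\<^sup>2)"
    by (rule Bochner_Integration.integrable_cong_AE_imp[OF L2D(2)[OF assms(1)]]) (use assms in auto)
  then show ?thesis using assms(2) by (simp add: L2_def)
qed

lemma inner_L2_cong_AE:
  assumes "u \<in> L2" "v \<in> L2" "u' \<in> L2" "v' \<in> L2"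
    and "AE x in lebesgue. u x = u' x" "AE x in lebesgue. v x = v' x"
  shows "inner_L2 u v = inner_L2 u' v'"
  unfolding inner_L2_def
  using assms(5,6) L2D(1)[OF L2_cnj[OF assms(1)]] L2D(1)[OF L2_cnj[OF assms(3)]] assms(2,4)[THEN L2D(1)]
  by (intro integral_cong_AE) auto

lemma norm_L2_eq_0_iff:
  assumes "u \<in> L2" shows "norm_L2 u = 0 \<longleftrightarrow> (AE x in lebesgue. u x = 0)"
  using integral_nonneg_eq_0_iff_AE[OF L2D(2)[OF assms]] by (simp add: norm_L2_def)

text \<open>The square root of a strictly positive integrable function, which exists because Lebesgue measure is
  \<open>\<sigma>\<close>-finite.\<close>

lemma ex_positive_L2: "\<exists>\<rho>::'a::euclidean_space \<Rightarrow> real. (\<forall>x. 0 < \<rho> x) \<and> (\<lambda>x. complex_of_real (\<rho> x)) \<in> L2"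
proof -
  obtain h :: "'a \<Rightarrow> ennreal" where h[measurable]: "h \<in> borel_measurable lborel"
    and fin: "integral\<^sup>N lborel h \<noteq> \<infinity>" and pos: "\<And>x. 0 < h x \<and> h x < \<infinity>"
    using sigma_finite_measure.Ex_finite_integrable_function[OF lborel.sigma_finite_measure_axioms] by auto
  define \<rho> where "\<rho> x = sqrt (enn2real (h x))" for x
  have [measurable]: "\<rho> \<in> borel_measurable borel" unfolding \<rho>_def using h by simp
  have p: "0 < \<rho> x" for x using pos[of x] by (simp add: \<rho>_def enn2real_positive_iff)
  have "(\<integral>\<^sup>+x. ennreal ((\<rho> x)\<^sup>2) \<partial>lborel) = integral\<^sup>N lborel h"
    by (rule nn_integral_cong) (use pos in \<open>auto simp: \<rho>_def\<close>)
  then have "integrable lborel (\<lambda>x. (\<rho> x)\<^sup>2)"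
    using fin by (intro integrableI_bounded) (auto simp: less_top)
  then have "integrable lebesgue (\<lambda>x. (\<rho> x)\<^sup>2)"
    by (subst integrable_completion) auto
  moreover have "(\<lambda>x. complex_of_real (\<rho> x)) \<in> borel_measurable lebesgue"
    by (rule measurable_completion) simp
  ultimately have "(\<lambda>x. complex_of_real (\<rho> x)) \<in> L2" by (simp add: L2_def)
  with p show ?thesis by blast
qed

text \<open>Multiplying by a strictly positive weight \<open>\<rho>\<close> from \<open>L\<^sup>2\<close> turns an
  \<open>L\<^sup>2\<close> Cauchy sequence into an \<open>L\<^sup>1\<close> Cauchy sequence, which has an almost
  everywhere convergent subsequence. The limit along that subsequence is part of the conclusion
  because the potential term of the form is later treated with the same subsequence.\<close>

lemma L2_cauchy_limit:
  assumes "L2.cauchy f"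
  obtains u r where "u \<in> L2" "strict_mono r" "AE x in lebesgue. (\<lambda>n. f (r n) x) \<longlonglongrightarrow> u x"
    "(\<lambda>n. norm_L2 (\<lambda>x. f n x - u x)) \<longlonglongrightarrow> 0"
proof -
  have fL: "f n \<in> L2" for n using assms by (simp add: L2.cauchy_def)
  have fC: "\<exists>N. \<forall>m\<ge>N. \<forall>n\<ge>N. norm_L2 (\<lambda>x. f m x - f n x) < e" if "e > 0" for e
    using assms that by (simp add: L2.cauchy_def)
  have [measurable]: "f n \<in> borel_measurable lebesgue" for n using fL L2D by blast
  obtain \<rho> :: "'a \<Rightarrow> real" where \<rho>: "\<And>x. 0 < \<rho> x" and \<rho>L: "(\<lambda>x. complex_of_real (\<rho> x)) \<in> L2"
    using ex_positive_L2 by blast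
  define s where "s n x = complex_of_real (\<rho> x) * f n x" for n x
  have sint: "integrable lebesgue (s n)" for n
    unfolding s_def by (rule L2_mult_integrable[OF \<rho>L fL])
  let ?R = "norm_L2 (\<lambda>x. complex_of_real (\<rho> x))"
  have sle: "(LINT x|lebesgue. norm (s i x - s j x)) \<le> ?R * norm_L2 (\<lambda>x. f i x - f j x)" for i j
  proof -
    define d where "d x = complex_of_real (cmod (f i x - f j x))" for x
    have fd: "(\<lambda>x. f i x - f j x) \<in> L2" by (intro L2.diff_mem fL)
    have "d \<in> borel_measurable lebesgue" unfolding d_def[abs_def] by measurable
    then have dL: "d \<in> L2" using L2D[OF fd] by (simp add: d_def L2_def)
    have nd: "norm_L2 d = norm_L2 (\<lambda>x. f i x - f j x)" by (simp add: norm_L2_def d_def)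
    have "inner_L2 (\<lambda>x. complex_of_real (\<rho> x)) d = (LINT x|lebesgue. complex_of_real (norm (s i x - s j x)))"
      unfolding inner_L2_def d_def s_def using \<rho>
      by (intro Bochner_Integration.integral_cong) (auto simp: norm_mult less_imp_le simp flip: right_diff_distrib)
    also have "\<dots> = complex_of_real (LINT x|lebesgue. norm (s i x - s j x))" by (rule integral_complex_of_real)
    finally have "(LINT x|lebesgue. norm (s i x - s j x)) \<le> cmod (inner_L2 (\<lambda>x. complex_of_real (\<rho> x)) d)"
      by simp
    also have "\<dots> \<le> ?R * norm_L2 d" by (rule L2.cauchy_schwarz[OF \<rho>L dL])
    finally show ?thesis by (simp add: nd)
  qed
  have sC: "\<exists>N. \<forall>i\<ge>N. \<forall>j\<ge>N. LINT x|lebesgue. norm (s i x - s j x) < e" if e: "e > 0" for e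
  proof -
    have R: "?R + 1 > 0" using norm_L2_nonneg[of "\<lambda>x. complex_of_real (\<rho> x)"] by simp
    obtain N where N: "\<forall>m\<ge>N. \<forall>n\<ge>N. norm_L2 (\<lambda>x. f m x - f n x) < e / (?R + 1)"
      using fC[of "e / (?R + 1)"] e R by auto
    have "LINT x|lebesgue. norm (s i x - s j x) < e" if "i \<ge> N" "j \<ge> N" for i j
    proof -
      have "?R * norm_L2 (\<lambda>x. f i x - f j x) \<le> (?R + 1) * norm_L2 (\<lambda>x. f i x - f j x)"
        by (intro mult_right_mono norm_L2_nonneg) simp
      also have "\<dots> < e" using N that R by (simp add: field_simps)
      finally show ?thesis using sle[of i j] by linarith
    qed
    then show ?thesis by blast
  qed
  obtain r where r: "strict_mono r" and AEC: "AE x in lebesgue. Cauchy (\<lambda>i. s (r i) x)"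
    using cauchy_L1_AE_cauchy_subseq[OF sint sC] by blast
  define u where "u x = lim (\<lambda>i. f (r i) x)" for x
  have [measurable]: "u \<in> borel_measurable lebesgue" unfolding u_def by measurable
  have lim: "AE x in lebesgue. (\<lambda>n. f (r n) x) \<longlonglongrightarrow> u x"
    using AEC
  proof eventually_elim
    fix x assume "Cauchy (\<lambda>i. s (r i) x)"
    then have "convergent (\<lambda>i. s (r i) x)" by (simp add: Cauchy_convergent_iff)
    then have "convergent (\<lambda>i. inverse (complex_of_real (\<rho> x)) * s (r i) x)"
      by (intro convergent_mult convergent_const)
    moreover have "inverse (complex_of_real (\<rho> x)) * s (r i) x = f (r i) x" for i
      using \<rho>[of x] by (simp add: s_def)
    ultimately show "(\<lambda>n. f (r n) x) \<longlonglongrightarrow> u x" by (simp add: u_def convergent_LIMSEQ_iff)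
  qed
  have close: "integrable lebesgue (\<lambda>x. (cmod (f n x - u x))\<^sup>2) \<and> norm_L2 (\<lambda>x. f n x - u x) \<le> e"
    if e: "e > 0" and N: "\<forall>m\<ge>N. \<forall>n\<ge>N. norm_L2 (\<lambda>x. f m x - f n x) < e" and n: "n \<ge> N" for e N n
  proof -
    have int: "integrable lebesgue (\<lambda>x. (cmod (f n x - f (r i) x))\<^sup>2)" for i
      by (intro L2D L2.diff_mem fL)
    have *: "AE x in lebesgue. (\<lambda>i. (cmod (f n x - f (r i) x))\<^sup>2) \<longlonglongrightarrow> (cmod (f n x - u x))\<^sup>2"
      using lim by eventually_elim (intro tendsto_intros)
    have "(LINT x|lebesgue. (cmod (f n x - f (r i) x))\<^sup>2) \<le> e\<^sup>2" if "i \<ge> N" for i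
      unfolding norm_L2_sq[symmetric]
      using N n that seq_suble[OF r, of i] by (intro power_mono norm_L2_nonneg less_imp_le) auto
    then have **: "\<forall>\<^sub>F i in sequentially. (LINT x|lebesgue. (cmod (f n x - f (r i) x))\<^sup>2) \<le> e\<^sup>2"
      unfolding eventually_sequentially by blast
    have I: "integrable lebesgue (\<lambda>x. (cmod (f n x - u x))\<^sup>2)" and le: "(LINT x|lebesgue. (cmod (f n x - u x))\<^sup>2) \<le> e\<^sup>2"
      by (rule fatou_bound[OF int _ * _ **]; simp)+
    have "(norm_L2 (\<lambda>x. f n x - u x))\<^sup>2 \<le> e\<^sup>2" using le by (simp add: norm_L2_sq)
    then have "norm_L2 (\<lambda>x. f n x - u x) \<le> e" by (rule power2_le_imp_le) (use e in simp)
    with I show ?thesis by blast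
  qed
  obtain N1 where N1: "\<forall>m\<ge>N1. \<forall>n\<ge>N1. norm_L2 (\<lambda>x. f m x - f n x) < 1" using fC[of 1] by auto
  have "(\<lambda>x. f N1 x - u x) \<in> L2"
    using close[OF _ N1, of N1] by (simp add: L2_def)
  from L2.diff_mem[OF fL[of N1] this] have uL: "u \<in> L2" by simp
  have "(\<lambda>n. norm_L2 (\<lambda>x. f n x - u x)) \<longlonglongrightarrow> 0"
  proof (rule LIMSEQ_I)
    fix e :: real assume e: "e > 0"
    then obtain N where N: "\<forall>m\<ge>N. \<forall>n\<ge>N. norm_L2 (\<lambda>x. f m x - f n x) < e / 2" using fC[of "e/2"] by auto
    have "norm (norm_L2 (\<lambda>x. f n x - u x) - 0) < e" if "n \<ge> N" for n
      using close[OF _ N that] e norm_L2_nonneg[of "\<lambda>x. f n x - u x"] by auto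
    then show "\<exists>no. \<forall>n\<ge>no. norm (norm_L2 (\<lambda>x. f n x - u x) - 0) < e" by blast
  qed
  with uL r lim show thesis by (rule that)
qed

section \<open>Test functions\<close>

text \<open>For \<open>p = 1\<close> this is the smooth function that is flat to infinite order at \<open>0\<close>. Allowing a polynomial
  in \<open>1 / t\<close> as a factor gives a family that is closed under differentiation.\<close>

definition flat :: "real poly \<Rightarrow> real \<Rightarrow> real" where
  "flat p t = (if t > 0 then poly p (1 / t) * exp (- 1 / t) else 0)"

lemma poly_div_exp_tendsto_0: "((\<lambda>s. poly q s * exp (- s)) \<longlongrightarrow> (0::real)) at_top"
proof -
  have "((\<lambda>s. \<Sum>i\<le>degree q. coeff q i * (s ^ i / exp s)) \<longlongrightarrow> (\<Sum>i\<le>degree q. coeff q i * 0)) at_top"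
    by (intro tendsto_sum tendsto_mult tendsto_const tendsto_power_div_exp_0)
  moreover have "(\<Sum>i\<le>degree q. coeff q i * (s ^ i / exp s)) = poly q s * exp (- s)" for s
    unfolding poly_altdef sum_distrib_right by (rule sum.cong) (simp_all add: exp_minus divide_inverse)
  ultimately show ?thesis by simp
qed

text \<open>At \<open>0\<close> the difference quotient is again a polynomial in \<open>1 / t\<close> times \<open>exp (- 1 / t)\<close>,
  which tends to \<open>0\<close> from the right.\<close>

lemma flat_has_derivative:
  "(flat p has_real_derivative flat ([:0, 0, 1:] * (p - pderiv p)) t) (at t)"
proof -
  consider "t > 0" | "t < 0" | "t = 0" by linarith
  then show ?thesis
  proof cases
    case 1
    have "((\<lambda>t. poly p (1 / t) * exp (- 1 / t)) has_real_derivative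
        poly (pderiv p) (1 / t) * (- 1 / t\<^sup>2) * exp (- 1 / t) + poly p (1 / t) * (exp (- 1 / t) * (1 / t\<^sup>2))) (at t)"
      using 1 by (auto intro!: derivative_eq_intros DERIV_chain2[OF poly_DERIV] simp: power2_eq_square field_simps)
    moreover have "poly (pderiv p) (1 / t) * (- 1 / t\<^sup>2) * exp (- 1 / t) + poly p (1 / t) * (exp (- 1 / t) * (1 / t\<^sup>2))
        = flat ([:0, 0, 1:] * (p - pderiv p)) t"
      using 1 by (simp add: flat_def power2_eq_square field_simps)
    ultimately have "((\<lambda>t. poly p (1 / t) * exp (- 1 / t)) has_real_derivative flat ([:0, 0, 1:] * (p - pderiv p)) t) (at t)"
      by simp
    then show ?thesis
    proof (rule has_field_derivative_transform_within_open)
      show "open {0::real<..}" "t \<in> {0<..}" using 1 by auto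
    qed (simp add: flat_def)
  next
    case 2
    have "((\<lambda>_. 0) has_real_derivative flat ([:0, 0, 1:] * (p - pderiv p)) t) (at t)"
      using 2 by (simp add: flat_def)
    then show ?thesis
    proof (rule has_field_derivative_transform_within_open)
      show "open {..<0::real}" "t \<in> {..<0}" using 2 by auto
    qed (simp add: flat_def)
  next
    case 3
    have r: "((\<lambda>h. flat p h / h) \<longlongrightarrow> 0) (at_right 0)"
    proof -
      have "((\<lambda>h. poly (pCons 0 p) (inverse h) * exp (- inverse h)) \<longlongrightarrow> 0) (at_right (0::real))"
        by (rule filterlim_compose[OF poly_div_exp_tendsto_0 filterlim_inverse_at_top_right])
      moreover have "\<forall>\<^sub>F h in at_right (0::real). poly (pCons 0 p) (inverse h) * exp (- inverse h) = flat p h / h"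
        using eventually_at_right_less by eventually_elim (simp add: flat_def inverse_eq_divide)
      ultimately show ?thesis by (rule Lim_transform_eventually)
    qed
    have l: "((\<lambda>h. flat p h / h) \<longlongrightarrow> 0) (at_left 0)"
      by (rule Lim_transform_eventually[OF tendsto_const])
        (auto simp: eventually_at_left[of "-1"] flat_def intro: exI[of _ "-1"])
    have "((\<lambda>h. flat p h / h) \<longlongrightarrow> 0) (at 0)"
      using l r by (rule filterlim_split_at)
    moreover have "flat q 0 = 0" for q by (simp add: flat_def)
    ultimately show ?thesis by (simp add: 3 DERIV_def)
  qed
qed

lemma flat_one_bounds: "0 \<le> flat 1 t" "flat 1 t \<le> 1" "flat 1 t \<noteq> 0 \<longleftrightarrow> 0 < t"
  by (auto simp: flat_def)

lemma flat_one_tendsto: "(\<lambda>n. flat 1 (real (Suc n) * t)) \<longlonglongrightarrow> (if 0 < t then 1 else 0)"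
proof (cases "0 < t")
  case True
  have "(\<lambda>n. exp (- (inverse (real (Suc n)) * (1 / t)))) \<longlonglongrightarrow> exp (- (0 * (1 / t)))"
    by (intro tendsto_intros LIMSEQ_inverse_real_of_nat)
  moreover have "exp (- (inverse (real (Suc n)) * (1 / t))) = flat 1 (real (Suc n) * t)" for n
    using True by (simp add: flat_def inverse_eq_divide del: of_nat_Suc)
  ultimately show ?thesis using True by simp
next
  case False
  then have "flat 1 (real (Suc n) * t) = 0" for n
    by (simp add: flat_def not_less mult_nonneg_nonpos del: of_nat_Suc)
  then show ?thesis using False by simp
qed

lemma partial_deriv_eq: "(f has_derivative f') (at x) \<Longrightarrow> partial_deriv i f x = f' i"
  unfolding partial_deriv_def using frechet_derivative_at by metis

lemma Ck_continuous: "Ck k f \<Longrightarrow> continuous_on UNIV f"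
  by (cases k) (auto intro!: differentiable_imp_continuous_on simp: differentiable_on_def)

lemma Ck_SucD: "Ck (Suc k) f \<Longrightarrow> Ck k f"
proof (induction k arbitrary: f)
  case 0
  have "continuous_on UNIV f" by (rule Ck_continuous[OF 0])
  then show ?case by simp
qed auto

lemma Ck_const: "Ck k (\<lambda>_. c)"
proof (induction k arbitrary: c)
  case (Suc k)
  have "partial_deriv i (\<lambda>_. c) = (\<lambda>_::'a. 0)" for i
    by (rule ext, subst partial_deriv_eq[where f' = "\<lambda>_. 0"]) auto
  then show ?case using Suc by auto
qed simp

lemma Ck_add: "Ck k f \<Longrightarrow> Ck k g \<Longrightarrow> Ck k (\<lambda>x. f x + g x)"
proof (induction k arbitrary: f g)
  case 0
  then show ?case by (auto intro: continuous_on_add)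
next
  case (Suc k)
  have "partial_deriv i (\<lambda>x. f x + g x) = (\<lambda>x. partial_deriv i f x + partial_deriv i g x)" for i
    using Suc.prems
    by (intro ext, subst partial_deriv_eq[OF has_derivative_add])
      (auto simp: partial_deriv_def frechet_derivative_works[symmetric])
  then show ?case using Suc by auto
qed

lemma Ck_mult:
  fixes f g :: "'a::euclidean_space \<Rightarrow> complex"
  shows "Ck k f \<Longrightarrow> Ck k g \<Longrightarrow> Ck k (\<lambda>x. f x * g x)"
proof (induction k arbitrary: f g)
  case 0
  then show ?case by (auto intro: continuous_on_mult)
next
  case (Suc k)
  have "partial_deriv i (\<lambda>x. f x * g x) = (\<lambda>x. f x * partial_deriv i g x + partial_deriv i f x * g x)" for i
    using Suc.prems
    by (intro ext, subst partial_deriv_eq[OF has_derivative_mult])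
      (auto simp: partial_deriv_def frechet_derivative_works[symmetric])
  moreover have "Ck k f" "Ck k g" using Suc.prems Ck_SucD by blast+
  ultimately show ?case using Suc.prems by (auto intro!: Ck_add Suc.IH)
qed

lemma Ck_prod:
  fixes f :: "'i \<Rightarrow> 'a::euclidean_space \<Rightarrow> complex"
  shows "(\<And>i. i \<in> I \<Longrightarrow> Ck k (f i)) \<Longrightarrow> Ck k (\<lambda>x. \<Prod>i\<in>I. f i x)"
  by (induction I rule: infinite_finite_induct) (auto intro: Ck_const Ck_mult)

lemma Ck_flat: "Ck k (\<lambda>x::'a::euclidean_space. complex_of_real (flat p (x \<bullet> w + s)))"
proof (induction k arbitrary: p)
  case 0
  have "continuous_on UNIV (flat p)"
    by (meson flat_has_derivative DERIV_isCont continuous_at_imp_continuous_on)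
  then show ?case
    by (auto intro!: continuous_intros intro: continuous_on_compose2)
next
  case (Suc k)
  let ?q = "[:0, 0, 1:] * (p - pderiv p)"
  have D: "((\<lambda>x. complex_of_real (flat p (x \<bullet> w + s))) has_derivative
      (\<lambda>h. complex_of_real (flat ?q (x \<bullet> w + s) * (h \<bullet> w)))) (at x)" for x :: 'a
  proof -
    have "((\<lambda>x. x \<bullet> w + s) has_derivative (\<lambda>h. h \<bullet> w)) (at x)"
      by (auto intro!: derivative_eq_intros)
    from has_derivative_compose[OF this flat_has_derivative[of p "x \<bullet> w + s", unfolded has_field_derivative_def]]
    show ?thesis by (intro has_derivative_of_real)
  qed
  have "partial_deriv i (\<lambda>x. complex_of_real (flat p (x \<bullet> w + s)))
      = (\<lambda>x. complex_of_real (flat ?q (x \<bullet> w + s)) * complex_of_real (i \<bullet> w))" for i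
    using partial_deriv_eq[OF D, of i] by (intro ext) simp
  then show ?case using Suc D by (auto intro!: Ck_mult Ck_const simp: differentiable_def)
qed

text \<open>Composition with a translation commutes with every partial derivative.\<close>

lemma Ck_translate: "Ck k f \<Longrightarrow> Ck k (\<lambda>x. f (x - h))"
proof (induction k arbitrary: f)
  case 0
  then show ?case by (auto intro!: continuous_intros intro: continuous_on_compose2)
next
  case (Suc k)
  have D: "((\<lambda>x. f (x - h)) has_derivative frechet_derivative f (at (x - h))) (at x)" for x
  proof -
    have "((\<lambda>x. x - h) has_derivative (\<lambda>d. d)) (at x)"
      by (auto intro!: derivative_eq_intros)
    moreover have "(f has_derivative frechet_derivative f (at (x - h))) (at (x - h))"
      using Suc.prems by (simp add: frechet_derivative_works[symmetric])
    ultimately show ?thesis by (rule has_derivative_compose)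
  qed
  have "partial_deriv i (\<lambda>x. f (x - h)) = (\<lambda>x. partial_deriv i f (x - h))" for i
    using partial_deriv_eq[OF D, of i] by (intro ext) (simp add: partial_deriv_def)
  then show ?case using Suc D by (auto simp: differentiable_def)
qed

lemma test_function_translate:
  assumes "test_function \<phi>" shows "test_function (\<lambda>x. \<phi> (x - h))"
proof -
  have "{x. \<phi> (x - h) \<noteq> 0} = (+) h ` {x. \<phi> x \<noteq> 0}"
    by (auto simp: image_iff) (metis add.commute diff_add_cancel)
  then have "closure {x. \<phi> (x - h) \<noteq> 0} = (+) h ` closure {x. \<phi> x \<noteq> 0}"
    by (simp add: closure_translation)
  then show ?thesis using assms by (auto simp: test_function_def intro: Ck_translate compact_translation)
qed

lemma partial_deriv_translate:
  assumes "test_function \<phi>" shows "partial_deriv i (\<lambda>x. \<phi> (x - h)) x = partial_deriv i \<phi> (x - h)"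
proof -
  have "((\<lambda>x. x - h) has_derivative (\<lambda>d. d)) (at x)"
    by (auto intro!: derivative_eq_intros)
  moreover have "\<phi> differentiable at (x - h)"
    using assms Ck.simps(2)[of 0 \<phi>] unfolding test_function_def by blast
  then have "(\<phi> has_derivative frechet_derivative \<phi> (at (x - h))) (at (x - h))"
    by (simp add: frechet_derivative_works[symmetric])
  ultimately have "((\<lambda>x. \<phi> (x - h)) has_derivative frechet_derivative \<phi> (at (x - h))) (at x)"
    by (rule has_derivative_compose)
  then show ?thesis using partial_deriv_eq by (fastforce simp: partial_deriv_def)
qed

lemma test_function_partial:
  assumes "test_function \<phi>" "i \<in> Basis"
  shows "test_function (partial_deriv i \<phi>)"
proof -
  have "Ck k (partial_deriv i \<phi>)" for k
  proof -
    have "Ck (Suc k) \<phi>" using assms by (auto simp: test_function_def)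
    then show ?thesis using assms(2) by simp
  qed
  moreover have "{x. partial_deriv i \<phi> x \<noteq> 0} \<subseteq> closure {x. \<phi> x \<noteq> 0}"
  proof
    fix x assume x: "x \<in> {x. partial_deriv i \<phi> x \<noteq> 0}"
    show "x \<in> closure {x. \<phi> x \<noteq> 0}"
    proof (rule ccontr)
      assume nx: "x \<notin> closure {x. \<phi> x \<noteq> 0}"
      have "((\<lambda>_. 0) has_derivative (\<lambda>_. 0)) (at x)" by simp
      then have "(\<phi> has_derivative (\<lambda>_. 0)) (at x)"
      proof (rule has_derivative_transform_within_open)
        show "open (- closure {x. \<phi> x \<noteq> 0})" "x \<in> - closure {x. \<phi> x \<noteq> 0}" using nx by auto
        show "0 = \<phi> y" if "y \<in> - closure {x. \<phi> x \<noteq> 0}" for y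
          using that closure_subset[of "{x. \<phi> x \<noteq> 0}"] by auto
      qed
      then show False using x partial_deriv_eq by fastforce
    qed
  qed
  then have "closure {x. partial_deriv i \<phi> x \<noteq> 0} \<subseteq> closure {x. \<phi> x \<noteq> 0}"
    by (simp add: closure_minimal)
  then have "compact (closure {x. partial_deriv i \<phi> x \<noteq> 0})"
    using assms(1) compact_Int_closed[of "closure {x. \<phi> x \<noteq> 0}" "closure {x. partial_deriv i \<phi> x \<noteq> 0}"]
    by (auto simp: test_function_def Int_absorb1)
  ultimately show ?thesis by (simp add: test_function_def)
qed

lemma test_function_continuous: "test_function \<phi> \<Longrightarrow> continuous_on UNIV \<phi>"
  unfolding test_function_def using Ck_continuous by blast

lemma test_function_borel: "test_function \<phi> \<Longrightarrow> \<phi> \<in> borel_measurable borel"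
  by (simp add: borel_measurable_continuous_onI test_function_continuous)

lemma test_function_L2:
  assumes "test_function \<phi>" shows "\<phi> \<in> L2"
proof -
  let ?K = "closure {x. \<phi> x \<noteq> 0}"
  have "integrable lborel (\<lambda>x. indicator ?K x *\<^sub>R (cmod (\<phi> x))\<^sup>2)"
    using assms test_function_continuous[OF assms]
    by (intro borel_integrable_compact) (auto simp: test_function_def intro!: continuous_intros intro: continuous_on_subset)
  moreover have "indicator ?K x *\<^sub>R (cmod (\<phi> x))\<^sup>2 = (cmod (\<phi> x))\<^sup>2" for x
    using closure_subset[of "{x. \<phi> x \<noteq> 0}"] by (cases "\<phi> x = 0") (auto simp: indicator_def)
  ultimately have "integrable lborel (\<lambda>x. (cmod (\<phi> x))\<^sup>2)" by (simp only:)
  then have "integrable lebesgue (\<lambda>x. (cmod (\<phi> x))\<^sup>2)"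
    using test_function_borel[OF assms] by (subst integrable_completion) auto
  moreover have "\<phi> \<in> borel_measurable lebesgue"
    by (rule measurable_completion) (simp add: test_function_borel[OF assms])
  ultimately show ?thesis by (simp add: L2_def)
qed

text \<open>A product of flat functions that vanishes exactly off the box with corners \<open>a\<close> and \<open>b\<close>.
  Since \<open>exp (- 1 / (n t))\<close> tends to \<open>1\<close> for \<open>t > 0\<close>, these functions tend to the indicator
  of the box.\<close>

definition bump :: "'a::euclidean_space \<Rightarrow> 'a \<Rightarrow> nat \<Rightarrow> 'a \<Rightarrow> complex" where
  "bump a b n x = (\<Prod>i\<in>Basis. complex_of_real (flat 1 (real (Suc n) * ((x - a) \<bullet> i)))
     * complex_of_real (flat 1 (real (Suc n) * ((b - x) \<bullet> i))))"

lemma bump_nonzero_iff: "bump a b n x \<noteq> 0 \<longleftrightarrow> x \<in> box a b"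
  unfolding bump_def by (auto simp: flat_one_bounds(3) box_def zero_less_mult_iff inner_diff_left simp del: of_nat_Suc)

lemma bump_norm_le_1: "cmod (bump a b n x) \<le> 1"
  unfolding bump_def prod_norm[symmetric]
  by (rule prod_le_1) (auto simp: norm_mult flat_one_bounds intro: mult_le_one)

lemma bump_tendsto: "(\<lambda>n. bump a b n x) \<longlonglongrightarrow> indicator (box a b) x"
proof -
  have "(\<lambda>n. bump a b n x) \<longlonglongrightarrow> (\<Prod>i\<in>Basis. complex_of_real (if 0 < (x - a) \<bullet> i then 1 else 0)
      * complex_of_real (if 0 < (b - x) \<bullet> i then 1 else 0))"
    unfolding bump_def by (intro tendsto_prod tendsto_mult tendsto_of_real flat_one_tendsto)
  moreover have "(\<Prod>i\<in>Basis. complex_of_real (if 0 < (x - a) \<bullet> i then 1 else 0)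
      * complex_of_real (if 0 < (b - x) \<bullet> i then 1 else 0)) = indicator (box a b) x"
    by (cases "x \<in> box a b") (auto simp: box_def inner_diff_left intro!: prod.neutral)
  ultimately show ?thesis by simp
qed

lemma test_function_bump: "test_function (bump a b n)"
  unfolding test_function_def
proof (intro conjI allI)
  fix k
  have "flat 1 (real (Suc n) * ((x - a) \<bullet> i)) = flat 1 (x \<bullet> (real (Suc n) *\<^sub>R i) + (- real (Suc n) * (a \<bullet> i)))"
    "flat 1 (real (Suc n) * ((b - x) \<bullet> i)) = flat 1 (x \<bullet> (- real (Suc n) *\<^sub>R i) + real (Suc n) * (b \<bullet> i))" for x i :: 'a
    by (simp_all add: inner_diff_left algebra_simps)
  then show "Ck k (bump a b n)"
    unfolding bump_def[abs_def] by (simp only:) (intro Ck_prod Ck_mult Ck_flat)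
  have "closure (box a b) \<subseteq> cbox a b" by (intro closure_minimal box_subset_cbox closed_cbox)
  then show "compact (closure {x. bump a b n x \<noteq> 0})"
    unfolding bump_nonzero_iff using compact_Int_closed[OF compact_cbox closed_closure, of a b "box a b"]
    by (simp add: Int_absorb1)
qed

lemma indicator_L2:
  assumes "A \<in> lmeasurable" shows "(\<lambda>x. indicator A x :: complex) \<in> L2"
proof -
  have [measurable]: "A \<in> sets lebesgue" using assms by auto
  have "(\<lambda>x. (cmod (indicator A x))\<^sup>2) = (indicator A :: _ \<Rightarrow> real)"
    by (auto simp: indicator_def)
  moreover have "integrable lebesgue (indicator A :: _ \<Rightarrow> real)"
    using assms by (intro integrable_real_indicator) (auto simp: fmeasurable_def)
  moreover have "(\<lambda>x. indicator A x :: complex) \<in> borel_measurable lebesgue" by measurable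
  ultimately show ?thesis by (simp only: L2_def mem_Collect_eq)
qed

section \<open>The fundamental lemma of the calculus of variations\<close>

lemma sigma_finite_lebesgue: "sigma_finite_measure (lebesgue :: 'a::euclidean_space measure)"
proof
  from lborel.sigma_finite_countable
  show "\<exists>A::'a set set. countable A \<and> A \<subseteq> sets lebesgue \<and> \<Union>A = space lebesgue \<and> (\<forall>a\<in>A. emeasure lebesgue a \<noteq> \<infinity>)"
  proof (rule ex_forward, elim conjE, intro conjI ballI)
    fix A :: "'a set set" and a
    assume "A \<subseteq> sets lborel" "\<forall>a\<in>A. emeasure lborel a \<noteq> \<infinity>" "a \<in> A"
    then show "emeasure lebesgue a \<noteq> \<infinity>" by (simp add: subset_iff)
  next
    fix A :: "'a set set" assume "A \<subseteq> sets lborel"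
    then show "A \<subseteq> sets lebesgue" by (simp add: subset_iff)
  qed simp_all
qed

text \<open>The boxes form an intersection-stable generator of the Borel sets, so the integral vanishes over
  every Borel set and hence over every Lebesgue set.\<close>

lemma AE_zero_if_integrable_box_integrals_zero:
  fixes g :: "'a::euclidean_space \<Rightarrow> complex"
  assumes g: "integrable lebesgue g" and total: "(LINT x|lebesgue. g x) = 0"
    and zero: "\<And>a b. (LINT x:box a b|lebesgue. g x) = 0"
  shows "AE x in lebesgue. g x = 0"
proof (rule sigma_finite_measure.density_zero[OF sigma_finite_lebesgue g])
  have gA: "set_integrable lebesgue A g" if "A \<in> sets lebesgue" for A
    unfolding set_integrable_def using that g by (rule integrable_mult_indicator)
  let ?E = "range (\<lambda>(a, b). box a b::'a set)"
  have E: "sets borel = sigma_sets UNIV ?E" by (subst borel_eq_box) simp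
  have st: "Int_stable ?E" by (auto simp: Int_stable_def box_Int_box)
  have PE: "?E \<subseteq> Pow UNIV" by simp
  have bz: "(LINT x:A|lebesgue. g x) = 0" if "A \<in> sigma_sets UNIV ?E" for A :: "'a set"
    using st PE that
  proof (rule sigma_sets_induct_disjoint)
    show "(LINT x:A|lebesgue. g x) = 0" if "A \<in> ?E" for A
      using that zero by auto
    show "(LINT x:{}|lebesgue. g x) = 0" by (simp add: set_lebesgue_integral_def)
  next
    fix A assume A: "A \<in> sigma_sets UNIV ?E" and 0: "(LINT x:A|lebesgue. g x) = 0"
    have "A \<in> sets borel" using A by (simp only: E)
    then have "A \<in> sets lebesgue" by simp
    from gA[OF this] have i: "integrable lebesgue (\<lambda>x. indicator A x *\<^sub>R g x)"
      by (simp only: set_integrable_def)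
    have "(LINT x:(UNIV - A)|lebesgue. g x) = (LINT x|lebesgue. g x - indicator A x *\<^sub>R g x)"
      unfolding set_lebesgue_integral_def
      by (intro Bochner_Integration.integral_cong) (auto simp: indicator_def)
    also have "\<dots> = (LINT x|lebesgue. g x) - (LINT x:A|lebesgue. g x)"
      unfolding set_lebesgue_integral_def by (rule Bochner_Integration.integral_diff[OF g i])
    finally show "(LINT x:(UNIV - A)|lebesgue. g x) = 0" using 0 total by simp
  next
    fix A :: "nat \<Rightarrow> 'a set"
    assume d: "disjoint_family A" and A: "range A \<subseteq> sigma_sets UNIV ?E" and 0: "\<And>i. (LINT x:A i|lebesgue. g x) = 0"
    have "A i \<in> sets borel" for i using A by (auto simp only: E)
    then have A': "A i \<in> sets lebesgue" for i by simp
    have "(LINT x:(\<Union>i. A i)|lebesgue. g x) = (\<Sum>i. LINT x:A i|lebesgue. g x)"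
    proof (rule lebesgue_integral_countable_add[OF A'])
      show "A i \<inter> A j = {}" if "i \<noteq> j" for i j using d that by (auto simp: disjoint_family_on_def)
      show "set_integrable lebesgue (\<Union>i. A i) g" by (intro gA sets.countable_UN) (use A' in auto)
    qed
    then show "(LINT x:(\<Union>i. A i)|lebesgue. g x) = 0" by (simp add: 0)
  qed
  fix A :: "'a set" assume "A \<in> sets lebesgue"
  from sets_completionE[OF this] obtain S N N' where *: "A = S \<union> N" "N \<subseteq> N'" "N' \<in> null_sets lborel" "S \<in> sets lborel"
    by metis
  have S: "S \<in> sets lebesgue" using *(4) by simp
  have "AE x in lebesgue. x \<notin> N'"
    using *(3) by (intro AE_not_in null_sets_completionI)
  then have "AE x in lebesgue. indicator A x *\<^sub>R g x = indicator S x *\<^sub>R g x"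
    by eventually_elim (use *(1,2) in \<open>auto simp: indicator_def\<close>)
  then have "(LINT x:A|lebesgue. g x) = (LINT x:S|lebesgue. g x)"
    using gA[OF S] gA[OF \<open>A \<in> sets lebesgue\<close>] unfolding set_lebesgue_integral_def set_integrable_def
    by (intro integral_cong_AE borel_measurable_integrable)
  also have "\<dots> = 0" using *(4) by (intro bz) (simp only: E[symmetric] sets_lborel)
  finally show "(LINT x:A|lebesgue. g x) = 0" .
qed

text \<open>The function is only locally integrable, so it is cut off to large boxes first.\<close>

lemma AE_zero_if_box_integrals_zero:
  fixes f :: "'a::euclidean_space \<Rightarrow> complex"
  assumes int: "\<And>a b. set_integrable lebesgue (box a b) f"
    and zero: "\<And>a b. (LINT x:box a b|lebesgue. f x) = 0"
  shows "AE x in lebesgue. f x = 0"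
proof -
  let ?C = "\<lambda>n::nat. box (- (real n *\<^sub>R One)) (real n *\<^sub>R One) :: 'a set"
  have "AE x in lebesgue. indicator (?C n) x *\<^sub>R f x = 0" for n
  proof (rule AE_zero_if_integrable_box_integrals_zero)
    show "integrable lebesgue (\<lambda>x. indicator (?C n) x *\<^sub>R f x)" using int unfolding set_integrable_def .
    show "(LINT x|lebesgue. indicator (?C n) x *\<^sub>R f x) = 0" using zero unfolding set_lebesgue_integral_def .
    fix a b :: 'a
    obtain c d where cd: "box a b \<inter> ?C n = box c d"
      unfolding box_Int_box by blast
    have "(LINT x:box a b|lebesgue. indicator (?C n) x *\<^sub>R f x) = (LINT x:(box a b \<inter> ?C n)|lebesgue. f x)"
      unfolding set_lebesgue_integral_def by (simp add: indicator_inter_arith)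
    then show "(LINT x:box a b|lebesgue. indicator (?C n) x *\<^sub>R f x) = 0" unfolding cd zero .
  qed
  then have "AE x in lebesgue. \<forall>n. indicator (?C n) x *\<^sub>R f x = 0"
    by (intro AE_all_countable[THEN iffD2] allI)
  then show ?thesis
  proof eventually_elim
    fix x assume *: "\<forall>n. indicator (?C n) x *\<^sub>R f x = 0"
    have "x \<in> (\<Union>n. ?C n)" unfolding UN_box_eq_UNIV by simp
    then obtain n where "x \<in> ?C n" by (elim UN_E)
    then show "f x = 0" using *[rule_format, of n] by simp
  qed
qed

text \<open>Testing against the bumps and passing to the limit gives zero integrals over all boxes.\<close>

lemma fundamental_lemma:
  fixes f :: "'a::euclidean_space \<Rightarrow> complex"
  assumes f: "f \<in> L2" and zero: "\<And>\<phi>. test_function \<phi> \<Longrightarrow> (LINT x|lebesgue. f x * \<phi> x) = 0"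
  shows "AE x in lebesgue. f x = 0"
proof (rule AE_zero_if_box_integrals_zero)
  fix a b :: 'a
  have int: "integrable lebesgue (\<lambda>x. f x * indicator (box a b) x)"
    by (intro L2_mult_integrable f indicator_L2) simp
  have eq: "indicator (box a b) x *\<^sub>R f x = f x * indicator (box a b) x" for x
    by (simp add: indicator_def)
  show "set_integrable lebesgue (box a b) f"
    using int by (simp add: set_integrable_def eq)
  have "(\<lambda>n. LINT x|lebesgue. f x * bump a b n x) \<longlonglongrightarrow> (LINT x|lebesgue. f x * indicator (box a b) x)"
  proof (rule integral_dominated_convergence)
    show "integrable lebesgue (\<lambda>x. norm (f x * indicator (box a b) x))" using int by (rule integrable_norm)
    show "(\<lambda>x. f x * bump a b n x) \<in> borel_measurable lebesgue" for n
      by (rule borel_measurable_integrable[OF L2_mult_integrable[OF f test_function_L2[OF test_function_bump]]])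
    show "AE x in lebesgue. (\<lambda>n. f x * bump a b n x) \<longlonglongrightarrow> f x * indicator (box a b) x"
      by (intro AE_I2 tendsto_mult tendsto_const bump_tendsto)
    have "norm (f x * bump a b n x) \<le> norm (f x * indicator (box a b) x)" for n x
      using bump_norm_le_1[of a b n x] bump_nonzero_iff[of a b n x]
      by (cases "x \<in> box a b") (auto simp: norm_mult mult_left_le)
    then show "AE x in lebesgue. norm (f x * bump a b n x) \<le> norm (f x * indicator (box a b) x)" for n by simp
  qed (use int in auto)
  then have "(\<lambda>n. 0) \<longlonglongrightarrow> (LINT x|lebesgue. f x * indicator (box a b) x)"
    using zero[OF test_function_bump] by simp
  then show "(LINT x:box a b|lebesgue. f x) = 0"
    by (simp add: set_lebesgue_integral_def eq LIMSEQ_const_iff)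
qed

section \<open>Weak derivatives and the form domain\<close>

text \<open>Uniqueness makes the chosen weak derivatives depend linearly on the function up to null sets, which
  is what makes the form sesquilinear.\<close>

lemma has_weak_partial_unique:
  assumes "g \<in> L2" "g' \<in> L2" "has_weak_partial i u g" "has_weak_partial i u g'"
  shows "AE x in lebesgue. g x = g' x"
proof -
  have "AE x in lebesgue. g x - g' x = 0"
  proof (rule fundamental_lemma)
    show "(\<lambda>x. g x - g' x) \<in> L2" using assms(1,2) by (rule L2.diff_mem)
    fix \<phi> :: "'a \<Rightarrow> complex" assume \<phi>: "test_function \<phi>"
    have "(LINT x|lebesgue. g x * \<phi> x) = (LINT x|lebesgue. g' x * \<phi> x)"
      using assms(3,4) \<phi> unfolding has_weak_partial_def by (metis neg_equal_iff_equal)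
    then show "(LINT x|lebesgue. (g x - g' x) * \<phi> x) = 0"
      using L2_mult_integrable[OF assms(1) test_function_L2[OF \<phi>]] L2_mult_integrable[OF assms(2) test_function_L2[OF \<phi>]]
      by (simp add: left_diff_distrib)
  qed
  then show ?thesis by simp
qed

lemma has_weak_partial_cong_AE:
  assumes "has_weak_partial i u g" "i \<in> Basis" "u \<in> L2" "u' \<in> L2" "g \<in> L2" "g' \<in> L2"
    and u: "AE x in lebesgue. u x = u' x" and g: "AE x in lebesgue. g x = g' x"
  shows "has_weak_partial i u' g'"
  unfolding has_weak_partial_def
proof (intro allI impI)
  fix \<phi> :: "'a \<Rightarrow> complex" assume \<phi>: "test_function \<phi>"
  note I = borel_measurable_integrable[OF L2_mult_integrable]
  note L = test_function_L2[OF \<phi>] test_function_L2[OF test_function_partial[OF \<phi> assms(2)]]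
  have "(LINT x|lebesgue. u x * partial_deriv i \<phi> x) = (LINT x|lebesgue. u' x * partial_deriv i \<phi> x)"
    by (rule integral_cong_AE[OF I[OF assms(3) L(2)] I[OF assms(4) L(2)]]) (use u in eventually_elim, simp)
  moreover have "(LINT x|lebesgue. g x * \<phi> x) = (LINT x|lebesgue. g' x * \<phi> x)"
    by (rule integral_cong_AE[OF I[OF assms(5) L(1)] I[OF assms(6) L(1)]]) (use g in eventually_elim, simp)
  ultimately show "(LINT x|lebesgue. u' x * partial_deriv i \<phi> x) = - (LINT x|lebesgue. g' x * \<phi> x)"
    using assms(1) \<phi> by (simp add: has_weak_partial_def)
qed

lemma H1_L2: "u \<in> H1 \<Longrightarrow> u \<in> L2"
  by (simp add: H1_def)

lemma weak_partial:
  assumes "u \<in> H1" "i \<in> Basis"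
  shows "weak_partial i u \<in> L2" "has_weak_partial i u (weak_partial i u)"
proof -
  have "\<exists>g. g \<in> L2 \<and> has_weak_partial i u g" using assms by (auto simp: H1_def)
  then have "weak_partial i u \<in> L2 \<and> has_weak_partial i u (weak_partial i u)"
    unfolding weak_partial_def by (rule someI_ex)
  then show "weak_partial i u \<in> L2" "has_weak_partial i u (weak_partial i u)" by auto
qed

lemma has_weak_partial_lincomb:
  assumes "u \<in> L2" "v \<in> L2" "g \<in> L2" "h \<in> L2" "i \<in> Basis"
    and "has_weak_partial i u g" "has_weak_partial i v h"
  shows "has_weak_partial i (\<lambda>x. u x + c * v x) (\<lambda>x. g x + c * h x)"
  unfolding has_weak_partial_def
proof (intro allI impI)
  fix \<phi> :: "'a \<Rightarrow> complex" assume \<phi>: "test_function \<phi>"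
  note I = L2_mult_integrable[OF _ test_function_L2[OF \<phi>]]
    L2_mult_integrable[OF _ test_function_L2[OF test_function_partial[OF \<phi> assms(5)]]]
  have "(LINT x|lebesgue. (u x + c * v x) * partial_deriv i \<phi> x)
      = (LINT x|lebesgue. u x * partial_deriv i \<phi> x + c * (v x * partial_deriv i \<phi> x))"
    by (simp add: algebra_simps)
  also have "\<dots> = (LINT x|lebesgue. u x * partial_deriv i \<phi> x) + c * (LINT x|lebesgue. v x * partial_deriv i \<phi> x)"
    using I(2)[OF assms(1)] I(2)[OF assms(2)] by simp
  also have "\<dots> = - ((LINT x|lebesgue. g x * \<phi> x) + c * (LINT x|lebesgue. h x * \<phi> x))"
    using assms(6,7) \<phi> by (simp add: has_weak_partial_def)
  also have "(LINT x|lebesgue. g x * \<phi> x) + c * (LINT x|lebesgue. h x * \<phi> x)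
      = (LINT x|lebesgue. g x * \<phi> x + c * (h x * \<phi> x))"
    using I(1)[OF assms(3)] I(1)[OF assms(4)] by simp
  also have "\<dots> = (LINT x|lebesgue. (g x + c * h x) * \<phi> x)" by (simp add: algebra_simps)
  finally show "(LINT x|lebesgue. (u x + c * v x) * partial_deriv i \<phi> x) = - (LINT x|lebesgue. (g x + c * h x) * \<phi> x)" .
qed

lemma H1_lincomb:
  assumes "u \<in> H1" "v \<in> H1"
  shows "(\<lambda>x. u x + c * v x) \<in> H1"
proof -
  have "\<exists>g\<in>L2. has_weak_partial i (\<lambda>x. u x + c * v x) g" if "i \<in> Basis" for i
    using assms that weak_partial
    by (intro bexI[of _ "\<lambda>x. weak_partial i u x + c * weak_partial i v x"] has_weak_partial_lincomb L2_lincomb)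
      (auto simp: H1_L2)
  then show ?thesis using assms by (auto simp: H1_def intro: L2_lincomb)
qed

lemma weak_partial_lincomb:
  assumes "u \<in> H1" "v \<in> H1" "i \<in> Basis"
  shows "AE x in lebesgue. weak_partial i (\<lambda>x. u x + c * v x) x = weak_partial i u x + c * weak_partial i v x"
proof (rule has_weak_partial_unique)
  note W = weak_partial[OF assms(1,3)] weak_partial[OF assms(2,3)]
  show "has_weak_partial i (\<lambda>x. u x + c * v x) (\<lambda>x. weak_partial i u x + c * weak_partial i v x)"
    by (rule has_weak_partial_lincomb[OF H1_L2[OF assms(1)] H1_L2[OF assms(2)] W(1,3) assms(3) W(2,4)])
  show "(\<lambda>x. weak_partial i u x + c * weak_partial i v x) \<in> L2" by (rule L2_lincomb[OF W(1,3)])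
qed (rule weak_partial[OF H1_lincomb[OF assms(1,2)] assms(3)])+

text \<open>For a fixed test function, both sides of the defining identity are continuous in \<open>L\<^sup>2\<close>.\<close>

lemma has_weak_partial_limit:
  assumes "\<And>n. f n \<in> L2" "\<And>n. g n \<in> L2" "u \<in> L2" "h \<in> L2" "i \<in> Basis"
    and "\<And>n. has_weak_partial i (f n) (g n)"
    and "(\<lambda>n. norm_L2 (\<lambda>x. f n x - u x)) \<longlonglongrightarrow> 0" "(\<lambda>n. norm_L2 (\<lambda>x. g n x - h x)) \<longlonglongrightarrow> 0"
  shows "has_weak_partial i u h"
  unfolding has_weak_partial_def
proof (intro allI impI)
  fix \<phi> :: "'a \<Rightarrow> complex" assume \<phi>: "test_function \<phi>"
  have "(\<lambda>n. inner_L2 (\<lambda>x. cnj (partial_deriv i \<phi> x)) (f n)) \<longlonglongrightarrow> inner_L2 (\<lambda>x. cnj (partial_deriv i \<phi> x)) u"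
    by (rule L2.B_tendsto[OF assms(1,3) L2_cnj[OF test_function_L2[OF test_function_partial[OF \<phi> assms(5)]]] assms(7)])
  then have 1: "(\<lambda>n. LINT x|lebesgue. f n x * partial_deriv i \<phi> x) \<longlonglongrightarrow> (LINT x|lebesgue. u x * partial_deriv i \<phi> x)"
    by (simp add: inner_L2_def mult.commute)
  have "(\<lambda>n. inner_L2 (\<lambda>x. cnj (\<phi> x)) (g n)) \<longlonglongrightarrow> inner_L2 (\<lambda>x. cnj (\<phi> x)) h"
    by (rule L2.B_tendsto[OF assms(2,4) L2_cnj[OF test_function_L2[OF \<phi>]] assms(8)])
  then have "(\<lambda>n. LINT x|lebesgue. g n x * \<phi> x) \<longlonglongrightarrow> (LINT x|lebesgue. h x * \<phi> x)"
    by (simp add: inner_L2_def mult.commute)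
  from tendsto_minus[OF this] have "(\<lambda>n. LINT x|lebesgue. f n x * partial_deriv i \<phi> x) \<longlonglongrightarrow> - (LINT x|lebesgue. h x * \<phi> x)"
    using assms(6) \<phi> by (simp add: has_weak_partial_def)
  with 1 show "(LINT x|lebesgue. u x * partial_deriv i \<phi> x) = - (LINT x|lebesgue. h x * \<phi> x)"
    by (rule LIMSEQ_unique)
qed

locale nonneg_potential =
  fixes V :: "'a::euclidean_space \<Rightarrow> real"
  assumes V_measurable [measurable]: "V \<in> borel_measurable lebesgue"
    and V_nonneg: "AE x in lebesgue. 0 \<le> V x"
begin

lemma form_domD:
  assumes "u \<in> form_dom V"
  shows "u \<in> H1" "u \<in> L2" "integrable lebesgue (\<lambda>x. V x * (cmod (u x))\<^sup>2)" "u \<in> borel_measurable lebesgue"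
  using assms by (auto simp: form_dom_def H1_L2 L2D)

lemma potential_lincomb_integrable:
  assumes [measurable]: "u \<in> borel_measurable lebesgue" "v \<in> borel_measurable lebesgue"
    and "integrable lebesgue (\<lambda>x. V x * (cmod (u x))\<^sup>2)" "integrable lebesgue (\<lambda>x. V x * (cmod (v x))\<^sup>2)"
  shows "integrable lebesgue (\<lambda>x. V x * (cmod (u x + c * v x))\<^sup>2)"
proof (rule Bochner_Integration.integrable_bound)
  show "integrable lebesgue (\<lambda>x. 2 * (V x * (cmod (u x))\<^sup>2) + 2 * (cmod c)\<^sup>2 * (V x * (cmod (v x))\<^sup>2))"
    using assms by (intro Bochner_Integration.integrable_add integrable_mult_right)
  have le: "(cmod (u x + c * v x))\<^sup>2 \<le> 2 * (cmod (u x))\<^sup>2 + 2 * (cmod c)\<^sup>2 * (cmod (v x))\<^sup>2" for x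
    using norm_add_square_le[of "u x" "c * v x"] by (simp add: norm_mult power_mult_distrib)
  show "AE x in lebesgue. norm (V x * (cmod (u x + c * v x))\<^sup>2)
      \<le> norm (2 * (V x * (cmod (u x))\<^sup>2) + 2 * (cmod c)\<^sup>2 * (V x * (cmod (v x))\<^sup>2))"
    using V_nonneg
  proof eventually_elim
    fix x assume V: "0 \<le> V x"
    have "V x * (cmod (u x + c * v x))\<^sup>2 \<le> V x * (2 * (cmod (u x))\<^sup>2 + 2 * (cmod c)\<^sup>2 * (cmod (v x))\<^sup>2)"
      by (rule mult_left_mono[OF le V])
    also have "\<dots> = 2 * (V x * (cmod (u x))\<^sup>2) + 2 * (cmod c)\<^sup>2 * (V x * (cmod (v x))\<^sup>2)"
      by (simp add: algebra_simps)
    finally show "norm (V x * (cmod (u x + c * v x))\<^sup>2)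
      \<le> norm (2 * (V x * (cmod (u x))\<^sup>2) + 2 * (cmod c)\<^sup>2 * (V x * (cmod (v x))\<^sup>2))"
      using V by (simp add: abs_of_nonneg)
  qed
qed measurable

lemma form_dom_lincomb: "u \<in> form_dom V \<Longrightarrow> v \<in> form_dom V \<Longrightarrow> (\<lambda>x. u x + c * v x) \<in> form_dom V"
  unfolding form_dom_def mem_Collect_eq
  by (elim conjE, intro conjI H1_lincomb potential_lincomb_integrable L2D H1_L2)

lemma potential_form_integrable:
  assumes "u \<in> form_dom V" "v \<in> form_dom V"
  shows "integrable lebesgue (\<lambda>x. complex_of_real (V x) * (cnj (u x) * v x))"
proof (rule Bochner_Integration.integrable_bound)
  have [measurable]: "(\<lambda>x. cnj (u x)) \<in> borel_measurable lebesgue" "v \<in> borel_measurable lebesgue"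
    using form_domD[OF assms(1)] form_domD[OF assms(2)] L2_cnj L2D by blast+
  show "(\<lambda>x. complex_of_real (V x) * (cnj (u x) * v x)) \<in> borel_measurable lebesgue" by measurable
  show "integrable lebesgue (\<lambda>x. V x * (cmod (u x))\<^sup>2 + V x * (cmod (v x))\<^sup>2)"
    using assms by (intro Bochner_Integration.integrable_add form_domD)
  show "AE x in lebesgue. norm (complex_of_real (V x) * (cnj (u x) * v x)) \<le> norm (V x * (cmod (u x))\<^sup>2 + V x * (cmod (v x))\<^sup>2)"
    using V_nonneg
  proof eventually_elim
    fix x assume V: "0 \<le> V x"
    have "cmod (u x) * cmod (v x) \<le> (cmod (u x))\<^sup>2 + (cmod (v x))\<^sup>2"
      by (rule norm_mult_le_sum_squares)
    from mult_left_mono[OF this V]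
    show "norm (complex_of_real (V x) * (cnj (u x) * v x)) \<le> norm (V x * (cmod (u x))\<^sup>2 + V x * (cmod (v x))\<^sup>2)"
      using V by (simp add: norm_mult abs_of_nonneg distrib_left)
  qed
qed

lemma schroedinger_form_self:
  "schroedinger_form V u u = complex_of_real ((\<Sum>i\<in>Basis. (norm_L2 (weak_partial i u))\<^sup>2) + (LINT x|lebesgue. V x * (cmod (u x))\<^sup>2))"
proof -
  have "complex_of_real (V x) * (cnj (u x) * u x) = complex_of_real (V x * (cmod (u x))\<^sup>2)" for x
    by (metis complex_norm_square mult.commute of_real_mult)
  then show ?thesis
    unfolding schroedinger_form_def by (simp add: inner_L2_self norm_L2_sq del: of_real_mult)
qed

lemma potential_nonneg: "0 \<le> (LINT x|lebesgue. V x * (cmod (u x))\<^sup>2)"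
  by (rule integral_nonneg_AE) (use V_nonneg in eventually_elim, simp)

end

sublocale nonneg_potential \<subseteq> form: semi_inner "form_dom V" "schroedinger_form V"
proof
  show "(\<lambda>_. 0) \<in> form_dom V"
  proof -
    have "\<forall>i\<in>Basis. \<exists>g\<in>L2. has_weak_partial i (\<lambda>_::'a. 0) g"
      by (intro ballI bexI[of _ "\<lambda>_. 0"]) (simp_all add: L2.zero_mem has_weak_partial_def)
    then show ?thesis by (simp add: form_dom_def H1_def L2.zero_mem)
  qed
  show "(\<lambda>x. u x + c * v x) \<in> form_dom V" if "u \<in> form_dom V" "v \<in> form_dom V" for u v c
    using that by (rule form_dom_lincomb)
  show "0 \<le> Re (schroedinger_form V u u)" if "u \<in> form_dom V" for u
    unfolding schroedinger_form_self using potential_nonneg[of u]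
    by (simp add: sum_nonneg)
  show "schroedinger_form V u v = cnj (schroedinger_form V v u)" if u: "u \<in> form_dom V" and v: "v \<in> form_dom V" for u v
  proof -
    have "inner_L2 (weak_partial i u) (weak_partial i v) = cnj (inner_L2 (weak_partial i v) (weak_partial i u))" if "i \<in> Basis" for i
      by (rule L2.herm[OF weak_partial(1)[OF form_domD(1)[OF u] that] weak_partial(1)[OF form_domD(1)[OF v] that]])
    then have 1: "(\<Sum>i\<in>Basis. inner_L2 (weak_partial i u) (weak_partial i v)) = cnj (\<Sum>i\<in>Basis. inner_L2 (weak_partial i v) (weak_partial i u))"
      unfolding cnj_sum by (rule sum.cong[OF refl])
    have "(LINT x|lebesgue. complex_of_real (V x) * (cnj (u x) * v x))
        = (LINT x|lebesgue. cnj (complex_of_real (V x) * (cnj (v x) * u x)))"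
      by (simp add: mult.commute)
    also have "\<dots> = cnj (LINT x|lebesgue. complex_of_real (V x) * (cnj (v x) * u x))"
      by (rule Bochner_Integration.integral_cnj)
    finally show ?thesis
      unfolding schroedinger_form_def 1 by simp
  qed
  show "schroedinger_form V w (\<lambda>x. u x + c * v x) = schroedinger_form V w u + c * schroedinger_form V w v"
    if w: "w \<in> form_dom V" and u: "u \<in> form_dom V" and v: "v \<in> form_dom V" for w u v c
  proof -
    have "inner_L2 (weak_partial i w) (weak_partial i (\<lambda>x. u x + c * v x))
        = inner_L2 (weak_partial i w) (weak_partial i u) + c * inner_L2 (weak_partial i w) (weak_partial i v)"
      if i: "i \<in> Basis" for i
    proof -
      note W = weak_partial(1)[OF form_domD(1) i]
      have "inner_L2 (weak_partial i w) (weak_partial i (\<lambda>x. u x + c * v x))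
          = inner_L2 (weak_partial i w) (\<lambda>x. weak_partial i u x + c * weak_partial i v x)"
        by (rule inner_L2_cong_AE[OF W[OF w] W[OF form_dom_lincomb[OF u v]] W[OF w] L2_lincomb[OF W[OF u] W[OF v]]
            AE_I2[OF refl] weak_partial_lincomb[OF form_domD(1)[OF u] form_domD(1)[OF v] i]])
      also have "\<dots> = inner_L2 (weak_partial i w) (weak_partial i u) + c * inner_L2 (weak_partial i w) (weak_partial i v)"
        by (rule L2.lin[OF W[OF w] W[OF u] W[OF v]])
      finally show ?thesis .
    qed
    then have "(\<Sum>i\<in>Basis. inner_L2 (weak_partial i w) (weak_partial i (\<lambda>x. u x + c * v x)))
        = (\<Sum>i\<in>Basis. inner_L2 (weak_partial i w) (weak_partial i u)) + c * (\<Sum>i\<in>Basis. inner_L2 (weak_partial i w) (weak_partial i v))"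
      by (simp add: sum.distrib sum_distrib_left)
    moreover have "(LINT x|lebesgue. complex_of_real (V x) * (cnj (w x) * (u x + c * v x)))
       = (LINT x|lebesgue. complex_of_real (V x) * (cnj (w x) * u x)) + c * (LINT x|lebesgue. complex_of_real (V x) * (cnj (w x) * v x))"
    proof -
      have "(LINT x|lebesgue. complex_of_real (V x) * (cnj (w x) * (u x + c * v x)))
          = (LINT x|lebesgue. complex_of_real (V x) * (cnj (w x) * u x) + c * (complex_of_real (V x) * (cnj (w x) * v x)))"
        by (simp add: algebra_simps)
      then show ?thesis using potential_form_integrable[OF w u] potential_form_integrable[OF w v] by simp
    qed
    ultimately show ?thesis unfolding schroedinger_form_def by (simp add: algebra_simps)
  qed
qed

context nonneg_potential
begin

definition form1 :: "('a \<Rightarrow> complex) \<Rightarrow> ('a \<Rightarrow> complex) \<Rightarrow> complex" where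
  "form1 u v = schroedinger_form V u v + inner_L2 u v"

end

sublocale nonneg_potential \<subseteq> form1: semi_inner "form_dom V" form1
proof
  note L = form_domD(2)
  show "(\<lambda>_. 0) \<in> form_dom V" by (rule form.zero_mem)
  show "(\<lambda>x. u x + c * v x) \<in> form_dom V" if "u \<in> form_dom V" "v \<in> form_dom V" for u v c
    using that by (rule form_dom_lincomb)
  show "form1 w (\<lambda>x. u x + c * v x) = form1 w u + c * form1 w v"
    if "w \<in> form_dom V" "u \<in> form_dom V" "v \<in> form_dom V" for w u v c
    unfolding form1_def form.lin[OF that] L2.lin[OF L L L, OF that] by (simp add: algebra_simps)
  show "form1 u v = cnj (form1 v u)" if "u \<in> form_dom V" "v \<in> form_dom V" for u v
    using form.herm[OF that] L2.herm[OF L L, OF that] unfolding form1_def by (simp only: complex_cnj_add)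
  show "0 \<le> Re (form1 u u)" if "u \<in> form_dom V" for u
    using form.pos[OF that] L2.pos[OF L[OF that]] by (simp add: form1_def)
qed

context nonneg_potential
begin

lemma form1_nrm_sq:
  assumes "u \<in> form_dom V"
  shows "(form1.nrm u)\<^sup>2 = (\<Sum>i\<in>Basis. (norm_L2 (weak_partial i u))\<^sup>2) + (LINT x|lebesgue. V x * (cmod (u x))\<^sup>2) + (norm_L2 u)\<^sup>2"
  unfolding form1.nrm_sq[OF assms] form1_def schroedinger_form_self inner_L2_self by (simp add: norm_L2_sq)

lemma form1_nrm_bounds:
  assumes "u \<in> form_dom V"
  shows "norm_L2 u \<le> form1.nrm u" "i \<in> Basis \<Longrightarrow> norm_L2 (weak_partial i u) \<le> form1.nrm u"
    "(LINT x|lebesgue. V x * (cmod (u x))\<^sup>2) \<le> (form1.nrm u)\<^sup>2"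
proof -
  note * = form1_nrm_sq[OF assms] potential_nonneg[of u] form1.nrm_nonneg[OF assms]
  have s: "0 \<le> (\<Sum>i\<in>Basis. (norm_L2 (weak_partial i u))\<^sup>2)" by (simp add: sum_nonneg)
  show "norm_L2 u \<le> form1.nrm u"
    using * s by (intro power2_le_imp_le[of "norm_L2 u"]) linarith+
  show "(LINT x|lebesgue. V x * (cmod (u x))\<^sup>2) \<le> (form1.nrm u)\<^sup>2"
    using * s zero_le_power2[of "norm_L2 u"] by linarith
  assume "i \<in> Basis"
  then have "(norm_L2 (weak_partial i u))\<^sup>2 \<le> (\<Sum>i\<in>Basis. (norm_L2 (weak_partial i u))\<^sup>2)"
    by (intro member_le_sum) auto
  then show "norm_L2 (weak_partial i u) \<le> form1.nrm u"
    using * zero_le_power2[of "norm_L2 u"] by (intro power2_le_imp_le[of "norm_L2 (weak_partial i u)"]) linarith+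
qed

lemma weak_partial_diff:
  assumes "u \<in> form_dom V" "v \<in> form_dom V" "i \<in> Basis"
  shows "norm_L2 (weak_partial i (\<lambda>x. u x - v x)) = norm_L2 (\<lambda>x. weak_partial i u x - weak_partial i v x)"
proof (rule norm_L2_cong_AE)
  note W = weak_partial(1)[OF form_domD(1) assms(3)]
  show "weak_partial i (\<lambda>x. u x - v x) \<in> borel_measurable lebesgue"
    by (intro L2D W form.diff_mem assms)
  show "(\<lambda>x. weak_partial i u x - weak_partial i v x) \<in> borel_measurable lebesgue"
    by (intro L2D L2.diff_mem W assms)
  show "AE x in lebesgue. weak_partial i (\<lambda>x. u x - v x) x = weak_partial i u x - weak_partial i v x"
    using weak_partial_lincomb[OF form_domD(1)[OF assms(1)] form_domD(1)[OF assms(2)] assms(3), of "-1"] by simp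
qed

text \<open>The \<open>L\<^sup>2\<close> limits of the functions and of their weak derivatives exist and fit together,
  since weak derivatives are closed under \<open>L\<^sup>2\<close> limits. For the potential term, Fatou's lemma
  along an almost everywhere convergent subsequence shows that the limit has finite potential energy
  and that the convergence also holds for this part of the norm.\<close>

theorem form_complete: "form1.complete"
  unfolding form1.complete_def
proof (intro allI impI)
  fix f assume C: "form1.cauchy f"
  have fQ: "f n \<in> form_dom V" for n using C by (simp add: form1.cauchy_def)
  note fL = form_domD(2)[OF fQ]
  have fC: "\<exists>N. \<forall>m\<ge>N. \<forall>n\<ge>N. form1.nrm (\<lambda>x. f m x - f n x) < e" if "e > 0" for e
    using C that by (simp add: form1.cauchy_def)
  have "L2.cauchy f" unfolding L2.cauchy_def
  proof (intro conjI allI impI fL)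
    fix e :: real assume "e > 0"
    from fC[OF this] show "\<exists>N. \<forall>m\<ge>N. \<forall>n\<ge>N. norm_L2 (\<lambda>x. f m x - f n x) < e"
      using form1_nrm_bounds(1)[OF form1.diff_mem[OF fQ fQ]] by (meson le_less_trans)
  qed
  then obtain u r where u: "u \<in> L2" and r: "strict_mono r"
    and ae: "AE x in lebesgue. (\<lambda>n. f (r n) x) \<longlonglongrightarrow> u x"
    and lim: "(\<lambda>n. norm_L2 (\<lambda>x. f n x - u x)) \<longlonglongrightarrow> 0" by (rule L2_cauchy_limit)
  have "\<exists>g. g \<in> L2 \<and> (\<lambda>n. norm_L2 (\<lambda>x. weak_partial i (f n) x - g x)) \<longlonglongrightarrow> 0" if i: "i \<in> Basis" for i
  proof -
    note W = weak_partial(1)[OF form_domD(1)[OF fQ] i]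
    have "L2.cauchy (\<lambda>n. weak_partial i (f n))" unfolding L2.cauchy_def
    proof (intro conjI allI impI W)
      fix e :: real assume "e > 0"
      from fC[OF this] show "\<exists>N. \<forall>m\<ge>N. \<forall>n\<ge>N. norm_L2 (\<lambda>x. weak_partial i (f m) x - weak_partial i (f n) x) < e"
        using form1_nrm_bounds(2)[OF form1.diff_mem[OF fQ fQ] i] unfolding weak_partial_diff[OF fQ fQ i]
        by (meson le_less_trans)
    qed
    then obtain g s where "g \<in> L2" "strict_mono s" "AE x in lebesgue. (\<lambda>n. weak_partial i (f (s n)) x) \<longlonglongrightarrow> g x"
      "(\<lambda>n. norm_L2 (\<lambda>x. weak_partial i (f n) x - g x)) \<longlonglongrightarrow> 0" by (rule L2_cauchy_limit)
    then show ?thesis by (intro exI[of _ g] conjI)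
  qed
  then obtain g where g: "\<And>i. i \<in> Basis \<Longrightarrow> g i \<in> L2"
    and glim: "\<And>i. i \<in> Basis \<Longrightarrow> (\<lambda>n. norm_L2 (\<lambda>x. weak_partial i (f n) x - g i x)) \<longlonglongrightarrow> 0" by metis
  have gw: "has_weak_partial i u (g i)" if i: "i \<in> Basis" for i
    by (rule has_weak_partial_limit[OF fL weak_partial(1)[OF form_domD(1)[OF fQ] i] u g[OF i] i
        weak_partial(2)[OF form_domD(1)[OF fQ] i] lim glim[OF i]])
  have uH: "u \<in> H1" using u g gw by (auto simp: H1_def)
  have dH: "(\<lambda>x. f n x - u x) \<in> H1" for n
    using H1_lincomb[OF form_domD(1)[OF fQ] uH, of n "-1"] by simp
  have [measurable]: "f n \<in> borel_measurable lebesgue" "u \<in> borel_measurable lebesgue" for n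
    using L2D fL u by blast+
  have pot: "integrable lebesgue (\<lambda>x. V x * (cmod (f n x - u x))\<^sup>2) \<and> (LINT x|lebesgue. V x * (cmod (f n x - u x))\<^sup>2) \<le> e\<^sup>2"
    if e: "e > 0" and N: "\<forall>m\<ge>N. \<forall>n\<ge>N. form1.nrm (\<lambda>x. f m x - f n x) < e" and n: "n \<ge> N" for e N n
  proof -
    note d = form1.diff_mem[OF fQ fQ]
    have 1: "AE x in lebesgue. 0 \<le> V x * (cmod (f n x - f (r i) x))\<^sup>2" for i
      using V_nonneg by eventually_elim simp
    have 2: "AE x in lebesgue. (\<lambda>i. V x * (cmod (f n x - f (r i) x))\<^sup>2) \<longlonglongrightarrow> V x * (cmod (f n x - u x))\<^sup>2"
      using ae by eventually_elim (intro tendsto_intros)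
    have "(LINT x|lebesgue. V x * (cmod (f n x - f (r i) x))\<^sup>2) \<le> e\<^sup>2" if "i \<ge> N" for i
    proof -
      have "(form1.nrm (\<lambda>x. f n x - f (r i) x))\<^sup>2 \<le> e\<^sup>2"
        using N n that seq_suble[OF r, of i] by (intro power_mono form1.nrm_nonneg[OF d] less_imp_le) auto
      with form1_nrm_bounds(3)[OF d[of n "r i"]] show ?thesis by linarith
    qed
    then have 3: "\<forall>\<^sub>F i in sequentially. (LINT x|lebesgue. V x * (cmod (f n x - f (r i) x))\<^sup>2) \<le> e\<^sup>2"
      unfolding eventually_sequentially by blast
    have "(\<lambda>x. V x * (cmod (f n x - u x))\<^sup>2) \<in> borel_measurable lebesgue" by measurable
    from fatou_bound[OF form_domD(3)[OF d] 1 2 this 3] show ?thesis by blast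
  qed
  have dQ: "\<exists>N. \<forall>n\<ge>N. (\<lambda>x. f n x - u x) \<in> form_dom V"
    using pot[of 1] fC[of 1] dH by (auto simp: form_dom_def)
  then obtain n where "(\<lambda>x. f n x - u x) \<in> form_dom V" by blast
  from form1.diff_mem[OF fQ[of n] this] have uQ: "u \<in> form_dom V" by simp
  note d = form1.diff_mem[OF fQ uQ]
  have "(\<lambda>n. LINT x|lebesgue. V x * (cmod (f n x - u x))\<^sup>2) \<longlonglongrightarrow> 0"
  proof (rule LIMSEQ_I)
    fix e :: real assume e: "e > 0"
    then obtain N where N: "\<forall>m\<ge>N. \<forall>n\<ge>N. form1.nrm (\<lambda>x. f m x - f n x) < sqrt (e / 2)" using fC[of "sqrt (e/2)"] by auto
    have "norm ((LINT x|lebesgue. V x * (cmod (f n x - u x))\<^sup>2) - 0) < e" if "n \<ge> N" for n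
      using pot[OF _ N that] e potential_nonneg[of "\<lambda>x. f n x - u x"] by auto
    then show "\<exists>no. \<forall>n\<ge>no. norm ((LINT x|lebesgue. V x * (cmod (f n x - u x))\<^sup>2) - 0) < e" by blast
  qed
  moreover have "(\<lambda>n. norm_L2 (weak_partial i (\<lambda>x. f n x - u x))) \<longlonglongrightarrow> 0" if i: "i \<in> Basis" for i
  proof -
    have "norm_L2 (weak_partial i (\<lambda>x. f n x - u x)) = norm_L2 (\<lambda>x. weak_partial i (f n) x - g i x)" for n
    proof -
      have "AE x in lebesgue. weak_partial i u x = g i x"
        by (rule has_weak_partial_unique[OF weak_partial(1)[OF uH i] g[OF i] weak_partial(2)[OF uH i] gw[OF i]])
      then have "AE x in lebesgue. weak_partial i (f n) x - weak_partial i u x = weak_partial i (f n) x - g i x"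
        by eventually_elim simp
      then show ?thesis unfolding weak_partial_diff[OF fQ uQ i]
        using weak_partial(1)[OF form_domD(1)[OF fQ] i] weak_partial(1)[OF uH i] g[OF i]
        by (intro norm_L2_cong_AE L2D L2.diff_mem)
    qed
    then show ?thesis using glim[OF i] by simp
  qed
  ultimately have "(\<lambda>n. (form1.nrm (\<lambda>x. f n x - u x))\<^sup>2) \<longlonglongrightarrow> (\<Sum>i\<in>(Basis::'a set). 0\<^sup>2) + 0 + 0\<^sup>2"
    unfolding form1_nrm_sq[OF d] by (intro tendsto_add tendsto_sum tendsto_power lim)
  then have "(\<lambda>n. sqrt ((form1.nrm (\<lambda>x. f n x - u x))\<^sup>2)) \<longlonglongrightarrow> sqrt 0"
    by (intro tendsto_real_sqrt) simp
  then have "(\<lambda>n. form1.nrm (\<lambda>x. f n x - u x)) \<longlonglongrightarrow> 0"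
    using form1.nrm_nonneg[OF d] by (simp add: real_sqrt_abs)
  with uQ show "\<exists>u\<in>form_dom V. (\<lambda>n. form1.nrm (\<lambda>x. f n x - u x)) \<longlonglongrightarrow> 0" by blast
qed

end

section \<open>Translation estimate\<close>

text \<open>Translates of Lebesgue measurable functions need not be jointly measurable in point and shift, so
  arguments with Fubini's theorem are carried out for Borel representatives.\<close>

lemma complex_borel_representative:
  fixes f :: "'a::euclidean_space \<Rightarrow> complex"
  assumes "f \<in> borel_measurable lebesgue"
  obtains f' where "f' \<in> borel_measurable borel" "AE x in lebesgue. f x = f' x"
proof -
  have "(\<lambda>x. Re (f x)) \<in> borel_measurable lebesgue" "(\<lambda>x. Im (f x)) \<in> borel_measurable lebesgue"
    using assms by measurable
  then obtain p q where pq: "p \<in> borel_measurable lborel" "q \<in> borel_measurable lborel"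
    and ae: "AE x in lborel. Re (f x) = p x" "AE x in lborel. Im (f x) = q x"
    using completion_ex_borel_measurable_real by metis
  have "(\<lambda>x. complex_of_real (p x) + \<i> * complex_of_real (q x)) \<in> borel_measurable borel"
    using pq by simp
  moreover have "AE x in lborel. f x = complex_of_real (p x) + \<i> * complex_of_real (q x)"
    using ae by eventually_elim (simp add: complex_eq_iff)
  ultimately show thesis using that AE_completion by blast
qed

lemma borel_imp_lebesgue_measurable: "f \<in> borel_measurable borel \<Longrightarrow> f \<in> borel_measurable lebesgue"
  by (rule measurable_completion) simp

lemma nn_integral_translate:
  fixes f :: "'a::euclidean_space \<Rightarrow> ennreal"
  assumes [measurable]: "f \<in> borel_measurable borel"
  shows "(\<integral>\<^sup>+x. f (x + h) \<partial>lborel) = (\<integral>\<^sup>+x. f x \<partial>lborel)"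
proof -
  have "(\<integral>\<^sup>+x. f x \<partial>lborel) = (\<integral>\<^sup>+x. f x \<partial>distr lborel borel ((+) h))"
    by (simp only: lborel_distr_plus)
  also have "\<dots> = (\<integral>\<^sup>+x. f (h + x) \<partial>lborel)" by (rule nn_integral_distr) auto
  finally show ?thesis by (simp add: add.commute)
qed

lemma integral_translate:
  fixes f :: "'a::euclidean_space \<Rightarrow> complex"
  assumes [measurable]: "f \<in> borel_measurable borel"
  shows "(LINT x|lborel. f (x + h)) = (LINT x|lborel. f x)"
proof -
  have "(LINT x|lborel. f x) = (LINT x|distr lborel borel ((+) h). f x)"
    by (simp only: lborel_distr_plus)
  also have "\<dots> = (LINT x|lborel. f (h + x))" by (rule integral_distr) auto
  finally show ?thesis by (simp add: add.commute)
qed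

abbreviation sqnorm :: "complex \<Rightarrow> ennreal" where
  "sqnorm z \<equiv> ennreal ((cmod z)\<^sup>2)"

lemma nn_integral_norm_L2:
  assumes "u \<in> L2" "u \<in> borel_measurable borel"
  shows "(\<integral>\<^sup>+x. sqnorm (u x) \<partial>lborel) = ennreal ((norm_L2 u)\<^sup>2)"
proof -
  have "(\<integral>\<^sup>+x. sqnorm (u x) \<partial>lebesgue) = ennreal (LINT x|lebesgue. (cmod (u x))\<^sup>2)"
    by (rule nn_integral_eq_integral[OF L2D(2)[OF assms(1)]]) simp
  then show ?thesis by (simp only: norm_L2_sq nn_integral_completion)
qed

lemma L2I_nn_integral:
  assumes [measurable]: "u \<in> borel_measurable borel" and "0 \<le> c"
    and le: "(\<integral>\<^sup>+x. sqnorm (u x) \<partial>lborel) \<le> ennreal (c\<^sup>2)"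
  shows "u \<in> L2" "norm_L2 u \<le> c"
proof -
  have "integrable lborel (\<lambda>x. (cmod (u x))\<^sup>2)"
    using le by (intro integrableI_bounded) (auto intro: le_less_trans[OF _ ennreal_less_top])
  then have "integrable lebesgue (\<lambda>x. (cmod (u x))\<^sup>2)" by (subst integrable_completion) auto
  then show L: "u \<in> L2" using borel_imp_lebesgue_measurable[OF assms(1)] by (simp add: L2_def)
  have "(norm_L2 u)\<^sup>2 \<le> c\<^sup>2" using le unfolding nn_integral_norm_L2[OF L assms(1)] by simp
  then show "norm_L2 u \<le> c" by (rule power2_le_imp_le) fact
qed

lemma translate_L2:
  assumes "u \<in> L2" and [measurable]: "u \<in> borel_measurable borel"
  shows "(\<lambda>x. u (x + h)) \<in> borel_measurable borel" "(\<lambda>x. u (x + h)) \<in> L2" "norm_L2 (\<lambda>x. u (x + h)) = norm_L2 u"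
proof -
  show m: "(\<lambda>x. u (x + h)) \<in> borel_measurable borel" by measurable
  have eq: "(\<integral>\<^sup>+x. sqnorm (u (x + h)) \<partial>lborel) = ennreal ((norm_L2 u)\<^sup>2)"
    using nn_integral_translate[of "\<lambda>x. sqnorm (u x)" h] nn_integral_norm_L2[OF assms] by simp
  show L: "(\<lambda>x. u (x + h)) \<in> L2"
    by (rule L2I_nn_integral(1)[OF m norm_L2_nonneg[of u]]) (simp add: eq)
  show "norm_L2 (\<lambda>x. u (x + h)) = norm_L2 u"
    using eq nn_integral_norm_L2[OF L m] norm_L2_nonneg[of u] norm_L2_nonneg[of "\<lambda>x. u (x + h)"] by simp
qed

text \<open>The Cauchy--Schwarz inequality against the indicator of \<open>A\<close>. If \<open>k\<close> is not integrable on
  \<open>A\<close>, then the left-hand side is \<open>0\<close> by the convention for the integral.\<close>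

lemma sq_norm_integral_le:
  fixes k :: "'a \<Rightarrow> complex"
  assumes [measurable]: "k \<in> borel_measurable M" "A \<in> sets M"
  shows "sqnorm (LINT x|M. indicator A x *\<^sub>R k x) \<le> emeasure M A * (\<integral>\<^sup>+x. indicator A x * sqnorm (k x) \<partial>M)"
proof -
  have "ennreal (cmod (LINT x|M. indicator A x *\<^sub>R k x)) \<le> (\<integral>\<^sup>+x. ennreal (norm (indicator A x *\<^sub>R k x)) \<partial>M)"
  proof (cases "integrable M (\<lambda>x. indicator A x *\<^sub>R k x)")
    case True
    then show ?thesis by (rule integral_norm_bound_ennreal)
  next
    case False
    then show ?thesis by (simp add: not_integrable_integral_eq)
  qed
  also have "\<dots> = (\<integral>\<^sup>+x. indicator A x * (indicator A x * ennreal (cmod (k x))) \<partial>M)"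
    by (intro nn_integral_cong) (auto simp: indicator_def)
  finally have "(ennreal (cmod (LINT x|M. indicator A x *\<^sub>R k x)))\<^sup>2 \<le> (\<integral>\<^sup>+x. indicator A x * (indicator A x * ennreal (cmod (k x))) \<partial>M)\<^sup>2"
    by (rule power_mono) simp
  also have "\<dots> \<le> (\<integral>\<^sup>+x. (indicator A x)\<^sup>2 \<partial>M) * (\<integral>\<^sup>+x. (indicator A x * ennreal (cmod (k x)))\<^sup>2 \<partial>M)"
    by (rule Cauchy_Schwarz_nn_integral) measurable
  also have "(\<integral>\<^sup>+x. (indicator A x)\<^sup>2 \<partial>M) = (\<integral>\<^sup>+x. indicator A x \<partial>M)"
    by (intro nn_integral_cong) (auto simp: indicator_def)
  also have "\<dots> = emeasure M A" by simp
  also have "(\<integral>\<^sup>+x. (indicator A x * ennreal (cmod (k x)))\<^sup>2 \<partial>M) = (\<integral>\<^sup>+x. indicator A x * sqnorm (k x) \<partial>M)"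
    by (intro nn_integral_cong) (auto simp: indicator_def ennreal_power)
  finally show ?thesis by (simp add: ennreal_power)
qed

text \<open>This justifies both exchanges of the order of integration below. The product is bounded by the sum
  of the squares, whose integral over \<open>x\<close> is the same for every \<open>\<tau>\<close>.\<close>

lemma translates_product_integrable:
  fixes w \<psi> :: "'a::euclidean_space \<Rightarrow> complex" and t :: real
  assumes w: "w \<in> L2" and wb[measurable]: "w \<in> borel_measurable borel"
    and p: "\<psi> \<in> L2" and pb[measurable]: "\<psi> \<in> borel_measurable borel"
  shows "integrable (lborel \<Otimes>\<^sub>M lborel) (\<lambda>(x, \<tau>). indicator {0..t} \<tau> *\<^sub>R (w (x + \<tau> *\<^sub>R a) * \<psi> (x + \<tau> *\<^sub>R b)))"
proof (rule integrableI_bounded)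
  let ?f = "\<lambda>(x, \<tau>). indicator {0..t} \<tau> *\<^sub>R (w (x + \<tau> *\<^sub>R a) * \<psi> (x + \<tau> *\<^sub>R b))"
  show "?f \<in> borel_measurable (lborel \<Otimes>\<^sub>M lborel)"
    by measurable
  let ?F = "\<lambda>(x, \<tau>). indicator {0..t} \<tau> * (sqnorm (w (x + \<tau> *\<^sub>R a)) + sqnorm (\<psi> (x + \<tau> *\<^sub>R b)))"
  have F: "?F \<in> borel_measurable (lborel \<Otimes>\<^sub>M lborel)" by measurable
  have "(\<integral>\<^sup>+z. ennreal (norm (?f z)) \<partial>(lborel \<Otimes>\<^sub>M lborel))
      \<le> (\<integral>\<^sup>+z. ?F z \<partial>(lborel \<Otimes>\<^sub>M lborel))"
  proof (rule nn_integral_mono)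
    fix z :: "'a \<times> real"
    obtain x \<tau> where z: "z = (x, \<tau>)" by (cases z)
    show "ennreal (norm (?f z)) \<le> ?F z"
      by (auto simp: z indicator_def norm_mult simp flip: ennreal_plus intro!: ennreal_leI norm_mult_le_sum_squares)
  qed
  also have "\<dots> = (\<integral>\<^sup>+\<tau>. (\<integral>\<^sup>+x. ?F (x, \<tau>) \<partial>lborel) \<partial>lborel)"
    by (rule lborel_pair.nn_integral_snd[OF F, symmetric])
  also have "\<dots> = (\<integral>\<^sup>+\<tau>. indicator {0..t} \<tau> * (ennreal ((norm_L2 w)\<^sup>2) + ennreal ((norm_L2 \<psi>)\<^sup>2)) \<partial>lborel)"
  proof (rule nn_integral_cong)
    fix \<tau> :: real
    have "(\<integral>\<^sup>+x. ?F (x, \<tau>) \<partial>lborel) = indicator {0..t} \<tau> * ((\<integral>\<^sup>+x. sqnorm (w (x + \<tau> *\<^sub>R a)) \<partial>lborel)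
        + (\<integral>\<^sup>+x. sqnorm (\<psi> (x + \<tau> *\<^sub>R b)) \<partial>lborel))"
      by (simp add: nn_integral_cmult nn_integral_add)
    then show "(\<integral>\<^sup>+x. ?F (x, \<tau>) \<partial>lborel) = indicator {0..t} \<tau> * (ennreal ((norm_L2 w)\<^sup>2) + ennreal ((norm_L2 \<psi>)\<^sup>2))"
      using nn_integral_translate[of "\<lambda>x. sqnorm (w x)" "\<tau> *\<^sub>R a"] nn_integral_translate[of "\<lambda>x. sqnorm (\<psi> x)" "\<tau> *\<^sub>R b"]
      by (simp add: nn_integral_norm_L2[OF w wb] nn_integral_norm_L2[OF p pb])
  qed
  also have "\<dots> = (ennreal ((norm_L2 w)\<^sup>2) + ennreal ((norm_L2 \<psi>)\<^sup>2)) * emeasure lborel {0..t}"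
    by (subst mult.commute) (rule nn_integral_cmult_indicator, simp)
  also have "\<dots> < \<infinity>" by (simp add: ennreal_mult_less_top emeasure_lborel_Icc_eq flip: ennreal_plus)
  finally show "(\<integral>\<^sup>+z. ennreal (norm (?f z)) \<partial>(lborel \<Otimes>\<^sub>M lborel)) < \<infinity>" .
qed

text \<open>The fundamental theorem of calculus along a segment in direction \<open>- i\<close>.\<close>

lemma test_function_line_integral:
  assumes \<phi>: "test_function \<phi>" and i: "i \<in> Basis" and t: "0 \<le> t"
  shows "(LINT \<tau>|lborel. indicator {0..t} \<tau> *\<^sub>R (- partial_deriv i \<phi> (x - \<tau> *\<^sub>R i))) = \<phi> (x - t *\<^sub>R i) - \<phi> x"
proof -
  have "(LINT \<tau>|lborel. indicator {0..t} \<tau> *\<^sub>R (- partial_deriv i \<phi> (x - \<tau> *\<^sub>R i))) = \<phi> (x - t *\<^sub>R i) - \<phi> (x - 0 *\<^sub>R i)"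
  proof (rule integral_FTC_atLeastAtMost[OF t])
    fix \<tau> :: real
    let ?D = "frechet_derivative \<phi> (at (x - \<tau> *\<^sub>R i))"
    have "\<phi> differentiable at (x - \<tau> *\<^sub>R i)"
      using \<phi> Ck.simps(2)[of 0 \<phi>] unfolding test_function_def by blast
    then have D: "(\<phi> has_derivative ?D) (at (x - \<tau> *\<^sub>R i))"
      by (simp add: frechet_derivative_works[symmetric])
    have "((\<lambda>\<tau>. x - \<tau> *\<^sub>R i) has_derivative (\<lambda>d. - d *\<^sub>R i)) (at \<tau>)"
      by (auto intro!: derivative_eq_intros)
    from has_derivative_compose[OF this D]
    have "((\<lambda>\<tau>. \<phi> (x - \<tau> *\<^sub>R i)) has_derivative (\<lambda>d. ?D (- d *\<^sub>R i))) (at \<tau>)" .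
    moreover have "?D (- d *\<^sub>R i) = d *\<^sub>R (- ?D i)" for d
      using linear_scale[OF has_derivative_linear[OF D], of "- d" i] by simp
    ultimately have "((\<lambda>\<tau>. \<phi> (x - \<tau> *\<^sub>R i)) has_vector_derivative - partial_deriv i \<phi> (x - \<tau> *\<^sub>R i)) (at \<tau>)"
      by (simp add: has_vector_derivative_def partial_deriv_def)
    then show "((\<lambda>\<tau>. \<phi> (x - \<tau> *\<^sub>R i)) has_vector_derivative - partial_deriv i \<phi> (x - \<tau> *\<^sub>R i)) (at \<tau> within {0..t})"
      by (rule has_vector_derivative_at_within)
  next
    have "continuous_on UNIV (partial_deriv i \<phi>)"
      by (rule test_function_continuous[OF test_function_partial[OF \<phi> i]])
    moreover have "continuous_on {0..t} (\<lambda>\<tau>. x - \<tau> *\<^sub>R i)" by (intro continuous_intros)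
    ultimately have "continuous_on {0..t} (\<lambda>\<tau>. partial_deriv i \<phi> (x - \<tau> *\<^sub>R i))"
      by (rule continuous_on_compose2) simp
    then show "continuous_on {0..t} (\<lambda>\<tau>. - partial_deriv i \<phi> (x - \<tau> *\<^sub>R i))"
      by (rule continuous_on_minus)
  qed
  then show ?thesis by simp
qed

text \<open>Almost everywhere, \<open>u (x + t i) - u x\<close> is the integral \<open>G x\<close> of \<open>g\<close> over the segment
  from \<open>x\<close> to \<open>x + t i\<close>, and the norm of \<open>G\<close> is at most \<open>t\<close> times that of
  \<open>g\<close> by \<open>sq_norm_integral_le\<close> and Tonelli's theorem. The identity is checked against a test
  function \<open>\<phi>\<close>: the shift is moved to \<open>\<phi>\<close>, the difference
  \<open>\<phi> (x - t i) - \<phi> x\<close> is written as an integral of \<open>\<partial>\<^sub>i \<phi>\<close> along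
  the segment, and the definition of the weak derivative applies to each translate of \<open>\<phi>\<close>. The
  order of integration is exchanged before and after that step.\<close>

lemma translation_estimate_axis:
  assumes u: "u \<in> L2" and ub[measurable]: "u \<in> borel_measurable borel"
    and g: "g \<in> L2" and gb[measurable]: "g \<in> borel_measurable borel"
    and wk: "has_weak_partial i u g" and i: "i \<in> Basis" and t: "0 \<le> t"
  shows "norm_L2 (\<lambda>x. u (x + t *\<^sub>R i) - u x) \<le> t * norm_L2 g"
proof -
  let ?q = "\<lambda>x \<tau>. indicator {0..t} \<tau> * sqnorm (g (x + \<tau> *\<^sub>R i))"
  define G where "G x = (LINT \<tau>|lborel. indicator {0..t} \<tau> *\<^sub>R g (x + \<tau> *\<^sub>R i))" for x
  define D where "D x = u (x + t *\<^sub>R i) - u x" for x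
  have Gb[measurable]: "G \<in> borel_measurable borel"
    unfolding G_def by (rule lborel.borel_measurable_lebesgue_integral) measurable
  have Db[measurable]: "D \<in> borel_measurable borel" unfolding D_def by measurable
  have D: "D \<in> L2" unfolding D_def by (intro L2.diff_mem translate_L2 u ub)
  have "(\<integral>\<^sup>+x. sqnorm (G x) \<partial>lborel)
      \<le> (\<integral>\<^sup>+x. ennreal t * (\<integral>\<^sup>+\<tau>. ?q x \<tau> \<partial>lborel) \<partial>lborel)"
  proof (rule nn_integral_mono)
    fix x
    have "sqnorm (G x) \<le> emeasure lborel {0..t} * (\<integral>\<^sup>+\<tau>. ?q x \<tau> \<partial>lborel)"
      unfolding G_def by (rule sq_norm_integral_le) auto
    then show "sqnorm (G x) \<le> ennreal t * (\<integral>\<^sup>+\<tau>. ?q x \<tau> \<partial>lborel)"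
      using t by simp
  qed
  also have "\<dots> = ennreal t * (\<integral>\<^sup>+x. (\<integral>\<^sup>+\<tau>. ?q x \<tau> \<partial>lborel) \<partial>lborel)"
    by (intro nn_integral_cmult lborel.borel_measurable_nn_integral) measurable
  also have "(\<integral>\<^sup>+x. (\<integral>\<^sup>+\<tau>. ?q x \<tau> \<partial>lborel) \<partial>lborel)
      = (\<integral>\<^sup>+\<tau>. (\<integral>\<^sup>+x. ?q x \<tau> \<partial>lborel) \<partial>lborel)"
    by (rule lborel_pair.Fubini'[symmetric]) measurable
  also have "\<dots> = (\<integral>\<^sup>+\<tau>. ennreal ((norm_L2 g)\<^sup>2) * indicator {0..t} \<tau> \<partial>lborel)"
  proof (rule nn_integral_cong)
    fix \<tau> :: real
    have "(\<integral>\<^sup>+x. ?q x \<tau> \<partial>lborel)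
        = indicator {0..t} \<tau> * (\<integral>\<^sup>+x. sqnorm (g (x + \<tau> *\<^sub>R i)) \<partial>lborel)"
      by (rule nn_integral_cmult) measurable
    then show "(\<integral>\<^sup>+x. ?q x \<tau> \<partial>lborel) = ennreal ((norm_L2 g)\<^sup>2) * indicator {0..t} \<tau>"
      using nn_integral_translate[of "\<lambda>x. sqnorm (g x)" "\<tau> *\<^sub>R i"]
      by (simp add: nn_integral_norm_L2[OF g gb] mult.commute)
  qed
  also have "\<dots> = ennreal ((norm_L2 g)\<^sup>2) * ennreal t"
    using t by (subst nn_integral_cmult_indicator) auto
  also have "ennreal t * (ennreal ((norm_L2 g)\<^sup>2) * ennreal t) = ennreal ((t * norm_L2 g)\<^sup>2)"
    using t by (simp add: power_mult_distrib power2_eq_square mult.commute mult.left_commute flip: ennreal_mult)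
  finally have G: "G \<in> L2" "norm_L2 G \<le> t * norm_L2 g"
    using L2I_nn_integral[OF Gb, of "t * norm_L2 g"] t norm_L2_nonneg[of g] by auto
  have "AE x in lebesgue. D x - G x = 0"
  proof (rule fundamental_lemma)
    show "(\<lambda>x. D x - G x) \<in> L2" by (rule L2.diff_mem[OF D G(1)])
    fix \<phi> :: "'a \<Rightarrow> complex" assume \<phi>: "test_function \<phi>"
    define d where "d = partial_deriv i \<phi>"
    have d: "test_function d" unfolding d_def by (rule test_function_partial[OF \<phi> i])
    note L = test_function_L2[OF \<phi>] test_function_L2[OF d]
    have [measurable]: "\<phi> \<in> borel_measurable borel" "d \<in> borel_measurable borel"
      using test_function_borel \<phi> d by blast+
    have il: "integrable lborel (\<lambda>x. v x * \<psi> x)"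
      if "v \<in> L2" "v \<in> borel_measurable borel" "\<psi> \<in> L2" "\<psi> \<in> borel_measurable borel" for v \<psi> :: "'a \<Rightarrow> complex"
    proof -
      have "(\<lambda>x. v x * \<psi> x) \<in> borel_measurable lborel" using that(2,4) by simp
      then show ?thesis using L2_mult_integrable[OF that(1,3)] integrable_completion by blast
    qed
    note shift = translate_L2[OF L(1), of "- (t *\<^sub>R i)"]
    have "(LINT x|lborel. D x * \<phi> x) = (LINT x|lborel. u (x + t *\<^sub>R i) * \<phi> x) - (LINT x|lborel. u x * \<phi> x)"
      unfolding D_def left_diff_distrib
      by (intro Bochner_Integration.integral_diff il translate_L2 u ub L) measurable
    also have "(LINT x|lborel. u (x + t *\<^sub>R i) * \<phi> x) = (LINT x|lborel. u x * \<phi> (x - t *\<^sub>R i))"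
      using integral_translate[of "\<lambda>x. u x * \<phi> (x - t *\<^sub>R i)" "t *\<^sub>R i"] by simp
    also have "(LINT x|lborel. u x * \<phi> (x - t *\<^sub>R i)) - (LINT x|lborel. u x * \<phi> x) = (LINT x|lborel. u x * (\<phi> (x - t *\<^sub>R i) - \<phi> x))"
      unfolding right_diff_distrib
      using shift by (intro Bochner_Integration.integral_diff[symmetric] il u ub L) (simp_all)
    also have "\<dots> = (LINT x|lborel. (LINT \<tau>|lborel. indicator {0..t} \<tau> *\<^sub>R (u x * (- d (x - \<tau> *\<^sub>R i)))))"
      unfolding d_def test_function_line_integral[OF \<phi> i t, symmetric]
      by (intro Bochner_Integration.integral_cong refl)
        (simp only: mult_scaleR_right[symmetric] Bochner_Integration.integral_mult_right_zero)
    also have "\<dots> = (LINT \<tau>|lborel. (LINT x|lborel. indicator {0..t} \<tau> *\<^sub>R (u x * (- d (x - \<tau> *\<^sub>R i)))))"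
    proof (rule lborel_pair.Fubini_integral[symmetric])
      have "(\<lambda>x. - d x) \<in> L2" using L2.scale_mem[OF L(2), of "-1"] by simp
      moreover have "(\<lambda>x. - d x) \<in> borel_measurable borel" by measurable
      ultimately have "integrable (lborel \<Otimes>\<^sub>M lborel) (\<lambda>(x, \<tau>). indicator {0..t} \<tau> *\<^sub>R (u (x + \<tau> *\<^sub>R 0) * (- d (x + \<tau> *\<^sub>R (- i)))))"
        by (rule translates_product_integrable[OF u ub])
      then show "integrable (lborel \<Otimes>\<^sub>M lborel) (\<lambda>(x, \<tau>). indicator {0..t} \<tau> *\<^sub>R (u x * (- d (x - \<tau> *\<^sub>R i))))" by simp
    qed
    also have "\<dots> = (LINT \<tau>|lborel. (LINT x|lborel. indicator {0..t} \<tau> *\<^sub>R (g (x + \<tau> *\<^sub>R i) * \<phi> x)))"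
    proof (rule Bochner_Integration.integral_cong[OF refl])
      fix \<tau> :: real
      have tf: "test_function (\<lambda>x. \<phi> (x - \<tau> *\<^sub>R i))" by (rule test_function_translate[OF \<phi>])
      have "(LINT x|lborel. u x * d (x - \<tau> *\<^sub>R i)) = (LINT x|lebesgue. u x * d (x - \<tau> *\<^sub>R i))"
        by (rule integral_completion[symmetric]) measurable
      also have "\<dots> = (LINT x|lebesgue. u x * partial_deriv i (\<lambda>x. \<phi> (x - \<tau> *\<^sub>R i)) x)"
        unfolding d_def by (simp only: partial_deriv_translate[OF \<phi>])
      also have "\<dots> = - (LINT x|lebesgue. g x * \<phi> (x - \<tau> *\<^sub>R i))"
        using wk tf by (simp add: has_weak_partial_def)
      also have "(LINT x|lebesgue. g x * \<phi> (x - \<tau> *\<^sub>R i)) = (LINT x|lborel. g x * \<phi> (x - \<tau> *\<^sub>R i))"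
        by (rule integral_completion) measurable
      also have "\<dots> = (LINT x|lborel. g (x + \<tau> *\<^sub>R i) * \<phi> x)"
        using integral_translate[of "\<lambda>x. g x * \<phi> (x - \<tau> *\<^sub>R i)" "\<tau> *\<^sub>R i"] by simp
      finally have "(LINT x|lborel. u x * (- d (x - \<tau> *\<^sub>R i))) = (LINT x|lborel. g (x + \<tau> *\<^sub>R i) * \<phi> x)" by simp
      then show "(LINT x|lborel. indicator {0..t} \<tau> *\<^sub>R (u x * (- d (x - \<tau> *\<^sub>R i)))) = (LINT x|lborel. indicator {0..t} \<tau> *\<^sub>R (g (x + \<tau> *\<^sub>R i) * \<phi> x))"
        by (simp only: integral_scaleR_right)
    qed
    also have "\<dots> = (LINT x|lborel. (LINT \<tau>|lborel. indicator {0..t} \<tau> *\<^sub>R (g (x + \<tau> *\<^sub>R i) * \<phi> x)))"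
    proof (rule lborel_pair.Fubini_integral)
      show "integrable (lborel \<Otimes>\<^sub>M lborel) (\<lambda>(x, \<tau>). indicator {0..t} \<tau> *\<^sub>R (g (x + \<tau> *\<^sub>R i) * \<phi> x))"
        using translates_product_integrable[OF g gb L(1) test_function_borel[OF \<phi>], where t = t and a = i and b = 0]
        by simp
    qed
    also have "\<dots> = (LINT x|lborel. G x * \<phi> x)"
      unfolding G_def by (intro Bochner_Integration.integral_cong refl)
        (simp only: mult_scaleR_left[symmetric] Bochner_Integration.integral_mult_left_zero)
    finally have "(LINT x|lborel. D x * \<phi> x) = (LINT x|lborel. G x * \<phi> x)" .
    then have "(LINT x|lborel. (D x - G x) * \<phi> x) = 0"
      unfolding left_diff_distrib
      using il[OF D Db L(1)] il[OF G(1) Gb L(1)] by simp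
    then show "(LINT x|lebesgue. (D x - G x) * \<phi> x) = 0"
      by (subst integral_completion) simp_all
  qed
  then have "norm_L2 D = norm_L2 G"
    using L2D(1)[OF D] L2D(1)[OF G(1)] by (intro norm_L2_cong_AE) auto
  then show ?thesis using G(2) by (simp add: D_def[abs_def])
qed

text \<open>The shift by \<open>h\<close> is a composition of shifts along the axes; translation invariance of the norm
  lets the single estimates add up, and also reduces negative shifts to positive ones.\<close>

lemma translation_estimate:
  fixes u :: "'a::euclidean_space \<Rightarrow> complex"
  assumes u: "u \<in> L2" and ub: "u \<in> borel_measurable borel"
    and g: "\<And>i. i \<in> Basis \<Longrightarrow> g i \<in> L2" and wk: "\<And>i. i \<in> Basis \<Longrightarrow> has_weak_partial i u (g i)"
  shows "norm_L2 (\<lambda>x. u (x + h) - u x) \<le> norm h * (\<Sum>i\<in>Basis. norm_L2 (g i))"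
proof -
  have axis: "norm_L2 (\<lambda>x. u (x + t *\<^sub>R i) - u x) \<le> \<bar>t\<bar> * norm_L2 (g i)" if i: "i \<in> Basis" for i t
  proof -
    obtain g' where g'b: "g' \<in> borel_measurable borel" and ae: "AE x in lebesgue. g i x = g' x"
      using complex_borel_representative[OF L2D(1)[OF g[OF i]]] by blast
    have g': "g' \<in> L2" by (rule L2_cong_AE[OF g[OF i] borel_imp_lebesgue_measurable[OF g'b] ae])
    have n: "norm_L2 (g i) = norm_L2 g'" by (rule norm_L2_cong_AE[OF L2D(1)[OF g[OF i]] borel_imp_lebesgue_measurable[OF g'b] ae])
    have wk': "has_weak_partial i u g'"
      by (rule has_weak_partial_cong_AE[OF wk[OF i] i u u g[OF i] g' AE_I2[OF refl] ae])
    note pos = translation_estimate_axis[OF u ub g' g'b wk' i]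
    show ?thesis
    proof (cases "0 \<le> t")
      case True
      then show ?thesis using pos[of t] by (simp add: n)
    next
      case False
      define s where "s = - t"
      have s: "0 \<le> s" using False by (simp add: s_def)
      note T = translate_L2[OF u ub]
      have m: "(\<lambda>x. u (x + t *\<^sub>R i) - u x) \<in> L2" "(\<lambda>x. u (x + t *\<^sub>R i) - u x) \<in> borel_measurable borel"
        using L2.diff_mem[OF T(2) u] T(1) ub by (auto intro: borel_measurable_diff)
      have "norm_L2 (\<lambda>x. u (x + t *\<^sub>R i) - u x) = norm_L2 (\<lambda>x. u ((x + s *\<^sub>R i) + t *\<^sub>R i) - u (x + s *\<^sub>R i))"
        by (rule translate_L2(3)[OF m, symmetric])
      also have "\<dots> = norm_L2 (\<lambda>x. u x - u (x + s *\<^sub>R i))" by (simp add: s_def)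
      also have "\<dots> = norm_L2 (\<lambda>x. u (x + s *\<^sub>R i) - u x)" by (rule L2.nrm_diff_commute[OF u T(2)])
      also have "\<dots> \<le> s * norm_L2 g'" by (rule pos[OF s])
      finally show ?thesis using False by (simp add: n s_def)
    qed
  qed
  have "norm_L2 (\<lambda>x. u (x + (\<Sum>i\<in>I. (h \<bullet> i) *\<^sub>R i)) - u x) \<le> (\<Sum>i\<in>I. \<bar>h \<bullet> i\<bar> * norm_L2 (g i))"
    if "finite I" "I \<subseteq> Basis" for I
    using that
  proof (induction I)
    case empty
    then show ?case by (simp add: norm_L2_def)
  next
    case (insert j I)
    let ?s = "\<Sum>i\<in>I. (h \<bullet> i) *\<^sub>R i"
    note T = translate_L2[OF u ub]
    have m: "(\<lambda>x. u (x + ?s) - u x) \<in> L2" "(\<lambda>x. u (x + ?s) - u x) \<in> borel_measurable borel"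
      using L2.diff_mem[OF T(2) u] T(1) ub by (auto intro: borel_measurable_diff)
    have "norm_L2 (\<lambda>x. u ((x + (h \<bullet> j) *\<^sub>R j) + ?s) - u x)
        \<le> norm_L2 (\<lambda>x. u ((x + (h \<bullet> j) *\<^sub>R j) + ?s) - u (x + (h \<bullet> j) *\<^sub>R j)) + norm_L2 (\<lambda>x. u (x + (h \<bullet> j) *\<^sub>R j) - u x)"
      by (rule L2.triangle_diff) (simp_all add: T(2) add.assoc u)
    also have "norm_L2 (\<lambda>x. u ((x + (h \<bullet> j) *\<^sub>R j) + ?s) - u (x + (h \<bullet> j) *\<^sub>R j)) = norm_L2 (\<lambda>x. u (x + ?s) - u x)"
      by (rule translate_L2(3)[OF m])
    also have "\<dots> \<le> (\<Sum>i\<in>I. \<bar>h \<bullet> i\<bar> * norm_L2 (g i))" using insert by simp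
    also have "norm_L2 (\<lambda>x. u (x + (h \<bullet> j) *\<^sub>R j) - u x) \<le> \<bar>h \<bullet> j\<bar> * norm_L2 (g j)"
      using insert by (intro axis) simp
    finally show ?case using insert by (simp add: add.assoc)
  qed
  from this[of Basis] have "norm_L2 (\<lambda>x. u (x + h) - u x) \<le> (\<Sum>i\<in>Basis. \<bar>h \<bullet> i\<bar> * norm_L2 (g i))"
    by (simp add: euclidean_representation)
  also have "\<dots> \<le> (\<Sum>i\<in>Basis. norm h * norm_L2 (g i))"
    by (intro sum_mono mult_right_mono norm_L2_nonneg Basis_le_norm)
  finally show ?thesis by (simp add: sum_distrib_left)
qed

section \<open>Ball averages\<close>

text \<open>Writing the mean over a ball as an inner product with an indicator makes linearity, independence of the representative and the bound
  \<open>ball_avg_le\<close> immediate.\<close>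

definition ball_avg :: "real \<Rightarrow> ('a::euclidean_space \<Rightarrow> complex) \<Rightarrow> 'a \<Rightarrow> complex" where
  "ball_avg s u x = inner_L2 (indicator (cball x s)) u / complex_of_real (measure lborel (cball (0::'a) s))"

lemma content_cball_translate: "measure lborel (cball (x::'a) s) = measure lborel (cball (0::'a::euclidean_space) s)"
  by (cases "0 \<le> s") (simp_all add: content_cball)

lemma emeasure_cball_content: "emeasure lborel (cball (x::'a::euclidean_space) s) = ennreal (measure lborel (cball (0::'a) s))"
  using emeasure_eq_ennreal_measure[of lborel "cball x s"] emeasure_lborel_cball_finite[of x s]
  by (simp add: content_cball_translate[of x] less_top)

lemma cball_indicator_L2: "(indicator (cball x s) :: 'a::euclidean_space \<Rightarrow> complex) \<in> L2"
  using indicator_L2[of "cball x s"] by simp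

lemma norm_cball_indicator: "norm_L2 (indicator (cball (x::'a::euclidean_space) s)) = sqrt (measure lborel (cball (0::'a) s))"
proof -
  have "(\<lambda>y. (cmod (indicator (cball x s) y))\<^sup>2) = (indicator (cball x s) :: 'a \<Rightarrow> real)"
    by (auto simp: indicator_def)
  then have "(LINT y|lebesgue. (cmod (indicator (cball x s) y))\<^sup>2) = measure lborel (cball x s)"
    by simp
  then show ?thesis unfolding norm_L2_def by (simp only: content_cball_translate[of x])
qed

lemma ball_avg_diff:
  assumes "u \<in> L2" "v \<in> L2"
  shows "ball_avg s (\<lambda>x. u x - v x) x = ball_avg s u x - ball_avg s v x"
  unfolding ball_avg_def L2.lin_diff[OF cball_indicator_L2 assms] by (rule diff_divide_distrib)

lemma ball_avg_cong_AE:
  assumes "u \<in> L2" "u' \<in> L2" "AE x in lebesgue. u x = u' x"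
  shows "ball_avg s u x = ball_avg s u' x"
  unfolding ball_avg_def
  by (subst inner_L2_cong_AE[OF cball_indicator_L2 assms(1) cball_indicator_L2 assms(2) AE_I2[OF refl] assms(3)]) (rule refl)

lemma ball_avg_le:
  fixes u :: "'a::euclidean_space \<Rightarrow> complex"
  assumes "u \<in> L2" "0 < s"
  shows "cmod (ball_avg s u x) \<le> norm_L2 u / sqrt (measure lborel (cball (0::'a) s))"
proof -
  let ?c = "measure lborel (cball (0::'a) s)"
  have c: "0 < ?c" by (rule content_cball_pos[OF assms(2)])
  have "cmod (inner_L2 (indicator (cball x s)) u) \<le> sqrt ?c * norm_L2 u"
    using L2.cauchy_schwarz[OF cball_indicator_L2 assms(1)] by (simp add: norm_cball_indicator)
  then have "cmod (ball_avg s u x) \<le> sqrt ?c * norm_L2 u / ?c"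
    unfolding ball_avg_def norm_divide using c by (simp add: divide_right_mono)
  also have "\<dots> = norm_L2 u / sqrt ?c" using c real_sqrt_mult_self[of ?c] by (simp add: field_simps)
  finally show ?thesis .
qed

lemma cnj_indicator_mult: "cnj (indicator A y) * z = indicator A y *\<^sub>R z"
  by (simp add: indicator_def)

text \<open>After a shift, the mean is an integral over a fixed ball, in which the centre enters only through the
  translate of \<open>u\<close>.\<close>

lemma ball_avg_borel:
  fixes u :: "'a::euclidean_space \<Rightarrow> complex"
  assumes u: "u \<in> L2" and ub[measurable]: "u \<in> borel_measurable borel"
  shows "ball_avg s u x = inner_L2 (indicator (cball 0 s)) (\<lambda>h. u (x + h)) / complex_of_real (measure lborel (cball (0::'a) s))"
    "inner_L2 (indicator (cball 0 s)) (\<lambda>h. u (x + h)) = (LINT h|lborel. indicator (cball 0 s) h *\<^sub>R u (x + h))"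
proof -
  have [measurable]: "cball y s \<in> sets borel" for y :: 'a by simp
  have "inner_L2 (indicator (cball x s)) u = (LINT y|lborel. indicator (cball x s) y *\<^sub>R u y)"
    unfolding inner_L2_def cnj_indicator_mult by (rule integral_completion) measurable
  also have "\<dots> = (LINT h|lborel. indicator (cball x s) (h + x) *\<^sub>R u (h + x))"
    by (rule integral_translate[symmetric]) measurable
  also have "\<dots> = (LINT h|lborel. indicator (cball 0 s) h *\<^sub>R u (x + h))"
    by (intro Bochner_Integration.integral_cong refl) (auto simp: indicator_def dist_norm add.commute)
  finally have 1: "inner_L2 (indicator (cball x s)) u = (LINT h|lborel. indicator (cball 0 s) h *\<^sub>R u (x + h))" .
  show 2: "inner_L2 (indicator (cball 0 s)) (\<lambda>h. u (x + h)) = (LINT h|lborel. indicator (cball 0 s) h *\<^sub>R u (x + h))"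
    unfolding inner_L2_def cnj_indicator_mult by (rule integral_completion) measurable
  show "ball_avg s u x = inner_L2 (indicator (cball 0 s)) (\<lambda>h. u (x + h)) / complex_of_real (measure lborel (cball (0::'a) s))"
    unfolding ball_avg_def 1 2 ..
qed

lemma ball_avg_borel_measurable:
  assumes u: "u \<in> L2" and ub[measurable]: "u \<in> borel_measurable borel"
  shows "ball_avg s u \<in> borel_measurable borel"
proof -
  have [measurable]: "cball 0 s \<in> sets borel" by simp
  have "(\<lambda>x. LINT h|lborel. indicator (cball 0 s) h *\<^sub>R u (x + h)) \<in> borel_measurable borel"
    by (rule lborel.borel_measurable_lebesgue_integral) measurable
  then show ?thesis unfolding ball_avg_borel[OF u ub, abs_def] by simp
qed

lemma sqnorm_mean_le:
  fixes k :: "'a::euclidean_space \<Rightarrow> complex"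
  assumes k: "k \<in> borel_measurable borel" and s: "0 < s"
  defines "c \<equiv> measure lborel (cball (0::'a) s)"
  shows "sqnorm ((LINT h|lborel. indicator (cball 0 s) h *\<^sub>R k h) / complex_of_real c)
    \<le> ennreal (1 / c) * (\<integral>\<^sup>+h. indicator (cball 0 s) h * sqnorm (k h) \<partial>lborel)"
proof -
  have c: "0 < c" unfolding c_def by (rule content_cball_pos[OF s])
  let ?I = "LINT h|lborel. indicator (cball 0 s) h *\<^sub>R k h"
  let ?J = "\<integral>\<^sup>+h. indicator (cball 0 s) h * sqnorm (k h) \<partial>lborel"
  have "sqnorm (?I / complex_of_real c) = ennreal (1 / c\<^sup>2) * sqnorm ?I"
    using c by (simp add: norm_divide power_divide flip: ennreal_mult)
  also have "\<dots> \<le> ennreal (1 / c\<^sup>2) * (ennreal c * ?J)"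
    using sq_norm_integral_le[of k lborel "cball 0 s"] k
    by (intro mult_left_mono) (simp_all add: emeasure_cball_content c_def)
  also have "\<dots> = ennreal (1 / c) * ?J"
    using c by (simp add: mult.assoc[symmetric] power2_eq_square flip: ennreal_mult)
  finally show ?thesis .
qed

text \<open>The difference of two means is the mean of \<open>u (x + h) - u (y + h)\<close> over \<open>h\<close>, a translate
  difference.\<close>

lemma ball_avg_lipschitz:
  fixes u :: "'a::euclidean_space \<Rightarrow> complex"
  assumes u: "u \<in> L2" and ub[measurable]: "u \<in> borel_measurable borel" and s: "0 < s"
    and tr: "\<And>h. norm_L2 (\<lambda>x. u (x + h) - u x) \<le> norm h * K"
  shows "cmod (ball_avg s u x - ball_avg s u y) \<le> dist x y * K / sqrt (measure lborel (cball (0::'a) s))"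
proof -
  let ?c = "measure lborel (cball (0::'a) s)"
  have c: "0 < ?c" by (rule content_cball_pos[OF s])
  have T: "(\<lambda>h. u (z + h)) \<in> L2" for z using translate_L2(2)[OF u ub, of z] by (simp add: add.commute)
  let ?d = "\<lambda>z. u (z + (x - y)) - u z"
  have d: "?d \<in> L2" "?d \<in> borel_measurable borel"
    using L2.diff_mem[OF translate_L2(2)[OF u ub] u] by measurable
  have "norm_L2 (\<lambda>h. u (x + h) - u (y + h)) = norm_L2 (\<lambda>h. ?d (h + y))" by (simp add: algebra_simps)
  also have "\<dots> = norm_L2 ?d" by (rule translate_L2(3)[OF d])
  also have "\<dots> \<le> dist x y * K" using tr[of "x - y"] by (simp add: dist_norm)
  finally have n: "norm_L2 (\<lambda>h. u (x + h) - u (y + h)) \<le> dist x y * K" .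
  have "ball_avg s u x - ball_avg s u y = inner_L2 (indicator (cball 0 s)) (\<lambda>h. u (x + h) - u (y + h)) / complex_of_real ?c"
    unfolding ball_avg_borel(1)[OF u ub] L2.lin_diff[OF cball_indicator_L2 T T] by (rule diff_divide_distrib[symmetric])
  moreover have "cmod (inner_L2 (indicator (cball 0 s)) (\<lambda>h. u (x + h) - u (y + h))) \<le> sqrt ?c * (dist x y * K)"
  proof -
    have "cmod (inner_L2 (indicator (cball 0 s)) (\<lambda>h. u (x + h) - u (y + h))) \<le> sqrt ?c * norm_L2 (\<lambda>h. u (x + h) - u (y + h))"
      using L2.cauchy_schwarz[OF cball_indicator_L2 L2.diff_mem[OF T T]] by (simp only: norm_cball_indicator)
    also have "\<dots> \<le> sqrt ?c * (dist x y * K)" by (rule mult_left_mono[OF n]) (use c in simp)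
    finally show ?thesis .
  qed
  ultimately have "cmod (ball_avg s u x - ball_avg s u y) \<le> sqrt ?c * (dist x y * K) / ?c"
    using c by (simp add: norm_divide divide_right_mono)
  also have "\<dots> = dist x y * K / sqrt ?c" using c real_sqrt_mult_self[of ?c] by (simp add: field_simps)
  finally show ?thesis .
qed

text \<open>The error \<open>u - ball_avg s u\<close> is a mean of the differences \<open>u x - u (x + h)\<close> with
  \<open>|h| \<le> s\<close>, each of which has norm at most \<open>s K\<close>.\<close>

lemma ball_avg_approx:
  fixes u :: "'a::euclidean_space \<Rightarrow> complex"
  assumes u: "u \<in> L2" and ub[measurable]: "u \<in> borel_measurable borel" and s: "0 < s" and K: "0 \<le> K"
    and tr: "\<And>h. norm_L2 (\<lambda>x. u (x + h) - u x) \<le> norm h * K"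
  shows "(\<lambda>x. u x - ball_avg s u x) \<in> L2" "norm_L2 (\<lambda>x. u x - ball_avg s u x) \<le> s * K"
proof -
  let ?c = "measure lborel (cball (0::'a) s)"
  have c: "0 < ?c" by (rule content_cball_pos[OF s])
  let ?q = "\<lambda>x h. indicator (cball 0 s) h * sqnorm (u (x + h) - u x)"
  have [measurable]: "cball (0::'a) s \<in> sets borel" by simp
  note [measurable] = ball_avg_borel_measurable[OF u ub, of s]
  have m: "(\<lambda>x. u x - ball_avg s u x) \<in> borel_measurable borel" by measurable
  have pt: "sqnorm (u x - ball_avg s u x)
      \<le> ennreal (1 / ?c) * (\<integral>\<^sup>+h. ?q x h \<partial>lborel)" for x
  proof -
    have T: "(\<lambda>h. u (x + h)) \<in> L2" using translate_L2(2)[OF u ub, of x] by (simp add: add.commute)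
    have "integrable lebesgue (\<lambda>h. indicator (cball 0 s) h * u (x + h))"
      by (rule L2_mult_integrable[OF cball_indicator_L2 T])
    moreover have "(\<lambda>h. indicator (cball 0 s) h * u (x + h)) = (\<lambda>h. indicator (cball 0 s) h *\<^sub>R u (x + h))"
      by (auto simp: indicator_def)
    ultimately have "integrable lebesgue (\<lambda>h. indicator (cball 0 s) h *\<^sub>R u (x + h))" by simp
    then have i1: "integrable lborel (\<lambda>h. indicator (cball 0 s) h *\<^sub>R u (x + h))"
      by (subst (asm) integrable_completion) simp_all
    have i2: "integrable lborel (\<lambda>h. indicator (cball (0::'a) s) h *\<^sub>R u x)"
      using emeasure_lborel_cball_finite[of "0::'a" s] by (intro integrable_scaleR_left integrable_real_indicator) auto
    have "(LINT h|lborel. indicator (cball 0 s) h *\<^sub>R (u (x + h) - u x))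
        = (LINT h|lborel. indicator (cball 0 s) h *\<^sub>R u (x + h)) - (LINT h|lborel. indicator (cball (0::'a) s) h *\<^sub>R u x)"
      unfolding scaleR_diff_right by (rule Bochner_Integration.integral_diff[OF i1 i2])
    also have "(LINT h|lborel. indicator (cball (0::'a) s) h *\<^sub>R u x) = complex_of_real ?c * u x"
      by (simp add: scaleR_conv_of_real)
    finally have "(LINT h|lborel. indicator (cball 0 s) h *\<^sub>R (u (x + h) - u x)) = complex_of_real ?c * (ball_avg s u x - u x)"
      using c unfolding ball_avg_borel[OF u ub] by (simp add: right_diff_distrib)
    then have "ball_avg s u x - u x = (LINT h|lborel. indicator (cball 0 s) h *\<^sub>R (u (x + h) - u x)) / complex_of_real ?c"
      using c by simp
    then have "sqnorm (u x - ball_avg s u x) = sqnorm ((LINT h|lborel. indicator (cball 0 s) h *\<^sub>R (u (x + h) - u x)) / complex_of_real ?c)"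
      by (simp only: norm_minus_commute[of "u x"])
    then show ?thesis using sqnorm_mean_le[OF _ s, of "\<lambda>h. u (x + h) - u x"] by simp
  qed
  have "(\<integral>\<^sup>+x. sqnorm (u x - ball_avg s u x) \<partial>lborel)
      \<le> (\<integral>\<^sup>+x. ennreal (1 / ?c) * (\<integral>\<^sup>+h. ?q x h \<partial>lborel) \<partial>lborel)"
    by (rule nn_integral_mono) (rule pt)
  also have "\<dots> = ennreal (1 / ?c) * (\<integral>\<^sup>+x. (\<integral>\<^sup>+h. ?q x h \<partial>lborel) \<partial>lborel)"
    by (intro nn_integral_cmult lborel.borel_measurable_nn_integral) measurable
  also have "(\<integral>\<^sup>+x. (\<integral>\<^sup>+h. ?q x h \<partial>lborel) \<partial>lborel)
      = (\<integral>\<^sup>+h. (\<integral>\<^sup>+x. ?q x h \<partial>lborel) \<partial>lborel)"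
    by (rule lborel_pair.Fubini'[symmetric]) measurable
  also have "\<dots> \<le> (\<integral>\<^sup>+h. ennreal ((s * K)\<^sup>2) * indicator (cball (0::'a) s) h \<partial>lborel)"
  proof (rule nn_integral_mono)
    fix h :: 'a
    have "(\<integral>\<^sup>+x. ?q x h \<partial>lborel)
        = indicator (cball 0 s) h * (\<integral>\<^sup>+x. sqnorm (u (x + h) - u x) \<partial>lborel)"
      by (rule nn_integral_cmult) measurable
    also have "(\<integral>\<^sup>+x. sqnorm (u (x + h) - u x) \<partial>lborel) = ennreal ((norm_L2 (\<lambda>x. u (x + h) - u x))\<^sup>2)"
      by (rule nn_integral_norm_L2[OF L2.diff_mem[OF translate_L2(2)[OF u ub] u]]) measurable
    also have "indicator (cball 0 s) h * ennreal ((norm_L2 (\<lambda>x. u (x + h) - u x))\<^sup>2) \<le> ennreal ((s * K)\<^sup>2) * indicator (cball (0::'a) s) h"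
    proof (cases "h \<in> cball 0 s")
      case True
      then have "norm h * K \<le> s * K" using K by (intro mult_right_mono) auto
      then have "norm_L2 (\<lambda>x. u (x + h) - u x) \<le> s * K" using tr[of h] by linarith
      then show ?thesis using True by (simp add: ennreal_leI power_mono norm_L2_nonneg)
    qed simp
    finally show "(\<integral>\<^sup>+x. ?q x h \<partial>lborel) \<le> ennreal ((s * K)\<^sup>2) * indicator (cball (0::'a) s) h" .
  qed
  also have "\<dots> = ennreal ((s * K)\<^sup>2) * ennreal ?c"
    by (subst nn_integral_cmult_indicator) (simp_all add: emeasure_cball_content)
  finally have "(\<integral>\<^sup>+x. sqnorm (u x - ball_avg s u x) \<partial>lborel) \<le> ennreal (1 / ?c) * (ennreal ((s * K)\<^sup>2) * ennreal ?c)"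
    by (simp add: mult_left_mono)
  also have "\<dots> = ennreal ((s * K)\<^sup>2)" using c by (simp add: ennreal_mult[symmetric])
  finally have "(\<integral>\<^sup>+x. sqnorm (u x - ball_avg s u x) \<partial>lborel) \<le> ennreal ((s * K)\<^sup>2)" .
  from L2I_nn_integral[OF m _ this] s K
  show "(\<lambda>x. u x - ball_avg s u x) \<in> L2" "norm_L2 (\<lambda>x. u x - ball_avg s u x) \<le> s * K" by auto
qed

text \<open>By \<open>sqnorm_mean_le\<close> and Tonelli's theorem, the mass of the means on \<open>S\<close> is at most the integral of
  \<open>|u y|\<^sup>2\<close> weighted by the fraction of the ball around \<open>y\<close> that \<open>S\<close> occupies.\<close>

lemma ball_avg_thin:
  fixes u :: "'a::euclidean_space \<Rightarrow> complex"
  assumes u: "u \<in> L2" and ub[measurable]: "u \<in> borel_measurable borel" and s: "0 < s" and e: "0 \<le> \<epsilon>"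
    and S[measurable]: "S \<in> sets borel" and thin: "\<And>y. emeasure lborel (S \<inter> cball y s) \<le> ennreal \<epsilon>"
  shows "(\<integral>\<^sup>+x. indicator S x * sqnorm (ball_avg s u x) \<partial>lborel) \<le> ennreal (\<epsilon> / measure lborel (cball (0::'a) s) * (norm_L2 u)\<^sup>2)"
proof -
  let ?c = "measure lborel (cball (0::'a) s)"
  let ?i = "\<lambda>x y. indicator {..s} (dist x y) :: ennreal"
  let ?q = "\<lambda>x y. indicator S x * (?i x y * sqnorm (u y))"
  have c: "0 < ?c" by (rule content_cball_pos[OF s])
  have [measurable]: "cball y s \<in> sets borel" for y :: 'a by simp
  have pt: "sqnorm (ball_avg s u x) \<le> ennreal (1 / ?c) * (\<integral>\<^sup>+y. ?i x y * sqnorm (u y) \<partial>lborel)" for x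
  proof -
    have "sqnorm (ball_avg s u x) \<le> ennreal (1 / ?c) * (\<integral>\<^sup>+h. indicator (cball 0 s) h * sqnorm (u (x + h)) \<partial>lborel)"
      unfolding ball_avg_borel[OF u ub] using sqnorm_mean_le[OF _ s, of "\<lambda>h. u (x + h)"] by simp
    also have "(\<integral>\<^sup>+h. indicator (cball 0 s) h * sqnorm (u (x + h)) \<partial>lborel) = (\<integral>\<^sup>+h. ?i x (h + x) * sqnorm (u (h + x)) \<partial>lborel)"
      by (intro nn_integral_cong) (auto simp: indicator_def dist_norm add.commute)
    also have "\<dots> = (\<integral>\<^sup>+y. ?i x y * sqnorm (u y) \<partial>lborel)"
      by (rule nn_integral_translate) measurable
    finally show ?thesis .
  qed
  have "(\<integral>\<^sup>+x. indicator S x * sqnorm (ball_avg s u x) \<partial>lborel)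
      \<le> (\<integral>\<^sup>+x. ennreal (1 / ?c) * (\<integral>\<^sup>+y. ?q x y \<partial>lborel) \<partial>lborel)"
  proof (rule nn_integral_mono)
    fix x
    show "indicator S x * sqnorm (ball_avg s u x) \<le> ennreal (1 / ?c) * (\<integral>\<^sup>+y. ?q x y \<partial>lborel)"
      using pt[of x] by (cases "x \<in> S") simp_all
  qed
  also have "\<dots> = ennreal (1 / ?c) * (\<integral>\<^sup>+x. (\<integral>\<^sup>+y. ?q x y \<partial>lborel) \<partial>lborel)"
    by (intro nn_integral_cmult lborel.borel_measurable_nn_integral) measurable
  also have "(\<integral>\<^sup>+x. (\<integral>\<^sup>+y. ?q x y \<partial>lborel) \<partial>lborel)
      = (\<integral>\<^sup>+y. (\<integral>\<^sup>+x. ?q x y \<partial>lborel) \<partial>lborel)"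
    by (rule lborel_pair.Fubini'[symmetric]) measurable
  also have "\<dots> \<le> (\<integral>\<^sup>+y. ennreal \<epsilon> * sqnorm (u y) \<partial>lborel)"
  proof (rule nn_integral_mono)
    fix y
    have "(\<integral>\<^sup>+x. ?q x y \<partial>lborel) = (\<integral>\<^sup>+x. sqnorm (u y) * indicator (S \<inter> cball y s) x \<partial>lborel)"
      by (intro nn_integral_cong) (auto simp: indicator_def dist_commute)
    also have "\<dots> = sqnorm (u y) * emeasure lborel (S \<inter> cball y s)"
      by (rule nn_integral_cmult_indicator) simp
    also have "\<dots> \<le> ennreal \<epsilon> * sqnorm (u y)"
      by (subst mult.commute) (intro mult_right_mono thin, simp)
    finally show "(\<integral>\<^sup>+x. ?q x y \<partial>lborel) \<le> ennreal \<epsilon> * sqnorm (u y)" .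
  qed
  also have "\<dots> = ennreal \<epsilon> * ennreal ((norm_L2 u)\<^sup>2)"
    by (subst nn_integral_cmult) (simp_all add: nn_integral_norm_L2[OF u ub])
  finally have "(\<integral>\<^sup>+x. indicator S x * sqnorm (ball_avg s u x) \<partial>lborel) \<le> ennreal (1 / ?c) * (ennreal \<epsilon> * ennreal ((norm_L2 u)\<^sup>2))"
    by (simp add: mult_left_mono)
  also have "\<dots> = ennreal (\<epsilon> / ?c * (norm_L2 u)\<^sup>2)" using c e by (simp flip: ennreal_mult)
  finally show ?thesis .
qed

text \<open>The estimates for Borel functions carry over, since the means and all norms depend only on the class
  of \<open>u\<close> modulo null sets.\<close>

lemma H1_ball_avg_estimates:
  fixes u :: "'a::euclidean_space \<Rightarrow> complex"
  assumes u: "u \<in> H1" and s: "0 < s"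
  defines "K \<equiv> \<Sum>i\<in>Basis. norm_L2 (weak_partial i u)" and "c \<equiv> measure lborel (cball (0::'a) s)"
  shows "ball_avg s u \<in> borel_measurable borel"
    and "(\<lambda>x. u x - ball_avg s u x) \<in> L2" and "norm_L2 (\<lambda>x. u x - ball_avg s u x) \<le> s * K"
    and "cmod (ball_avg s u x - ball_avg s u y) \<le> dist x y * K / sqrt c"
    and "0 \<le> \<epsilon> \<Longrightarrow> S \<in> sets borel \<Longrightarrow> (\<And>y. emeasure lborel (S \<inter> cball y s) \<le> ennreal \<epsilon>) \<Longrightarrow>
      (\<integral>\<^sup>+x. indicator S x * sqnorm (ball_avg s u x) \<partial>lborel) \<le> ennreal (\<epsilon> / c * (norm_L2 u)\<^sup>2)"
proof -
  note uL = H1_L2[OF u]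
  obtain v where vb: "v \<in> borel_measurable borel" and ae: "AE x in lebesgue. u x = v x"
    using complex_borel_representative[OF L2D(1)[OF uL]] by blast
  note vl = borel_imp_lebesgue_measurable[OF vb]
  have v: "v \<in> L2" by (rule L2_cong_AE[OF uL vl ae])
  have avg: "ball_avg s u = ball_avg s v" by (rule ext) (rule ball_avg_cong_AE[OF uL v ae])
  have n: "norm_L2 u = norm_L2 v" by (rule norm_L2_cong_AE[OF L2D(1)[OF uL] vl ae])
  have wk: "has_weak_partial i v (weak_partial i u)" if i: "i \<in> Basis" for i
    using weak_partial[OF u i]
    by (intro has_weak_partial_cong_AE[OF _ i uL v _ _ ae AE_I2[OF refl]])
  have tr: "norm_L2 (\<lambda>x. v (x + h) - v x) \<le> norm h * K" for h
    unfolding K_def by (rule translation_estimate[OF v vb weak_partial(1)[OF u] wk])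
  have K: "0 \<le> K" unfolding K_def by (intro sum_nonneg norm_L2_nonneg)
  show b: "ball_avg s u \<in> borel_measurable borel" unfolding avg by (rule ball_avg_borel_measurable[OF v vb])
  note a = ball_avg_approx[OF v vb s K tr]
  have m: "(\<lambda>x. u x - ball_avg s u x) \<in> borel_measurable lebesgue"
    using L2D(1)[OF uL] borel_imp_lebesgue_measurable[OF b] by (rule borel_measurable_diff)
  have ae': "AE x in lebesgue. v x - ball_avg s v x = u x - ball_avg s u x"
    using ae by eventually_elim (simp add: avg)
  show "(\<lambda>x. u x - ball_avg s u x) \<in> L2" by (rule L2_cong_AE[OF a(1) m ae'])
  show "norm_L2 (\<lambda>x. u x - ball_avg s u x) \<le> s * K"
    using norm_L2_cong_AE[OF L2D(1)[OF a(1)] m ae'] a(2) by simp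
  show "cmod (ball_avg s u x - ball_avg s u y) \<le> dist x y * K / sqrt c"
    unfolding avg c_def by (rule ball_avg_lipschitz[OF v vb s tr])
  show "(\<integral>\<^sup>+x. indicator S x * sqnorm (ball_avg s u x) \<partial>lborel) \<le> ennreal (\<epsilon> / c * (norm_L2 u)\<^sup>2)"
    if "0 \<le> \<epsilon>" "S \<in> sets borel" "\<And>y. emeasure lborel (S \<inter> cball y s) \<le> ennreal \<epsilon>"
    unfolding avg c_def n by (rule ball_avg_thin[OF v vb s that])
qed

section \<open>Thin sets\<close>

text \<open>A Borel subset of full measure, for use where joint measurability matters.\<close>

lemma lebesgue_set_borel_core:
  assumes "\<Omega> \<in> sets lebesgue"
  obtains S where "S \<in> sets borel" "S \<subseteq> \<Omega>" "AE x in lebesgue. x \<in> \<Omega> \<longrightarrow> x \<in> S"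
proof -
  from sets_completionE[OF assms] obtain S N N' where *: "\<Omega> = S \<union> N" "N \<subseteq> N'" "N' \<in> null_sets lborel" "S \<in> sets lborel"
    by metis
  have "AE x in lebesgue. x \<notin> N'"
    using *(3) by (intro AE_not_in null_sets_completionI)
  then have "AE x in lebesgue. x \<in> \<Omega> \<longrightarrow> x \<in> S"
    by eventually_elim (use *(1,2) in auto)
  with * show thesis by (intro that[of S]) auto
qed

text \<open>Replacing \<open>\<Omega>\<close> by a Borel subset of full measure turns the volume into an integral of a jointly
  measurable function, so that its measurability in the centre follows from Tonelli's theorem.\<close>

lemma omega_measurable:
  fixes \<Omega> :: "'a::euclidean_space set"
  assumes "\<Omega> \<in> sets lebesgue"
  shows "omega l \<Omega> \<in> borel_measurable borel"
proof -
  obtain S where S[measurable]: "S \<in> sets borel" "S \<subseteq> \<Omega>" and ae: "AE x in lebesgue. x \<in> \<Omega> \<longrightarrow> x \<in> S"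
    using lebesgue_set_borel_core[OF assms] .
  have [measurable]: "cball y l \<in> sets borel" for y :: 'a by simp
  have "omega l \<Omega> x = enn2real (\<integral>\<^sup>+y. indicator S y * indicator {..l} (dist x y) \<partial>lborel)" for x
  proof -
    have "emeasure lebesgue (\<Omega> \<inter> cball x l) = emeasure lebesgue (S \<inter> cball x l)"
      by (rule emeasure_eq_AE) (use ae S(2) assms in \<open>auto elim!: eventually_mono\<close>)
    also have "\<dots> = emeasure lborel (S \<inter> cball x l)" by simp
    also have "\<dots> = (\<integral>\<^sup>+y. indicator (S \<inter> cball x l) y \<partial>lborel)" by simp
    also have "\<dots> = (\<integral>\<^sup>+y. indicator S y * indicator {..l} (dist x y) \<partial>lborel)"
      by (intro nn_integral_cong) (auto simp: indicator_def)
    finally show ?thesis by (simp add: omega_def measure_def)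
  qed
  moreover have "(\<lambda>x. enn2real (\<integral>\<^sup>+y. indicator S y * indicator {..l} (dist x y) \<partial>lborel)) \<in> borel_measurable borel"
    by measurable
  ultimately show ?thesis by (metis (no_types, lifting) ext)
qed

text \<open>Let \<open>A\<close> be the
  part of \<open>\<Omega>\<close> that lies in the ball of radius \<open>s\<close> around \<open>y\<close> but outside the ball of
  radius \<open>R\<close> around \<open>0\<close>, and let \<open>m\<close> be its measure. For \<open>x\<close> in \<open>A\<close>, the ball of
  radius \<open>2 s\<close> around \<open>x\<close> contains \<open>A\<close>, so
  \<open>omega (2 * s) \<Omega> x \<ge> m\<close>. Hence \<open>m\<close> to the power \<open>r + 1\<close> is at most the tail of
  the convergent integral over \<open>\<Omega>\<close> outside the ball of radius \<open>R\<close>.\<close>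

lemma polynomially_thin_tail:
  fixes \<Omega> :: "'a::euclidean_space set"
  assumes thin: "polynomially_thin r \<Omega>" and r: "0 < r" and s: "0 < s" and e: "0 < \<epsilon>"
  obtains R where "0 < R" "\<And>y. emeasure lebesgue (\<Omega> \<inter> cball y s - cball 0 R) \<le> ennreal \<epsilon>"
proof -
  have \<Omega>: "\<Omega> \<in> sets lebesgue" using thin by (simp add: polynomially_thin_def)
  define w where "w x = ennreal (omega (2 * s) \<Omega> x powr r) * indicator \<Omega> x" for x
  have wint: "(\<integral>\<^sup>+x. w x \<partial>lebesgue) < \<infinity>"
    using thin s unfolding polynomially_thin_def w_def by (metis mult_pos_pos zero_less_numeral)
  have om[measurable]: "omega (2 * s) \<Omega> \<in> borel_measurable lebesgue"
    by (rule borel_imp_lebesgue_measurable[OF omega_measurable[OF \<Omega>]])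
  have [measurable]: "w \<in> borel_measurable lebesgue" unfolding w_def using \<Omega> by measurable
  define F where "F n = (\<integral>\<^sup>+x. w x * indicator (- cball 0 (real n)) x \<partial>lebesgue)" for n
  have [measurable]: "- cball 0 (real n) \<in> sets (lebesgue :: 'a measure)" for n
    by (simp add: Compl_in_sets_lebesgue)
  have "F \<longlonglongrightarrow> (\<integral>\<^sup>+x. 0 \<partial>(lebesgue :: 'a measure))"
    unfolding F_def
  proof (rule nn_integral_dominated_convergence[where w = w])
    show "AE x in lebesgue. (\<lambda>n. w x * indicator (- cball 0 (real n)) x) \<longlonglongrightarrow> 0"
    proof (rule AE_I2)
      fix x :: 'a
      obtain N where "norm x \<le> real N" using real_arch_simple by blast
      then have "\<forall>\<^sub>F n in sequentially. w x * indicator (- cball 0 (real n)) x = 0"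
        by (intro eventually_sequentiallyI[of N]) (auto simp: indicator_def)
      then show "(\<lambda>n. w x * indicator (- cball 0 (real n)) x) \<longlonglongrightarrow> 0" by (rule tendsto_eventually)
    qed
    show "AE x in lebesgue. w x * indicator (- cball 0 (real n)) x \<le> w x" for n
      by (intro AE_I2) (auto simp: indicator_def)
  qed (use wint in auto)
  then have "F \<longlonglongrightarrow> 0" by simp
  moreover have "0 < ennreal (\<epsilon> powr r * \<epsilon>)" using e by simp
  ultimately have "\<forall>\<^sub>F n in sequentially. F n < ennreal (\<epsilon> powr r * \<epsilon>)" by (rule order_tendstoD(2))
  then obtain N where N: "\<And>n. n \<ge> N \<Longrightarrow> F n < ennreal (\<epsilon> powr r * \<epsilon>)" unfolding eventually_sequentially by blast
  \<comment> \<open>The successor keeps the radius positive.\<close>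
  define n where "n = Suc N"
  have Fn: "F n < ennreal (\<epsilon> powr r * \<epsilon>)" using N[of n] by (simp add: n_def)
  have "emeasure lebesgue (\<Omega> \<inter> cball y s - cball 0 (real n)) \<le> ennreal \<epsilon>" for y
  proof (rule ccontr)
    let ?A = "\<Omega> \<inter> cball y s - cball 0 (real n)"
    assume "\<not> emeasure lebesgue ?A \<le> ennreal \<epsilon>"
    then have gt: "ennreal \<epsilon> < emeasure lebesgue ?A" by simp
    have cb: "cball x t \<in> sets (lebesgue :: 'a measure)" for x t by simp
    have A: "?A \<in> sets lebesgue" by (rule sets.Diff[OF sets.Int[OF \<Omega> cb] cb])
    have fin: "\<Omega> \<inter> cball x (2 * s) \<in> lmeasurable" for x
      by (rule fmeasurableI2[of "cball x (2 * s)"]) (simp_all add: sets.Int[OF \<Omega> cb])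
    have om: "\<epsilon> \<le> omega (2 * s) \<Omega> x" if x: "x \<in> ?A" for x
    proof -
      have "?A \<subseteq> \<Omega> \<inter> cball x (2 * s)"
      proof
        fix z assume z: "z \<in> ?A"
        have "dist x z \<le> dist y x + dist y z" by (metis dist_commute dist_triangle)
        then show "z \<in> \<Omega> \<inter> cball x (2 * s)" using x z by auto
      qed
      then have "emeasure lebesgue ?A \<le> emeasure lebesgue (\<Omega> \<inter> cball x (2 * s))"
        by (rule emeasure_mono) (rule sets.Int[OF \<Omega> cb])
      also have "\<dots> = ennreal (omega (2 * s) \<Omega> x)"
        unfolding omega_def using fin by (intro emeasure_eq_measure2)
      finally have "ennreal \<epsilon> < ennreal (omega (2 * s) \<Omega> x)" using gt by (rule less_le_trans[rotated])
      then show ?thesis by (simp add: ennreal_less_iff e less_imp_le)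
    qed
    have "ennreal (\<epsilon> powr r * \<epsilon>) = ennreal (\<epsilon> powr r) * ennreal \<epsilon>" using e by (simp add: ennreal_mult)
    also have "\<dots> \<le> ennreal (\<epsilon> powr r) * emeasure lebesgue ?A" using gt by (intro mult_left_mono) auto
    also have "\<dots> = (\<integral>\<^sup>+x. ennreal (\<epsilon> powr r) * indicator ?A x \<partial>lebesgue)"
      by (rule nn_integral_cmult_indicator[symmetric, OF A])
    also have "\<dots> \<le> F n" unfolding F_def
    proof (rule nn_integral_mono)
      fix x
      have "ennreal (\<epsilon> powr r) \<le> ennreal (omega (2 * s) \<Omega> x powr r)" if "x \<in> ?A"
        using om[OF that] e r by (intro ennreal_leI powr_mono2) auto
      then show "ennreal (\<epsilon> powr r) * indicator ?A x \<le> w x * indicator (- cball 0 (real n)) x"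
        by (auto simp: w_def indicator_def)
    qed
    finally show False using Fn by simp
  qed
  moreover have "0 < real n" by (simp add: n_def)
  ultimately show thesis using that by blast
qed

section \<open>Compactness of the form domain in \<open>L\<^sup>2\<close>\<close>

context nonneg_potential
begin

text \<open>Where \<open>V \<ge> M\<close>, the mass is controlled by the potential energy. On the rest, which is
  \<open>S\<close> up to a null set, \<open>w\<close> is split into its ball mean and the remainder; the mean is small near
  the origin by hypothesis and small far out because \<open>S\<close> is thin there.\<close>

lemma form_dom_L2_estimate:
  assumes w: "w \<in> form_dom V" and M: "0 < M" and s: "0 < s" and e: "0 \<le> \<epsilon>"
    and S: "S \<in> sets borel" and VS: "AE x in lebesgue. x \<in> S \<or> M \<le> V x"
    and near: "\<And>x. x \<in> cball 0 R \<Longrightarrow> cmod (ball_avg s w x) \<le> \<eta>"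
    and far: "\<And>y. emeasure lborel ((S - cball 0 R) \<inter> cball y s) \<le> ennreal \<epsilon>"
    and B: "form1.nrm w \<le> B"
  shows "(norm_L2 w)\<^sup>2 \<le> B\<^sup>2 / M + 2 * (s * (real DIM('a) * B))\<^sup>2 + 2 * (measure lborel (cball (0::'a) R) * \<eta>\<^sup>2)
     + 2 * (\<epsilon> / measure lborel (cball (0::'a) s) * B\<^sup>2)"
proof -
  note D = form_domD[OF w]
  let ?A = "ball_avg s w"
  let ?K = "\<Sum>i\<in>Basis. norm_L2 (weak_partial i w)"
  let ?T = "S - cball 0 R"
  let ?c = "measure lborel (cball (0::'a) s)"
  let ?d = "\<lambda>x. w x - ?A x"
  let ?n = "\<lambda>x. ennreal (\<eta>\<^sup>2) * indicator (cball (0::'a) R) x" and ?m = "\<lambda>x. indicator ?T x * sqnorm (?A x)"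
  let ?v = "measure lborel (cball (0::'a) R) * \<eta>\<^sup>2" and ?E = "LINT x|lebesgue. V x * (cmod (w x))\<^sup>2"
  note E = H1_ball_avg_estimates[OF D(1) s]
  have B0: "0 \<le> B" using form1.nrm_nonneg[OF w] B by linarith
  have c: "0 < ?c" by (rule content_cball_pos[OF s])
  have [measurable]: "?A \<in> borel_measurable lebesgue" "w \<in> borel_measurable lebesgue" "?A \<in> borel_measurable borel"
    using borel_imp_lebesgue_measurable[OF E(1)] D E(1) by auto
  have T[measurable]: "?T \<in> sets borel" using S by simp
  have T'[measurable]: "?T \<in> sets lebesgue" using T by simp
  have C[measurable]: "cball 0 R \<in> sets (lebesgue :: 'a measure)" by simp
  have split: "(cmod (w x))\<^sup>2 \<le> 2 * (cmod (?d x))\<^sup>2 + 2 * (cmod (?A x))\<^sup>2" for x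
    using norm_add_square_le[of "?d x" "?A x"] by simp
  have pt: "AE x in lebesgue. sqnorm (w x) \<le>
      ennreal (1 / M) * ennreal (V x * (cmod (w x))\<^sup>2) + (2 * sqnorm (?d x)
      + (2 * (?n x) + 2 * (?m x)))"
    using V_nonneg VS
  proof eventually_elim
    fix x assume V: "0 \<le> V x" and or: "x \<in> S \<or> M \<le> V x"
    let ?rhs = "ennreal (1 / M) * ennreal (V x * (cmod (w x))\<^sup>2) + (2 * sqnorm (?d x)
      + (2 * (?n x) + 2 * (?m x)))"
    have two: "ennreal (2 * a) = 2 * ennreal a" if "0 \<le> a" for a
      using that by (simp add: ennreal_mult)
    \<comment> \<open>Where both alternatives hold, the potential term alone suffices, so the cases are split by the size of the potential.\<close>
    show "sqnorm (w x) \<le> ?rhs"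
    proof (cases "M \<le> V x")
      case True
      have "M * (cmod (w x))\<^sup>2 \<le> V x * (cmod (w x))\<^sup>2" by (rule mult_right_mono[OF True]) simp
      then have "(cmod (w x))\<^sup>2 \<le> 1 / M * (V x * (cmod (w x))\<^sup>2)" using M by (simp add: field_simps)
      then have "sqnorm (w x) \<le> ennreal (1 / M * (V x * (cmod (w x))\<^sup>2))" by (rule ennreal_leI)
      also have "\<dots> = ennreal (1 / M) * ennreal (V x * (cmod (w x))\<^sup>2)" using M V by (intro ennreal_mult) auto
      finally show ?thesis by (rule order_trans) simp
    next
      case False
      then have x: "x \<in> S" using or by simp
      have "sqnorm (w x) \<le> ennreal (2 * (cmod (?d x))\<^sup>2 + 2 * (cmod (?A x))\<^sup>2)"
        by (rule ennreal_leI[OF split])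
      also have "\<dots> = 2 * sqnorm (?d x) + 2 * sqnorm (?A x)"
        by (simp add: two)
      also have "2 * sqnorm (?A x) \<le> 2 * (?n x) + 2 * (?m x)"
      proof (cases "x \<in> cball 0 R")
        case True
        then have "sqnorm (?A x) \<le> ennreal (\<eta>\<^sup>2)" using near by (intro ennreal_leI power_mono) auto
        then show ?thesis using True by (simp add: mult_left_mono)
      next
        case False
        then show ?thesis using x by simp
      qed
      finally have "sqnorm (w x) \<le> 2 * sqnorm (?d x)
          + (2 * (?n x) + 2 * (?m x))"
        by (simp add: add_left_mono)
      then show ?thesis by (rule order_trans) simp
    qed
  qed
  have i1: "(\<integral>\<^sup>+x. ennreal (V x * (cmod (w x))\<^sup>2) \<partial>lebesgue) = ennreal ?E"
    by (rule nn_integral_eq_integral[OF D(3)]) (use V_nonneg in eventually_elim, simp)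
  have i2: "(\<integral>\<^sup>+x. sqnorm (?d x) \<partial>lebesgue) = ennreal ((norm_L2 ?d)\<^sup>2)"
    unfolding norm_L2_sq by (rule nn_integral_eq_integral[OF L2D(2)[OF E(2)]]) simp
  have i3: "(\<integral>\<^sup>+x. ?n x \<partial>lebesgue) = ennreal (?v)"
    by (subst nn_integral_cmult_indicator[OF C]) (simp add: emeasure_cball_content ennreal_mult mult.commute)
  have i4: "(\<integral>\<^sup>+x. ?m x \<partial>lebesgue) \<le> ennreal (\<epsilon> / ?c * (norm_L2 w)\<^sup>2)"
    unfolding nn_integral_completion by (rule E(5)[OF e T far])
  have "ennreal ((norm_L2 w)\<^sup>2) = (\<integral>\<^sup>+x. sqnorm (w x) \<partial>lebesgue)"
    unfolding norm_L2_sq by (rule nn_integral_eq_integral[OF L2D(2)[OF D(2)], symmetric]) simp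
  also have "\<dots> \<le> (\<integral>\<^sup>+x. ennreal (1 / M) * ennreal (V x * (cmod (w x))\<^sup>2) + (2 * sqnorm (?d x)
      + (2 * (?n x) + 2 * (?m x))) \<partial>lebesgue)"
    by (rule nn_integral_mono_AE[OF pt])
  also have "\<dots> = ennreal (1 / M) * (\<integral>\<^sup>+x. ennreal (V x * (cmod (w x))\<^sup>2) \<partial>lebesgue) + (2 * (\<integral>\<^sup>+x. sqnorm (?d x) \<partial>lebesgue)
      + (2 * (\<integral>\<^sup>+x. ?n x \<partial>lebesgue) + 2 * (\<integral>\<^sup>+x. ?m x \<partial>lebesgue)))"
    by (simp add: nn_integral_add nn_integral_cmult)
  also have "\<dots> \<le> ennreal (1 / M) * ennreal ?E + (2 * ennreal ((norm_L2 ?d)\<^sup>2)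
      + (2 * ennreal (?v) + 2 * ennreal (\<epsilon> / ?c * (norm_L2 w)\<^sup>2)))"
    unfolding i1 i2 i3 by (intro add_mono mult_left_mono order_refl i4) simp
  also have "\<dots> = ennreal (1 / M * ?E + (2 * (norm_L2 ?d)\<^sup>2
      + (2 * (?v) + 2 * (\<epsilon> / ?c * (norm_L2 w)\<^sup>2))))"
  proof -
    have two: "2 * ennreal a = ennreal (2 * a)" if "0 \<le> a" for a using that by (simp add: ennreal_mult)
    have nn: "0 \<le> 1 / M" "0 \<le> ?E" "0 \<le> ?v"
      "0 \<le> \<epsilon> / ?c * (norm_L2 w)\<^sup>2" "0 \<le> (norm_L2 ?d)\<^sup>2"
      using M e c potential_nonneg[of w] by simp_all
    show ?thesis using nn by (simp only: two ennreal_mult[symmetric] ennreal_plus[symmetric] add_nonneg_nonneg mult_nonneg_nonneg zero_le_numeral)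
  qed
  finally have le: "(norm_L2 w)\<^sup>2 \<le> 1 / M * ?E + (2 * (norm_L2 ?d)\<^sup>2
      + (2 * (?v) + 2 * (\<epsilon> / ?c * (norm_L2 w)\<^sup>2)))"
    using M e c potential_nonneg[of w] by (subst (asm) ennreal_le_iff) (auto intro!: add_nonneg_nonneg)
  have BB: "(form1.nrm w)\<^sup>2 \<le> B\<^sup>2" by (rule power_mono[OF B form1.nrm_nonneg[OF w]])
  have "1 / M * ?E \<le> 1 / M * B\<^sup>2"
    using form1_nrm_bounds(3)[OF w] BB M by (intro mult_left_mono) auto
  moreover have "(norm_L2 ?d)\<^sup>2 \<le> (s * (real DIM('a) * B))\<^sup>2"
  proof (rule power_mono[OF _ norm_L2_nonneg])
    have "?K \<le> (\<Sum>i\<in>(Basis::'a set). B)"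
      using form1_nrm_bounds(2)[OF w] B by (intro sum_mono) (meson order_trans)
    then have "s * ?K \<le> s * (real DIM('a) * B)" using s by simp
    with E(3) show "norm_L2 ?d \<le> s * (real DIM('a) * B)" by linarith
  qed
  moreover have "\<epsilon> / ?c * (norm_L2 w)\<^sup>2 \<le> \<epsilon> / ?c * B\<^sup>2"
    using form1_nrm_bounds(1)[OF w] B e c by (intro mult_left_mono power_mono norm_L2_nonneg) auto
  ultimately show ?thesis using le by simp
qed

text \<open>For a sequence of bounded energy, the parameters \<open>M\<close>, \<open>s\<close> and \<open>R\<close> of the
  preceding estimate are fixed in this order. The ball means of radius \<open>s\<close> are then uniformly
  bounded and uniformly Lipschitz, so by Arzela--Ascoli a subsequence of them converges uniformly on the
  ball of radius \<open>R\<close>, which makes the means of the differences small there.\<close>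

lemma eps_close_subsequence:
  fixes f :: "nat \<Rightarrow> 'a \<Rightarrow> complex"
  assumes thin: "\<And>M. M > 0 \<Longrightarrow> \<exists>r>0. polynomially_thin r {x. 0 \<le> V x \<and> V x < M}"
    and f: "\<And>n. f n \<in> form_dom V" and Bf: "\<And>n. form1.nrm (f n) \<le> B" and e: "0 < e"
  obtains r where "strict_mono (r :: nat \<Rightarrow> nat)" "\<And>m n. norm_L2 (\<lambda>x. f (r m) x - f (r n) x) < e"
proof -
  \<comment> \<open>A bound for the form norm of differences, kept positive so that it may be divided by. The constants below make each of the four error terms at most \<open>e\<^sup>2 / 8\<close>.\<close>
  define b where "b = 2 * B + 1"
  have b: "0 < b" using form1.nrm_nonneg[OF f, of 0] Bf[of 0] by (simp add: b_def)
  define M where "M = 8 * b\<^sup>2 / e\<^sup>2"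
  have M: "0 < M" using b e by (simp add: M_def)
  define s where "s = e / (4 * (real DIM('a) * b))"
  have s: "0 < s" using b e by (simp add: s_def)
  define c where "c = measure lborel (cball (0::'a) s)"
  have c: "0 < c" unfolding c_def by (rule content_cball_pos[OF s])
  define \<epsilon> where "\<epsilon> = c * e\<^sup>2 / (16 * b\<^sup>2)"
  have \<epsilon>: "0 < \<epsilon>" using b e c by (simp add: \<epsilon>_def)
  let ?\<Omega> = "{x. 0 \<le> V x \<and> V x < M}"
  obtain p where p: "0 < p" "polynomially_thin p ?\<Omega>" using thin[OF M] by blast
  obtain R where R: "0 < R" and far: "\<And>y. emeasure lebesgue (?\<Omega> \<inter> cball y s - cball 0 R) \<le> ennreal \<epsilon>"
    using polynomially_thin_tail[OF p(2,1) s \<epsilon>] by blast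
  have \<Omega>: "?\<Omega> \<in> sets lebesgue" using p(2) by (simp add: polynomially_thin_def)
  obtain S where S: "S \<in> sets borel" "S \<subseteq> ?\<Omega>" and ae: "AE x in lebesgue. x \<in> ?\<Omega> \<longrightarrow> x \<in> S"
    using lebesgue_set_borel_core[OF \<Omega>] by blast
  have VS: "AE x in lebesgue. x \<in> S \<or> M \<le> V x"
    using ae V_nonneg by eventually_elim auto
  have farS: "emeasure lborel ((S - cball 0 R) \<inter> cball y s) \<le> ennreal \<epsilon>" for y
  proof -
    have "emeasure lborel ((S - cball 0 R) \<inter> cball y s) = emeasure lebesgue ((S - cball 0 R) \<inter> cball y s)"
      using S(1) by simp
    also have "\<dots> \<le> emeasure lebesgue (?\<Omega> \<inter> cball y s - cball 0 R)"
    proof (rule emeasure_mono)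
      show "(S - cball 0 R) \<inter> cball y s \<subseteq> ?\<Omega> \<inter> cball y s - cball 0 R" using S(2) by blast
      have cb: "cball x t \<in> sets (lebesgue :: 'a measure)" for x t by simp
      show "?\<Omega> \<inter> cball y s - cball 0 R \<in> sets lebesgue" by (rule sets.Diff[OF sets.Int[OF \<Omega> cb] cb])
    qed
    finally show ?thesis using far[of y] by (rule order_trans)
  qed
  define v where "v = measure lborel (cball (0::'a) R)"
  have v: "0 < v" unfolding v_def by (rule content_cball_pos[OF R])
  define \<eta> where "\<eta> = e / (4 * sqrt v)"
  have \<eta>: "0 < \<eta>" using e v by (simp add: \<eta>_def)
  let ?K = "real DIM('a) * B"
  have Kn: "(\<Sum>i\<in>Basis. norm_L2 (weak_partial i (f n))) \<le> ?K" for n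
  proof -
    have "(\<Sum>i\<in>Basis. norm_L2 (weak_partial i (f n))) \<le> (\<Sum>i\<in>(Basis::'a set). B)"
      using form1_nrm_bounds(2)[OF f] Bf by (intro sum_mono) (meson order_trans)
    then show ?thesis by simp
  qed
  have lip: "cmod (ball_avg s (f n) x - ball_avg s (f n) y) \<le> dist x y * ?K / sqrt c" for n x y
  proof -
    have "cmod (ball_avg s (f n) x - ball_avg s (f n) y) \<le> dist x y * (\<Sum>i\<in>Basis. norm_L2 (weak_partial i (f n))) / sqrt c"
      unfolding c_def by (rule H1_ball_avg_estimates(4)[OF form_domD(1)[OF f] s])
    also have "\<dots> \<le> dist x y * ?K / sqrt c"
      using Kn[of n] c by (intro divide_right_mono mult_left_mono) auto
    finally show ?thesis .
  qed
  have bd: "cmod (ball_avg s (f n) x) \<le> B / sqrt c" for n x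
  proof -
    have "cmod (ball_avg s (f n) x) \<le> norm_L2 (f n) / sqrt c"
      unfolding c_def by (rule ball_avg_le[OF form_domD(2)[OF f] s])
    also have "\<dots> \<le> B / sqrt c"
      using form1_nrm_bounds(1)[OF f, of n] Bf[of n] c by (intro divide_right_mono) auto
    finally show ?thesis .
  qed
  \<comment> \<open>A positive Lipschitz constant for all the means.\<close>
  define L where "L = \<bar>?K\<bar> / sqrt c + 1"
  have L: "0 < L" using c by (simp add: L_def add_nonneg_pos)
  obtain g k where "continuous_on (cball (0::'a) R) g" and k: "strict_mono (k :: nat \<Rightarrow> nat)"
    and conv: "\<And>\<delta>. 0 < \<delta> \<Longrightarrow> \<exists>N. \<forall>n x. n \<ge> N \<and> x \<in> cball 0 R \<longrightarrow> norm (ball_avg s (f (k n)) x - g x) < \<delta>"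
  proof (rule Arzela_Ascoli[of "cball (0::'a) R" "\<lambda>n. ball_avg s (f n)" "B / sqrt c"])
    fix x :: 'a and \<delta> :: real assume \<delta>: "0 < \<delta>"
    have "norm (ball_avg s (f n) x - ball_avg s (f n) y) < \<delta>" if "norm (x - y) < \<delta> / L" for n y
    proof -
      have "dist x y * ?K / sqrt c \<le> dist x y * (\<bar>?K\<bar> / sqrt c)"
        using c by (simp add: divide_right_mono mult_left_mono)
      also have "\<dots> \<le> dist x y * L" by (intro mult_left_mono) (simp_all add: L_def)
      also have "\<dots> < \<delta>" using that L by (simp add: dist_norm field_simps)
      finally show ?thesis using lip[of n x y] by linarith
    qed
    then show "\<exists>d>0. \<forall>n y. y \<in> cball 0 R \<and> norm (x - y) < d \<longrightarrow> norm (ball_avg s (f n) x - ball_avg s (f n) y) < \<delta>"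
      using \<delta> L by (intro exI[of _ "\<delta> / L"]) auto
  qed (use bd in auto)
  obtain N where N: "\<And>n x. n \<ge> N \<Longrightarrow> x \<in> cball 0 R \<Longrightarrow> norm (ball_avg s (f (k n)) x - g x) < \<eta> / 2"
    using conv[of "\<eta> / 2"] \<eta> by auto
  define r where "r n = k (n + N)" for n
  have r: "strict_mono r" using k by (auto simp: r_def strict_mono_def)
  have "norm_L2 (\<lambda>x. f (r m) x - f (r n) x) < e" for m n
  proof -
    let ?w = "\<lambda>x. f (r m) x - f (r n) x"
    have w: "?w \<in> form_dom V" by (rule form1.diff_mem[OF f f])
    have near: "cmod (ball_avg s ?w x) \<le> \<eta>" if x: "x \<in> cball 0 R" for x
    proof -
      have "ball_avg s ?w x = (ball_avg s (f (r m)) x - g x) - (ball_avg s (f (r n)) x - g x)"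
        by (simp add: ball_avg_diff[OF form_domD(2)[OF f] form_domD(2)[OF f]])
      also have "cmod \<dots> \<le> cmod (ball_avg s (f (r m)) x - g x) + cmod (ball_avg s (f (r n)) x - g x)"
        by (rule norm_triangle_ineq4)
      also have "\<dots> \<le> \<eta>" using N[OF _ x, of "m + N"] N[OF _ x, of "n + N"] by (simp add: r_def)
      finally show ?thesis .
    qed
    have wb: "form1.nrm ?w \<le> b"
      using form1.triangle_minus[OF f f, of "r m" "r n"] Bf[of "r m"] Bf[of "r n"] by (simp add: b_def)
    have "(norm_L2 ?w)\<^sup>2 \<le> b\<^sup>2 / M + 2 * (s * (real DIM('a) * b))\<^sup>2 + 2 * (v * \<eta>\<^sup>2) + 2 * (\<epsilon> / c * b\<^sup>2)"
      unfolding v_def c_def by (rule form_dom_L2_estimate[OF w M s less_imp_le[OF \<epsilon>] S(1) VS near farS wb])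
    also have "b\<^sup>2 / M = e\<^sup>2 / 8" using b e by (simp add: M_def)
    also have "s * (real DIM('a) * b) = e / 4" using b by (simp add: s_def)
    also have "v * \<eta>\<^sup>2 = e\<^sup>2 / 16" using v by (simp add: \<eta>_def power_divide power_mult_distrib)
    also have "\<epsilon> / c * b\<^sup>2 = e\<^sup>2 / 16" using b c by (simp add: \<epsilon>_def)
    also have "e\<^sup>2 / 8 + 2 * (e / 4)\<^sup>2 + 2 * (e\<^sup>2 / 16) + 2 * (e\<^sup>2 / 16) = e\<^sup>2 / 2" by (simp add: power_divide)
    also have "\<dots> < e\<^sup>2" using e by simp
    finally show ?thesis by (rule power2_less_imp_less) (use e in simp)
  qed
  with r show thesis by (rule that)
qed

text \<open>A diagonal argument over \<open>\<epsilon> = 1 / (n + 1)\<close>.\<close>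

lemma compact_embedding_if_thin:
  fixes f :: "nat \<Rightarrow> 'a \<Rightarrow> complex"
  assumes thin: "\<And>M. M > 0 \<Longrightarrow> \<exists>r>0. polynomially_thin r {x. 0 \<le> V x \<and> V x < M}"
    and f: "\<And>n. f n \<in> form_dom V" and Bf: "\<And>n. form1.nrm (f n) \<le> B"
  obtains r where "strict_mono (r :: nat \<Rightarrow> nat)" "L2.cauchy (\<lambda>n. f (r n))"
proof -
  define P where "P n s = (\<forall>j k. norm_L2 (\<lambda>x. f (s j) x - f (s k) x) < 1 / real (Suc n))" for n and s :: "nat \<Rightarrow> nat"
  interpret subseqs P
  proof
    fix n :: nat and s :: "nat \<Rightarrow> nat" assume "strict_mono s"
    obtain r where "strict_mono (r :: nat \<Rightarrow> nat)" "\<And>m k. norm_L2 (\<lambda>x. f (s (r m)) x - f (s (r k)) x) < 1 / real (Suc n)"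
      using eps_close_subsequence[of "\<lambda>n. f (s n)" B "1 / real (Suc n)", OF thin f Bf] by auto
    then show "\<exists>r'. strict_mono r' \<and> P n (s \<circ> r')" by (auto simp: P_def)
  qed
  have hold: "P n (diagseq \<circ> ((+) (Suc n)))" for n
    by (rule diagseq_holds) (simp add: P_def)
  have "L2.cauchy (\<lambda>n. f (diagseq n))"
    unfolding L2.cauchy_def
  proof (intro conjI allI impI form_domD f)
    fix e :: real assume e: "e > 0"
    from reals_Archimedean[OF e] obtain n where n: "inverse (real (Suc n)) < e" ..
    have "norm_L2 (\<lambda>x. f (diagseq i) x - f (diagseq j) x) < e" if "i \<ge> Suc n" "j \<ge> Suc n" for i j
    proof -
      from le_Suc_ex[OF that(1)] obtain i' where "i = Suc n + i'" ..
      moreover from le_Suc_ex[OF that(2)] obtain j' where "j = Suc n + j'" ..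
      ultimately have "norm_L2 (\<lambda>x. f (diagseq i) x - f (diagseq j) x) < 1 / real (Suc n)"
        using hold[of n] by (simp add: P_def del: of_nat_Suc)
      then show ?thesis using n by (simp add: inverse_eq_divide)
    qed
    then show "\<exists>N. \<forall>i\<ge>N. \<forall>j\<ge>N. norm_L2 (\<lambda>x. f (diagseq i) x - f (diagseq j) x) < e" by blast
  qed
  with subseq_diagseq show thesis by (rule that)
qed

end

section \<open>The spectrum of the operator\<close>

text \<open>From here on, the thinness of the sublevel sets enters only through the compactness of the embedding
  of the form domain into \<open>L\<^sup>2\<close>.\<close>

locale compact_form = nonneg_potential V for V :: "'a::euclidean_space \<Rightarrow> real" +
  assumes compact_embedding: "\<And>f B. (\<And>n. f n \<in> form_dom V) \<Longrightarrow> (\<And>n. form1.nrm (f n) \<le> B) \<Longrightarrow>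
    \<exists>r::nat \<Rightarrow> nat. strict_mono r \<and> L2.cauchy (\<lambda>n. f (r n))"
begin

abbreviation H :: "(('a \<Rightarrow> complex) \<times> ('a \<Rightarrow> complex)) set" where
  "H \<equiv> schroedinger_operator V"

lemma operatorD:
  assumes "(u, f) \<in> H"
  shows "u \<in> form_dom V" "u \<in> L2" "f \<in> L2" "v \<in> form_dom V \<Longrightarrow> schroedinger_form V v u = inner_L2 v f"
  using assms form_domD(2) by (auto simp: schroedinger_operator_def)

lemma operatorI:
  assumes "u \<in> form_dom V" "f \<in> L2" "\<And>v. v \<in> form_dom V \<Longrightarrow> schroedinger_form V v u = inner_L2 v f"
  shows "(u, f) \<in> H"
  using assms by (simp add: schroedinger_operator_def)

lemma operator_lincomb:
  assumes "(u, f) \<in> H" "(v, g) \<in> H"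
  shows "(\<lambda>x. u x + c * v x, \<lambda>x. f x + c * g x) \<in> H"
proof (rule operatorI)
  note U = operatorD[OF assms(1)] and W = operatorD[OF assms(2)]
  show "(\<lambda>x. u x + c * v x) \<in> form_dom V" by (rule form.lincomb_mem[OF U(1) W(1)])
  show "(\<lambda>x. f x + c * g x) \<in> L2" by (rule L2.lincomb_mem[OF U(3) W(3)])
  fix w assume w: "w \<in> form_dom V"
  show "schroedinger_form V w (\<lambda>x. u x + c * v x) = inner_L2 w (\<lambda>x. f x + c * g x)"
    unfolding form.lin[OF w U(1) W(1)] L2.lin[OF form_domD(2)[OF w] U(3) W(3)]
    by (simp add: U(4)[OF w] W(4)[OF w])
qed

lemma operator_zero: "(\<lambda>_. 0, \<lambda>_. 0) \<in> H"
  by (rule operatorI) (simp_all add: form.zero_mem L2.zero_mem form.lin_zero L2.lin_zero form_domD)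

lemma operator_scale:
  assumes "(v, g) \<in> H" shows "(\<lambda>x. c * v x, \<lambda>x. c * g x) \<in> H"
  using operator_lincomb[OF operator_zero assms, of c] by simp

lemma operator_diff:
  assumes "(u, f) \<in> H" "(v, g) \<in> H"
  shows "(\<lambda>x. u x - v x, \<lambda>x. f x - g x) \<in> H"
  using operator_lincomb[OF assms, of "-1"] by simp

lemma operator_cong_AE:
  assumes "(u, f) \<in> H" "g \<in> L2" "AE x in lebesgue. f x = g x"
  shows "(u, g) \<in> H"
proof (rule operatorI[OF operatorD(1)[OF assms(1)] assms(2)])
  fix v assume v: "v \<in> form_dom V"
  have "inner_L2 v f = inner_L2 v g"
    by (rule inner_L2_cong_AE[OF form_domD(2)[OF v] operatorD(3)[OF assms(1)] form_domD(2)[OF v] assms(2) AE_I2[OF refl] assms(3)])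
  then show "schroedinger_form V v u = inner_L2 v g" using operatorD(4)[OF assms(1) v] by simp
qed

lemma form1_nrm_le_operator:
  assumes "(u, f) \<in> H"
  shows "(form1.nrm u)\<^sup>2 \<le> norm_L2 u * (norm_L2 f + norm_L2 u)"
proof -
  note U = operatorD[OF assms]
  have "(form1.nrm u)\<^sup>2 = Re (inner_L2 u f) + (norm_L2 u)\<^sup>2"
    unfolding form1.nrm_sq[OF U(1)] form1_def L2.nrm_sq[OF U(2)] by (simp add: U(4)[OF U(1)])
  also have "Re (inner_L2 u f) \<le> norm_L2 u * norm_L2 f"
    using L2.cauchy_schwarz[OF U(2,3)] complex_Re_le_cmod[of "inner_L2 u f"] by linarith
  finally show ?thesis by (simp add: algebra_simps power2_eq_square)
qed

text \<open>The source of all compactness statements about \<open>H\<close>. Boundedness of \<open>u n\<close> and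
  \<open>f n\<close> bounds the energy of \<open>u n\<close>, so a subsequence converges in \<open>L\<^sup>2\<close>. The energy of a
  difference is \<open>Re \<langle>u m - u n, f m - f n\<rangle>\<close>, so the subsequence is even Cauchy in the form
  norm and its limit lies in the form domain; the defining identity of \<open>H\<close> passes to the limit.\<close>

lemma operator_limit:
  assumes uf: "\<And>n. (u n, f n) \<in> H" and ub: "\<And>n. norm_L2 (u n) \<le> a" and fb: "\<And>n. norm_L2 (f n) \<le> b"
    and h: "h \<in> L2" and lim: "(\<lambda>n. norm_L2 (\<lambda>x. f n x - z * u n x - h x)) \<longlonglongrightarrow> 0"
  obtains r v where "strict_mono (r :: nat \<Rightarrow> nat)" "(v, \<lambda>x. h x + z * v x) \<in> H" "v \<in> L2"
    "(\<lambda>n. norm_L2 (\<lambda>x. u (r n) x - v x)) \<longlonglongrightarrow> 0"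
proof -
  note U = operatorD[OF uf]
  have a: "0 \<le> a" using norm_L2_nonneg[of "u 0"] ub[of 0] by linarith
  have b: "0 \<le> b" using norm_L2_nonneg[of "f 0"] fb[of 0] by linarith
  have "form1.nrm (u n) \<le> sqrt (a * (b + a))" for n
  proof (rule real_le_rsqrt)
    have "(form1.nrm (u n))\<^sup>2 \<le> norm_L2 (u n) * (norm_L2 (f n) + norm_L2 (u n))" by (rule form1_nrm_le_operator[OF uf])
    also have "\<dots> \<le> a * (b + a)" using ub[of n] fb[of n] a b by (intro mult_mono add_mono) (auto simp: norm_L2_nonneg add_nonneg_nonneg)
    finally show "(form1.nrm (u n))\<^sup>2 \<le> a * (b + a)" .
  qed
  from compact_embedding[where f = u, OF U(1) this] obtain r :: "nat \<Rightarrow> nat" where r: "strict_mono r" and C: "L2.cauchy (\<lambda>n. u (r n))"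
    by (elim exE conjE) (rule that)
  have "form1.cauchy (\<lambda>n. u (r n))" unfolding form1.cauchy_def
  proof (intro conjI allI impI U)
    fix e :: real assume e: "0 < e"
    \<comment> \<open>Bounds the second factor in \<open>form1_nrm_le_operator\<close> for differences, and is positive.\<close>
    define k where "k = 2 * b + 2 * a + 1"
    have k: "0 < k" using a b by (simp add: k_def)
    have "0 < e\<^sup>2 / k" using e k by simp
    with C have "\<exists>N. \<forall>m\<ge>N. \<forall>n\<ge>N. norm_L2 (\<lambda>x. u (r m) x - u (r n) x) < e\<^sup>2 / k"
      by (simp only: L2.cauchy_def)
    then obtain N where N: "\<forall>m\<ge>N. \<forall>n\<ge>N. norm_L2 (\<lambda>x. u (r m) x - u (r n) x) < e\<^sup>2 / k" ..
    have "form1.nrm (\<lambda>x. u (r m) x - u (r n) x) < e" if mn: "m \<ge> N" "n \<ge> N" for m n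
    proof (rule power2_less_imp_less)
      let ?d = "\<lambda>x. u (r m) x - u (r n) x" and ?g = "\<lambda>x. f (r m) x - f (r n) x"
      have "norm_L2 ?g \<le> 2 * b" using L2.triangle_minus[OF U(3) U(3), of "r m" "r n"] fb[of "r m"] fb[of "r n"] by linarith
      moreover have "norm_L2 ?d \<le> 2 * a" using L2.triangle_minus[OF U(2) U(2), of "r m" "r n"] ub[of "r m"] ub[of "r n"] by linarith
      ultimately have "norm_L2 ?d * (norm_L2 ?g + norm_L2 ?d) \<le> norm_L2 ?d * k"
        by (intro mult_left_mono) (simp_all add: k_def norm_L2_nonneg)
      also have "\<dots> < e\<^sup>2" using N mn k by (simp add: pos_less_divide_eq)
      finally show "(form1.nrm ?d)\<^sup>2 < e\<^sup>2" using form1_nrm_le_operator[OF operator_diff[OF uf uf], of "r m" "r n"] by linarith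
    qed (use e in simp)
    then show "\<exists>N. \<forall>m\<ge>N. \<forall>n\<ge>N. form1.nrm (\<lambda>x. u (r m) x - u (r n) x) < e" by blast
  qed
  with form_complete have "\<exists>v\<in>form_dom V. (\<lambda>n. form1.nrm (\<lambda>x. u (r n) x - v x)) \<longlonglongrightarrow> 0"
    by (simp only: form1.complete_def)
  then obtain v where v: "v \<in> form_dom V" and vlim: "(\<lambda>n. form1.nrm (\<lambda>x. u (r n) x - v x)) \<longlonglongrightarrow> 0" ..
  have vL: "v \<in> L2" by (rule form_domD(2)[OF v])
  have lim2: "(\<lambda>n. norm_L2 (\<lambda>x. u (r n) x - v x)) \<longlonglongrightarrow> 0"
    by (rule tendsto_sandwich[OF always_eventually always_eventually tendsto_const vlim])
      (simp_all add: norm_L2_nonneg form1_nrm_bounds(1)[OF form1.diff_mem[OF U(1) v]])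
  have zv: "(\<lambda>x. h x + z * v x) \<in> L2" by (rule L2.lincomb_mem[OF h vL])
  have flim: "(\<lambda>n. norm_L2 (\<lambda>x. f (r n) x - (h x + z * v x))) \<longlonglongrightarrow> 0"
  proof (rule tendsto_sandwich[OF always_eventually always_eventually tendsto_const])
    show "\<forall>n. 0 \<le> norm_L2 (\<lambda>x. f (r n) x - (h x + z * v x))" by (simp add: norm_L2_nonneg)
    show "\<forall>n. norm_L2 (\<lambda>x. f (r n) x - (h x + z * v x))
        \<le> norm_L2 (\<lambda>x. f (r n) x - z * u (r n) x - h x) + cmod z * norm_L2 (\<lambda>x. u (r n) x - v x)"
    proof
      fix n
      have "(\<lambda>x. f (r n) x - (h x + z * v x)) = (\<lambda>x. (f (r n) x - z * u (r n) x - h x) + z * (u (r n) x - v x))"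
        by (simp add: algebra_simps)
      then show "norm_L2 (\<lambda>x. f (r n) x - (h x + z * v x))
        \<le> norm_L2 (\<lambda>x. f (r n) x - z * u (r n) x - h x) + cmod z * norm_L2 (\<lambda>x. u (r n) x - v x)"
        using L2.triangle[OF L2.diff_mem[OF L2.diff_mem[OF U(3) L2.scale_mem[OF U(2)]] h] L2.scale_mem[OF L2.diff_mem[OF U(2) vL]], of "r n" z "r n" z "r n"]
          L2.nrm_scale[OF L2.diff_mem[OF U(2) vL], of z "r n"] by simp
    qed
    have "(\<lambda>n. norm_L2 (\<lambda>x. f (r n) x - z * u (r n) x - h x)) \<longlonglongrightarrow> 0"
      using LIMSEQ_subseq_LIMSEQ[OF lim r] by (simp add: o_def)
    from tendsto_add[OF this tendsto_mult_right_zero[OF lim2, of "cmod z"]]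
    show "(\<lambda>n. norm_L2 (\<lambda>x. f (r n) x - z * u (r n) x - h x) + cmod z * norm_L2 (\<lambda>x. u (r n) x - v x)) \<longlonglongrightarrow> 0" by simp
  qed
  have "(v, \<lambda>x. h x + z * v x) \<in> H"
  proof (rule operatorI[OF v zv])
    fix w assume w: "w \<in> form_dom V"
    note wL = form_domD(2)[OF w]
    have "(\<lambda>n. form1 w (u (r n)) - inner_L2 w (u (r n))) \<longlonglongrightarrow> form1 w v - inner_L2 w v"
      by (rule tendsto_diff[OF form1.B_tendsto[OF U(1) v w vlim] L2.B_tendsto[OF U(2) vL wL lim2]])
    moreover have "form1 w (u (r n)) - inner_L2 w (u (r n)) = inner_L2 w (f (r n))" for n
      using U(4)[OF w, of "r n"] by (simp add: form1_def)
    ultimately have "(\<lambda>n. inner_L2 w (f (r n))) \<longlonglongrightarrow> schroedinger_form V w v" by (simp add: form1_def)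
    moreover have "(\<lambda>n. inner_L2 w (f (r n))) \<longlonglongrightarrow> inner_L2 w (\<lambda>x. h x + z * v x)"
      by (rule L2.B_tendsto[OF U(3) zv wL flim])
    ultimately show "schroedinger_form V w v = inner_L2 w (\<lambda>x. h x + z * v x)" by (rule LIMSEQ_unique)
  qed
  with r show thesis using vL lim2 by (rule that)
qed

text \<open>The Riesz representation in the form domain, applied to \<open>v \<mapsto> \<langle>g, v\<rangle>\<close>.\<close>

lemma operator_plus_one_surjective:
  assumes g: "g \<in> L2"
  obtains u where "(u, \<lambda>x. g x - u x) \<in> H"
proof -
  have "\<exists>u\<in>form_dom V. \<forall>v\<in>form_dom V. form1 u v = inner_L2 g v"
  proof (rule form1.riesz_representation[OF form_complete])
    show "inner_L2 g (\<lambda>x. u x + c * v x) = inner_L2 g u + c * inner_L2 g v"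
      if "u \<in> form_dom V" "v \<in> form_dom V" for u v c
      by (rule L2.lin[OF g form_domD(2)[OF that(1)] form_domD(2)[OF that(2)]])
    show "cmod (inner_L2 g v) \<le> norm_L2 g * form1.nrm v" if v: "v \<in> form_dom V" for v
      using L2.cauchy_schwarz[OF g form_domD(2)[OF v]] mult_left_mono[OF form1_nrm_bounds(1)[OF v] norm_L2_nonneg[of g]]
      by linarith
  qed
  then obtain u where u: "u \<in> form_dom V" and eq: "\<And>v. v \<in> form_dom V \<Longrightarrow> form1 u v = inner_L2 g v" by blast
  have uL: "u \<in> L2" by (rule form_domD(2)[OF u])
  have "(u, \<lambda>x. g x - u x) \<in> H"
  proof (rule operatorI[OF u L2.diff_mem[OF g uL]])
    fix v assume v: "v \<in> form_dom V"
    note vL = form_domD(2)[OF v]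
    have "form1 v u = inner_L2 v g"
      using form1.herm[OF v u] eq[OF v] L2.herm[OF vL g] by simp
    then show "schroedinger_form V v u = inner_L2 v (\<lambda>x. g x - u x)"
      unfolding L2.lin_diff[OF vL g uL] by (simp add: form1_def algebra_simps)
  qed
  then show thesis by (rule that)
qed

lemma eigenspace_iff: "u \<in> eigenspace H z \<longleftrightarrow> (u, \<lambda>x. z * u x) \<in> H"
proof
  assume "u \<in> eigenspace H z"
  then obtain f where f: "(u, f) \<in> H" "AE x in lebesgue. f x = z * u x" by (auto simp: eigenspace_def)
  then show "(u, \<lambda>x. z * u x) \<in> H" by (intro operator_cong_AE[OF f(1)] L2.scale_mem operatorD(2)[OF f(1)])
next
  assume "(u, \<lambda>x. z * u x) \<in> H"
  then show "u \<in> eigenspace H z" by (auto simp: eigenspace_def)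
qed

lemma is_eigenvalue_iff: "is_eigenvalue H z \<longleftrightarrow> (\<exists>u. (u, \<lambda>x. z * u x) \<in> H \<and> norm_L2 u \<noteq> 0)"
  unfolding is_eigenvalue_def Bex_def eigenspace_iff using norm_L2_eq_0_iff operatorD(2) by blast

lemma eigenvalue_normalized:
  assumes "is_eigenvalue H z"
  obtains u where "(u, \<lambda>x. z * u x) \<in> H" "norm_L2 u = 1"
proof -
  obtain u where u: "(u, \<lambda>x. z * u x) \<in> H" and n: "norm_L2 u \<noteq> 0" using assms is_eigenvalue_iff by blast
  let ?c = "complex_of_real (1 / norm_L2 u)"
  have "(\<lambda>x. ?c * u x, \<lambda>x. z * (?c * u x)) \<in> H"
    using operator_scale[OF u, of ?c] by (simp add: mult.left_commute)
  moreover have "norm_L2 (\<lambda>x. ?c * u x) = 1"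
    using L2.nrm_scale[OF operatorD(2)[OF u], of ?c] n norm_L2_nonneg[of u] by (simp add: norm_divide)
  ultimately show thesis by (rule that)
qed

lemma eigenvalue_real:
  assumes "is_eigenvalue H z" shows "cnj z = z"
proof -
  obtain u where u: "(u, \<lambda>x. z * u x) \<in> H" and n: "norm_L2 u = 1" using eigenvalue_normalized[OF assms] by blast
  note U = operatorD[OF u]
  have "schroedinger_form V u u = z * inner_L2 u u" unfolding U(4)[OF U(1)] by (rule L2.lin_scale[OF U(2,2)])
  moreover have "inner_L2 u u = 1" using n norm_L2_sq[of u] by (simp add: inner_L2_self)
  ultimately show ?thesis using form.herm[OF U(1,1)] by simp
qed

text \<open>Symmetry of the form gives \<open>z \<langle>v, u\<rangle> = y \<langle>v, u\<rangle>\<close>.\<close>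

lemma eigenvectors_orthogonal:
  assumes "(u, \<lambda>x. z * u x) \<in> H" "(v, \<lambda>x. y * v x) \<in> H" "cnj y = y" "z \<noteq> y"
  shows "inner_L2 v u = 0"
proof -
  note U = operatorD[OF assms(1)] and W = operatorD[OF assms(2)]
  have "z * inner_L2 v u = schroedinger_form V v u" unfolding U(4)[OF W(1)] by (rule L2.lin_scale[OF W(2) U(2), symmetric])
  also have "\<dots> = cnj (schroedinger_form V u v)" by (rule form.herm[OF W(1) U(1)])
  also have "\<dots> = cnj (y * inner_L2 u v)" unfolding W(4)[OF U(1)] by (simp only: L2.lin_scale[OF U(2) W(2)])
  also have "\<dots> = y * inner_L2 v u" using L2.herm[OF W(2) U(2)] assms(3) by simp
  finally show ?thesis using assms(4) by simp
qed

lemma norm_L2_limit: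
  assumes "\<And>n. u n \<in> L2" "v \<in> L2" "(\<lambda>n. norm_L2 (\<lambda>x. u n x - v x)) \<longlonglongrightarrow> 0" "\<And>n. norm_L2 (u n) = 1"
  shows "norm_L2 v = 1"
proof -
  have "(\<lambda>n. norm_L2 (u n)) \<longlonglongrightarrow> norm_L2 v"
  proof (rule LIM_zero_cancel, rule Lim_null_comparison[OF always_eventually assms(3)], rule allI)
    fix n
    show "norm (norm_L2 (u n) - norm_L2 v) \<le> norm_L2 (\<lambda>x. u n x - v x)"
      using L2.nrm_le_diff[OF assms(1,2), of n] L2.nrm_le_diff[OF assms(2,1), of n] L2.nrm_diff_commute[OF assms(1,2), of n]
      by (simp add: abs_le_iff)
  qed
  then show ?thesis using assms(4) by (simp add: LIMSEQ_const_iff)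
qed

text \<open>Each contradiction below is derived from this consequence of \<open>operator_limit\<close>, applied to
  normalized approximate eigenvectors.\<close>

lemma eigenvector_limit:
  assumes uf: "\<And>n. (u n, f n) \<in> H" and un: "\<And>n. norm_L2 (u n) = 1"
    and small: "\<And>n. norm_L2 (\<lambda>x. f n x - z * u n x) \<le> 1 / real (Suc n)"
  obtains r v where "strict_mono (r :: nat \<Rightarrow> nat)" "(v, \<lambda>x. z * v x) \<in> H" "norm_L2 v = 1"
    "(\<lambda>n. norm_L2 (\<lambda>x. u (r n) x - v x)) \<longlonglongrightarrow> 0"
proof -
  note U = operatorD[OF uf]
  have fb: "norm_L2 (f n) \<le> cmod z + 1" for n
  proof -
    have "norm_L2 (f n) \<le> norm_L2 (\<lambda>x. z * u n x) + norm_L2 (\<lambda>x. f n x - z * u n x)"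
      by (rule L2.nrm_le_diff[OF U(3) L2.scale_mem[OF U(2)]])
    moreover have "1 / real (Suc n) \<le> 1" by simp
    ultimately show ?thesis using small[of n] L2.nrm_scale[OF U(2), of z n] unfolding un mult_1_right by linarith
  qed
  have lim: "(\<lambda>n. norm_L2 (\<lambda>x. f n x - z * u n x - 0)) \<longlonglongrightarrow> 0"
  proof (rule tendsto_sandwich[OF always_eventually always_eventually tendsto_const])
    show "\<forall>n. norm_L2 (\<lambda>x. f n x - z * u n x - 0) \<le> inverse (real (Suc n))"
      using small by (auto simp: inverse_eq_divide)
  qed (simp_all add: norm_L2_nonneg LIMSEQ_inverse_real_of_nat del: of_nat_Suc)
  obtain r v where v: "strict_mono (r :: nat \<Rightarrow> nat)" "(v, \<lambda>x. 0 + z * v x) \<in> H" "v \<in> L2"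
    "(\<lambda>n. norm_L2 (\<lambda>x. u (r n) x - v x)) \<longlonglongrightarrow> 0"
    by (rule operator_limit[where u = u and f = f, OF uf eq_refl[OF un] fb L2.zero_mem lim])
  have "norm_L2 v = 1" by (rule norm_L2_limit[OF U(2) v(3,4) un])
  moreover have "(v, \<lambda>x. z * v x) \<in> H" using v(2) by simp
  ultimately show thesis using v(1,4) that by blast
qed

text \<open>If no bound existed, normalized almost-solutions of \<open>H u = z u\<close> would have a limit point, and this
  would be an eigenvector.\<close>

lemma resolvent_bound:
  assumes z: "\<not> is_eigenvalue H z"
  shows "\<exists>C. 0 < C \<and> (\<forall>u f. (u, f) \<in> H \<longrightarrow> norm_L2 u \<le> C * norm_L2 (\<lambda>x. f x - z * u x))"
proof (rule ccontr)
  assume no: "\<not> ?thesis"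
  have "\<exists>p. p \<in> H \<and> norm_L2 (fst p) = 1 \<and> norm_L2 (\<lambda>x. snd p x - z * fst p x) < 1 / real (Suc n)" for n
  proof -
    have "\<exists>u f. (u, f) \<in> H \<and> \<not> norm_L2 u \<le> real (Suc n) * norm_L2 (\<lambda>x. f x - z * u x)"
      using no[unfolded not_ex, THEN spec, of "real (Suc n)"] by (simp del: of_nat_Suc)
    then obtain u f where uf: "(u, f) \<in> H" and "\<not> norm_L2 u \<le> real (Suc n) * norm_L2 (\<lambda>x. f x - z * u x)"
      by (elim exE conjE)
    then have gt: "real (Suc n) * norm_L2 (\<lambda>x. f x - z * u x) < norm_L2 u" by simp
    note U = operatorD[OF uf]
    have "0 \<le> real (Suc n) * norm_L2 (\<lambda>x. f x - z * u x)" by (intro mult_nonneg_nonneg norm_L2_nonneg) simp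
    with gt have n: "0 < norm_L2 u" by linarith
    let ?c = "complex_of_real (1 / norm_L2 u)"
    have "(\<lambda>x. ?c * u x, \<lambda>x. ?c * f x) \<in> H" by (rule operator_scale[OF uf])
    moreover have "norm_L2 (\<lambda>x. ?c * u x) = 1"
      using L2.nrm_scale[OF U(2), of ?c] n by (simp add: norm_divide)
    moreover have "norm_L2 (\<lambda>x. ?c * f x - z * (?c * u x)) < 1 / real (Suc n)"
    proof -
      have "(\<lambda>x. ?c * f x - z * (?c * u x)) = (\<lambda>x. ?c * (f x - z * u x))" by (simp add: algebra_simps)
      then have "norm_L2 (\<lambda>x. ?c * f x - z * (?c * u x)) = norm_L2 (\<lambda>x. f x - z * u x) / norm_L2 u"
        using L2.nrm_scale[OF L2.diff_mem[OF U(3) L2.scale_mem[OF U(2)]], of ?c z] n by (simp add: norm_divide)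
      also have "\<dots> < 1 / real (Suc n)" using gt n by (simp add: field_simps del: of_nat_Suc)
      finally show ?thesis .
    qed
    ultimately show ?thesis by (intro exI[of _ "(\<lambda>x. ?c * u x, \<lambda>x. ?c * f x)"]) simp
  qed
  then obtain p where p: "\<And>n. p n \<in> H" "\<And>n. norm_L2 (fst (p n)) = 1" "\<And>n. norm_L2 (\<lambda>x. snd (p n) x - z * fst (p n) x) < 1 / real (Suc n)"
    by metis
  define u where "u n = fst (p n)" for n
  define f where "f n = snd (p n)" for n
  have uf: "(u n, f n) \<in> H" for n using p(1)[of n] by (simp add: u_def f_def)
  have un: "norm_L2 (u n) = 1" for n using p(2)[of n] by (simp add: u_def)
  have small: "norm_L2 (\<lambda>x. f n x - z * u n x) < 1 / real (Suc n)" for n using p(3)[of n] by (simp add: u_def f_def)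
  obtain r v where v: "strict_mono (r :: nat \<Rightarrow> nat)" "(v, \<lambda>x. z * v x) \<in> H" "norm_L2 v = 1"
    "(\<lambda>n. norm_L2 (\<lambda>x. u (r n) x - v x)) \<longlonglongrightarrow> 0"
    by (rule eigenvector_limit[where u = u and f = f, OF uf un less_imp_le[OF small]])
  have "is_eigenvalue H z" unfolding is_eigenvalue_iff by (intro exI[of _ v]) (simp add: v(2,3))
  with z show False ..
qed

text \<open>Let \<open>R\<close> be the range of \<open>H - z\<close>. By the bound above and \<open>operator_limit\<close> it is complete, so
  \<open>g\<close> has a projection \<open>h\<close> to \<open>R\<close>, and \<open>w = g - h\<close> is orthogonal to \<open>R\<close>.
  Symmetry of \<open>H\<close> together with surjectivity of \<open>H + 1\<close> makes \<open>w\<close> an eigenvector for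
  \<open>cnj z\<close> or zero: the solution \<open>w'\<close> of \<open>(H + 1) w' = (cnj z + 1) w\<close> agrees with \<open>w\<close>,
  because \<open>w - w'\<close> is orthogonal to the range of \<open>H + 1\<close>. Eigenvalues are real, so \<open>w\<close>
  vanishes.\<close>

lemma range_surjective:
  assumes z: "\<not> is_eigenvalue H z" and g: "g \<in> L2"
  shows "\<exists>(u, f)\<in>H. AE x in lebesgue. f x - z * u x = g x"
proof -
  from resolvent_bound[OF z] obtain C where C: "0 < C"
    and bound: "\<forall>u f. (u, f) \<in> H \<longrightarrow> norm_L2 u \<le> C * norm_L2 (\<lambda>x. f x - z * u x)" by (elim exE conjE)
  \<comment> \<open>The range of \<open>H - z\<close>.\<close>
  define R where "R = {h. \<exists>u f. (u, f) \<in> H \<and> h = (\<lambda>x. f x - z * u x)}"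
  have RI: "(\<lambda>x. f x - z * u x) \<in> R" if "(u, f) \<in> H" for u f
    unfolding R_def mem_Collect_eq by (intro exI conjI) (rule that, rule refl)
  have RE: "\<exists>u f. (u, f) \<in> H \<and> h = (\<lambda>x. f x - z * u x)" if "h \<in> R" for h
    using that unfolding R_def mem_Collect_eq .
  have RL: "h \<in> L2" if "h \<in> R" for h
  proof -
    from RE[OF that] obtain u f where uf: "(u, f) \<in> H" and h: "h = (\<lambda>x. f x - z * u x)" by (elim exE conjE)
    show ?thesis unfolding h by (rule L2.diff_mem[OF operatorD(3)[OF uf] L2.scale_mem[OF operatorD(2)[OF uf]]])
  qed
  interpret R: semi_inner R inner_L2
  proof
    show "(\<lambda>_. 0) \<in> R" using RI[OF operator_zero] by simp
    show "(\<lambda>x. u x + c * v x) \<in> R" if "u \<in> R" "v \<in> R" for u v c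
    proof -
      from RE[OF that(1)] RE[OF that(2)] obtain u1 f1 u2 f2
        where *: "(u1, f1) \<in> H" "(u2, f2) \<in> H" "u = (\<lambda>x. f1 x - z * u1 x)" "v = (\<lambda>x. f2 x - z * u2 x)"
        by (elim exE conjE)
      have "(\<lambda>x. u x + c * v x) = (\<lambda>x. (f1 x + c * f2 x) - z * (u1 x + c * u2 x))"
        by (simp add: * algebra_simps)
      then show ?thesis using RI[OF operator_lincomb[OF *(1,2), of c]] by simp
    qed
    show "inner_L2 w (\<lambda>x. u x + c * v x) = inner_L2 w u + c * inner_L2 w v" if "w \<in> R" "u \<in> R" "v \<in> R" for w u v c
      by (rule L2.lin[OF RL RL RL, OF that])
    show "inner_L2 u v = cnj (inner_L2 v u)" if "u \<in> R" "v \<in> R" for u v by (rule L2.herm[OF RL RL, OF that])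
    show "0 \<le> Re (inner_L2 u u)" if "u \<in> R" for u by (rule L2.pos[OF RL[OF that]])
  qed
  have Rn: "R.nrm = norm_L2" by (simp add: fun_eq_iff R.nrm_def inner_L2_self norm_L2_def)
  have "R.complete" unfolding R.complete_def Rn
  proof (intro allI impI)
    fix h assume "R.cauchy h"
    then have hR: "\<And>n. h n \<in> R" and hC: "L2.cauchy h"
      unfolding R.cauchy_def L2.cauchy_def Rn using RL by auto
    obtain h' r' where h': "h' \<in> L2" "strict_mono r'" "AE x in lebesgue. (\<lambda>n. h (r' n) x) \<longlonglongrightarrow> h' x"
      and lim: "(\<lambda>n. norm_L2 (\<lambda>x. h n x - h' x)) \<longlonglongrightarrow> 0"
      using hC by (rule L2_cauchy_limit)
    have "\<exists>p. p \<in> H \<and> h n = (\<lambda>x. snd p x - z * fst p x)" for n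
    proof -
      from RE[OF hR[of n]] obtain u f where "(u, f) \<in> H" "h n = (\<lambda>x. f x - z * u x)" by (elim exE conjE)
      then show ?thesis by (intro exI[of _ "(u, f)"]) simp
    qed
    then obtain p where p: "\<And>n. p n \<in> H" "\<And>n. h n = (\<lambda>x. snd (p n) x - z * fst (p n) x)" by metis
    define u where "u n = fst (p n)" for n
    define f where "f n = snd (p n)" for n
    have uf: "(u n, f n) \<in> H" for n using p(1)[of n] by (simp add: u_def f_def)
    have hn: "h n = (\<lambda>x. f n x - z * u n x)" for n using p(2)[of n] by (simp add: u_def f_def)
    note U = operatorD[OF uf]
    obtain D where D: "\<And>n. norm_L2 (\<lambda>x. h n x - h' x) \<le> D"
      using convergent_imp_Bseq[OF convergentI[OF lim]] unfolding Bseq_def real_norm_def by (meson abs_le_D1)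
    define b where "b = norm_L2 h' + D"
    have hb: "norm_L2 (h n) \<le> b" for n
      using L2.nrm_le_diff[OF RL[OF hR] h'(1), of n] D[of n] by (simp add: b_def)
    have ub: "norm_L2 (u n) \<le> C * b" for n
      using bound[rule_format, OF uf, of n] mult_left_mono[OF hb[of n], of C] C unfolding hn[symmetric] by linarith
    have fb: "norm_L2 (f n) \<le> cmod z * (C * b) + b" for n
    proof -
      have "norm_L2 (f n) \<le> norm_L2 (\<lambda>x. z * u n x) + norm_L2 (h n)"
        unfolding hn by (rule L2.nrm_le_diff[OF U(3) L2.scale_mem[OF U(2)]])
      then show ?thesis
        using L2.nrm_scale[OF U(2), of z n] hb[of n] mult_left_mono[OF ub[of n] norm_ge_zero[of z]] by linarith
    qed
    obtain s v where v: "strict_mono (s :: nat \<Rightarrow> nat)" "(v, \<lambda>x. h' x + z * v x) \<in> H" "v \<in> L2"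
      "(\<lambda>n. norm_L2 (\<lambda>x. u (s n) x - v x)) \<longlonglongrightarrow> 0"
      by (rule operator_limit[where u = u and f = f, OF uf ub fb h'(1) lim[unfolded hn]])
    have "h' \<in> R" using RI[OF v(2)] by simp
    then show "\<exists>u\<in>R. (\<lambda>n. norm_L2 (\<lambda>x. h n x - u x)) \<longlonglongrightarrow> 0" using lim by blast
  qed
  then have "\<exists>h\<in>R. \<forall>v\<in>R. inner_L2 h v = inner_L2 g v"
  proof (rule R.riesz_representation)
    show "inner_L2 g (\<lambda>x. u x + c * v x) = inner_L2 g u + c * inner_L2 g v" if "u \<in> R" "v \<in> R" for u v c
      by (rule L2.lin[OF g RL RL, OF that])
    show "cmod (inner_L2 g v) \<le> norm_L2 g * R.nrm v" if "v \<in> R" for v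
      unfolding Rn by (rule L2.cauchy_schwarz[OF g RL[OF that]])
  qed
  then obtain h where h: "h \<in> R" and hg: "\<And>v. v \<in> R \<Longrightarrow> inner_L2 h v = inner_L2 g v" by blast
  define w where "w x = g x - h x" for x
  have w: "w \<in> L2" unfolding w_def by (rule L2.diff_mem[OF g RL[OF h]])
  have orth: "inner_L2 w f = z * inner_L2 w u" if uf: "(u, f) \<in> H" for u f
  proof -
    note U = operatorD[OF uf]
    note d = RI[OF uf]
    have "inner_L2 w (\<lambda>x. f x - z * u x) = 0"
      unfolding w_def L2.antilin_diff[OF RL[OF d] g RL[OF h]] using hg[OF d] by simp
    then show ?thesis
      unfolding L2.lin_diff[OF w U(3) L2.scale_mem[OF U(2)]] L2.lin_scale[OF w U(2)] by simp
  qed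
  \<comment> \<open>The right-hand side for which \<open>w\<close> would solve \<open>(H + 1) w = ?k\<close> if it were an eigenvector for \<open>cnj z\<close>.\<close>
  let ?k = "\<lambda>x. (cnj z + 1) * w x"
  have k: "?k \<in> L2" by (rule L2.scale_mem[OF w])
  obtain w' where w': "(w', \<lambda>x. ?k x - w' x) \<in> H" using operator_plus_one_surjective[OF k] by blast
  note W = operatorD[OF w']
  have dL: "(\<lambda>x. w x - w' x) \<in> L2" by (rule L2.diff_mem[OF w W(2)])
  have sym: "inner_L2 (\<lambda>x. w x - w' x) (\<lambda>x. f x + u x) = 0" if uf: "(u, f) \<in> H" for u f
  proof -
    note U = operatorD[OF uf]
    have "inner_L2 w' f = schroedinger_form V w' u" using U(4)[OF W(1)] by simp
    also have "\<dots> = cnj (schroedinger_form V u w')" by (rule form.herm[OF W(1) U(1)])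
    also have "\<dots> = cnj (inner_L2 u (\<lambda>x. ?k x - w' x))" using W(4)[OF U(1)] by simp
    also have "\<dots> = inner_L2 (\<lambda>x. ?k x - w' x) u" by (rule L2.herm[OF W(3) U(2), symmetric])
    also have "\<dots> = (z + 1) * inner_L2 w u - inner_L2 w' u"
      unfolding L2.antilin_diff[OF U(2) k W(2)] L2.antilin_scale[OF U(2) w] by simp
    finally have "inner_L2 w' f = (z + 1) * inner_L2 w u - inner_L2 w' u" .
    then show ?thesis
      unfolding L2.antilin_diff[OF L2.add_mem[OF U(3,2)] w W(2)] L2.lin_add[OF w U(3,2)] L2.lin_add[OF W(2) U(3,2)] orth[OF uf]
      by (simp add: algebra_simps)
  qed
  obtain q where q: "(q, \<lambda>x. (w x - w' x) - q x) \<in> H" using operator_plus_one_surjective[OF dL] by blast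
  have "inner_L2 (\<lambda>x. w x - w' x) (\<lambda>x. w x - w' x) = 0" using sym[OF q] by simp
  then have "norm_L2 (\<lambda>x. w x - w' x) = 0" by (simp add: inner_L2_self norm_L2_def)
  then have ww': "AE x in lebesgue. w x - w' x = 0" using norm_L2_eq_0_iff[OF dL] by simp
  have "(w', \<lambda>x. cnj z * w' x) \<in> H"
    by (rule operator_cong_AE[OF w' L2.scale_mem[OF W(2)]]) (use ww' in eventually_elim, simp add: algebra_simps)
  then have "norm_L2 w' = 0"
    using z eigenvalue_real[of "cnj z"] unfolding is_eigenvalue_iff[of "cnj z"] by (metis complex_cnj_cnj is_eigenvalue_iff)
  then have "AE x in lebesgue. w' x = 0" using norm_L2_eq_0_iff[OF W(2)] by simp
  with ww' have "AE x in lebesgue. g x = h x" by eventually_elim (simp add: w_def)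
  then have gh: "AE x in lebesgue. h x = g x" by eventually_elim simp
  from RE[OF h] obtain u f where uf: "(u, f) \<in> H" and hf: "h = (\<lambda>x. f x - z * u x)" by (elim exE conjE)
  from gh have "AE x in lebesgue. f x - z * u x = g x" by eventually_elim (simp add: hf)
  with uf show ?thesis by blast
qed

lemma spectrum_eigenvalue:
  assumes "z \<in> spectrum H" shows "is_eigenvalue H z"
proof (rule ccontr)
  assume z: "\<not> is_eigenvalue H z"
  have 1: "\<forall>g\<in>L2. \<exists>(u, f)\<in>H. AE x in lebesgue. f x - z * u x = g x" using range_surjective[OF z] by blast
  from resolvent_bound[OF z] obtain C where "0 < C"
    and C: "\<forall>u f. (u, f) \<in> H \<longrightarrow> norm_L2 u \<le> C * norm_L2 (\<lambda>x. f x - z * u x)" by (elim exE conjE)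
  have "\<forall>(u, f)\<in>H. norm_L2 u \<le> C * norm_L2 (\<lambda>x. f x - z * u x)"
  proof (intro ballI)
    fix p assume "p \<in> H"
    then show "case p of (u, f) \<Rightarrow> norm_L2 u \<le> C * norm_L2 (\<lambda>x. f x - z * u x)"
      using C[THEN spec, THEN spec, of "fst p" "snd p"] by (simp add: case_prod_unfold)
  qed
  then have 2: "\<exists>C. \<forall>(u, f)\<in>H. norm_L2 u \<le> C * norm_L2 (\<lambda>x. f x - z * u x)" by (rule exI)
  have "z \<in> resolvent_set H" unfolding resolvent_set_def by (intro CollectI conjI 1 2)
  with assms show False by (simp add: spectrum_def)
qed

text \<open>Normalized eigenvectors for eigenvalues \<open>y n\<close> that tend to \<open>z\<close> would accumulate at a normalized
  eigenvector for \<open>z\<close>, to which all of them are orthogonal.\<close>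

lemma spectrum_isolated:
  assumes z: "z \<in> spectrum H" shows "z isolated_in spectrum H"
proof (rule ccontr)
  assume "\<not> z isolated_in spectrum H"
  then have "\<exists>y\<in>spectrum H. dist z y < 1 / real (Suc n) \<and> y \<noteq> z" for n
    using z unfolding isolated_in_dist_Ex_iff by (metis zero_less_divide_1_iff of_nat_0_less_iff zero_less_Suc)
  then obtain y where y: "\<And>n. y n \<in> spectrum H" "\<And>n. dist z (y n) < 1 / real (Suc n)" "\<And>n. y n \<noteq> z" by metis
  have "\<exists>u. (u, \<lambda>x. y n * u x) \<in> H \<and> norm_L2 u = 1" for n
    using eigenvalue_normalized[OF spectrum_eigenvalue[OF y(1)]] by metis
  then obtain u where u: "\<And>n. (u n, \<lambda>x. y n * u n x) \<in> H" and un: "\<And>n. norm_L2 (u n) = 1" by metis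
  note U = operatorD[OF u]
  have d: "cmod (y n - z) < 1 / real (Suc n)" for n using y(2)[of n] by (simp add: dist_norm norm_minus_commute)
  have small: "norm_L2 (\<lambda>x. y n * u n x - z * u n x) \<le> 1 / real (Suc n)" for n
  proof -
    have "(\<lambda>x. y n * u n x - z * u n x) = (\<lambda>x. (y n - z) * u n x)" by (simp add: algebra_simps)
    then show ?thesis using d[of n] by (simp add: L2.nrm_scale[OF U(2)] un)
  qed
  obtain r v where v: "strict_mono (r :: nat \<Rightarrow> nat)" "(v, \<lambda>x. z * v x) \<in> H" "norm_L2 v = 1"
    "(\<lambda>n. norm_L2 (\<lambda>x. u (r n) x - v x)) \<longlonglongrightarrow> 0"
    by (rule eigenvector_limit[where u = u and f = "\<lambda>n x. y n * u n x", OF u un small])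
  note vL = operatorD(2)[OF v(2)]
  have "inner_L2 (u (r n)) v = 0" for n
    by (rule eigenvectors_orthogonal[OF v(2) u eigenvalue_real[OF spectrum_eigenvalue[OF y(1)]] y(3)[symmetric]])
  then have "(\<lambda>n. 0) \<longlonglongrightarrow> inner_L2 v v" using L2.B_tendsto_left[OF U(2) vL vL v(4)] by simp
  then have "inner_L2 v v = 0" by (simp add: LIMSEQ_const_iff)
  then show False using v(3) by (simp add: inner_L2_self norm_L2_def)
qed

text \<open>Otherwise Gram--Schmidt produces an infinite orthonormal sequence of eigenvectors. A limit of a
  subsequence would be orthogonal to the members of that subsequence and hence to itself.\<close>

lemma finite_multiplicity: "finite_multiplicity H z"
proof (rule ccontr)
  assume inf: "\<not> finite_multiplicity H z"
  define P where "P e n x \<longleftrightarrow> (x, \<lambda>t. z * x t) \<in> H \<and> norm_L2 x = 1 \<and> (\<forall>m<n. inner_L2 (e m) x = 0)"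
    for e :: "nat \<Rightarrow> 'a \<Rightarrow> complex" and n x
  have "\<exists>e. \<forall>n. P e n (e n)"
  proof (rule dependent_wellorder_choice)
    fix r and e e' :: "nat \<Rightarrow> 'a \<Rightarrow> complex" and n :: nat
    assume "\<And>m. m < n \<Longrightarrow> e m = e' m"
    then show "P e n r = P e' n r" by (simp add: P_def)
  next
    fix n :: nat and e :: "nat \<Rightarrow> 'a \<Rightarrow> complex"
    assume IH: "\<And>m. m < n \<Longrightarrow> P e m (e m)"
    have eH: "(e m, \<lambda>t. z * e m t) \<in> H" and en: "norm_L2 (e m) = 1" if "m < n" for m using IH[OF that] by (auto simp: P_def)
    have eL: "e m \<in> L2" if "m < n" for m by (rule operatorD(2)[OF eH[OF that]])
    have ee: "inner_L2 (e i) (e j) = (if i = j then 1 else 0)" if ij: "i < n" "j < n" for i j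
    proof -
      consider "i < j" | "j < i" | "i = j" by linarith
      then show ?thesis
      proof cases
        case 1
        then show ?thesis using IH[OF ij(2)] by (simp add: P_def)
      next
        case 2
        then show ?thesis using IH[OF ij(1)] L2.herm[OF eL[OF ij(1)] eL[OF ij(2)]] by (simp add: P_def)
      next
        case 3
        then show ?thesis using en[OF ij(1)] norm_L2_sq[of "e i"] by (simp add: inner_L2_self)
      qed
    qed
    have inj: "inj_on e {..<n}"
    proof (rule inj_onI)
      fix i j assume ij: "i \<in> {..<n}" "j \<in> {..<n}" "e i = e j"
      show "i = j"
      proof (rule ccontr)
        assume "i \<noteq> j"
        then have "inner_L2 (e i) (e j) = 0" using ee[of i j] ij(1,2) by simp
        moreover have "inner_L2 (e i) (e j) = 1" using ee[of i i] ij(1) unfolding ij(3)[symmetric] by simp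
        ultimately show False by simp
      qed
    qed
    have fin: "finite (e ` {..<n})" and sub: "e ` {..<n} \<subseteq> eigenspace H z" using eH by (auto simp: eigenspace_iff)
    have "\<exists>u\<in>eigenspace H z. \<forall>c. \<not> (AE x in lebesgue. u x = (\<Sum>s\<in>e ` {..<n}. c s * s x))"
    proof (rule ccontr)
      assume "\<not> ?thesis"
      then have "\<forall>u\<in>eigenspace H z. \<exists>c. AE x in lebesgue. u x = (\<Sum>s\<in>e ` {..<n}. c s * s x)" by simp
      with fin sub have "finite_multiplicity H z"
        unfolding finite_multiplicity_def by (intro exI[of _ "e ` {..<n}"] conjI)
      with inf show False ..
    qed
    then obtain u where u: "u \<in> eigenspace H z"
      and nspan: "\<forall>c. \<not> (AE x in lebesgue. u x = (\<Sum>s\<in>e ` {..<n}. c s * s x))" by (elim bexE)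
    have uH: "(u, \<lambda>x. z * u x) \<in> H" using u by (simp add: eigenspace_iff)
    note uL = operatorD(2)[OF uH]
    \<comment> \<open>One Gram--Schmidt step for an eigenvector outside the span of the earlier ones.\<close>
    define v where "v x = u x - (\<Sum>i<n. inner_L2 (e i) u * e i x)" for x
    have "(\<lambda>x. \<Sum>i\<in>I. k i * e i x, \<lambda>x. z * (\<Sum>i\<in>I. k i * e i x)) \<in> H" if "finite I" "I \<subseteq> {..<n}" for I k
      using that
    proof (induction I)
      case empty
      then show ?case using operator_zero by simp
    next
      case (insert i I)
      then have "(\<lambda>x. (\<Sum>i\<in>I. k i * e i x) + k i * e i x, \<lambda>x. z * (\<Sum>i\<in>I. k i * e i x) + k i * (z * e i x)) \<in> H"
        by (intro operator_lincomb eH) auto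
      then show ?case using insert by (simp add: algebra_simps)
    qed
    from operator_diff[OF uH this[of "{..<n}" "\<lambda>i. inner_L2 (e i) u"]]
    have vH: "(v, \<lambda>x. z * v x) \<in> H" by (simp add: v_def[abs_def] right_diff_distrib)
    note vL = operatorD(2)[OF vH]
    have ev: "inner_L2 (e j) v = 0" if j: "j < n" for j
    proof -
      have sL: "(\<lambda>x. \<Sum>i<n. inner_L2 (e i) u * e i x) \<in> L2" by (rule L2.sum_mem) (simp add: eL)
      have "inner_L2 (e j) (\<lambda>x. \<Sum>i<n. inner_L2 (e i) u * e i x) = (\<Sum>i<n. inner_L2 (e i) u * inner_L2 (e j) (e i))"
        by (rule L2.lin_sum[OF eL[OF j]]) (simp add: eL)
      also have "\<dots> = (\<Sum>i<n. if i = j then inner_L2 (e i) u else 0)"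
        by (rule sum.cong) (use ee j in auto)
      also have "\<dots> = inner_L2 (e j) u" using j by simp
      finally show ?thesis unfolding v_def L2.lin_diff[OF eL[OF j] uL sL] by simp
    qed
    have nv: "norm_L2 v \<noteq> 0"
    proof
      assume "norm_L2 v = 0"
      then have "AE x in lebesgue. v x = 0" using norm_L2_eq_0_iff[OF vL] by simp
      then have "AE x in lebesgue. u x = (\<Sum>s\<in>e ` {..<n}. inner_L2 s u * s x)"
        by eventually_elim (simp add: v_def sum.reindex[OF inj])
      with nspan[THEN spec, of "\<lambda>s. inner_L2 s u"] show False ..
    qed
    let ?c = "complex_of_real (1 / norm_L2 v)"
    have "P e n (\<lambda>x. ?c * v x)" unfolding P_def
    proof (intro conjI allI impI)
      show "(\<lambda>x. ?c * v x, \<lambda>t. z * (?c * v t)) \<in> H" using operator_scale[OF vH, of ?c] by (simp add: mult.left_commute)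
      show "norm_L2 (\<lambda>x. ?c * v x) = 1"
        using L2.nrm_scale[OF vL, of ?c] nv norm_L2_nonneg[of v] by (simp add: norm_divide)
      show "inner_L2 (e m) (\<lambda>x. ?c * v x) = 0" if "m < n" for m
        unfolding L2.lin_scale[OF eL[OF that] vL] ev[OF that] by simp
    qed
    then show "\<exists>x. P e n x" by (intro exI[of _ "\<lambda>x. ?c * v x"])
  qed
  then obtain e where "\<forall>n. P e n (e n)" ..
  then have e: "P e n (e n)" for n by (rule spec)
  have eH: "(e n, \<lambda>t. z * e n t) \<in> H" and en: "norm_L2 (e n) = 1" for n using e[of n] by (auto simp: P_def)
  have orth: "inner_L2 (e m) (e n) = 0" if "m < n" for m n using e[of n] that by (simp add: P_def)
  note E = operatorD[OF eH]
  have small: "norm_L2 (\<lambda>x. z * e n x - z * e n x) \<le> 1 / real (Suc n)" for n by (simp add: norm_L2_def)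
  obtain r v where v: "strict_mono (r :: nat \<Rightarrow> nat)" "(v, \<lambda>x. z * v x) \<in> H" "norm_L2 v = 1"
    "(\<lambda>n. norm_L2 (\<lambda>x. e (r n) x - v x)) \<longlonglongrightarrow> 0"
    by (rule eigenvector_limit[where u = e and f = "\<lambda>n x. z * e n x", OF eH en small])
  note vL = operatorD(2)[OF v(2)]
  have "inner_L2 (e (r m)) v = 0" for m
  proof -
    have "(\<lambda>n. inner_L2 (e (r m)) (e (r n))) \<longlonglongrightarrow> inner_L2 (e (r m)) v" by (rule L2.B_tendsto[OF E(2) vL E(2) v(4)])
    moreover have "\<forall>\<^sub>F n in sequentially. inner_L2 (e (r m)) (e (r n)) = 0"
      by (rule eventually_sequentiallyI[of "Suc m"]) (use v(1) in \<open>auto intro!: orth simp: strict_mono_def\<close>)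
    ultimately show ?thesis by (metis tendsto_eventually LIMSEQ_unique)
  qed
  then have "(\<lambda>n. 0) \<longlonglongrightarrow> inner_L2 v v" using L2.B_tendsto_left[OF E(2) vL vL v(4)] by simp
  then have "inner_L2 v v = 0" by (simp add: LIMSEQ_const_iff)
  then show False using v(3) by (simp add: inner_L2_self norm_L2_def)
qed

theorem purely_discrete: "purely_discrete_spectrum H"
  unfolding purely_discrete_spectrum_def essential_spectrum_def discrete_spectrum_def
  using spectrum_isolated spectrum_eigenvalue finite_multiplicity by blast

end

theorem theorem3:
  fixes V :: "real ^ 'n \<Rightarrow> real"
  assumes "locally_L1 V"
    and "AE x in lebesgue. 0 \<le> V x"
    and "\<And>M. M > 0 \<Longrightarrow> \<exists>r>0. polynomially_thin r {x. 0 \<le> V x \<and> V x < M}"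
  shows "purely_discrete_spectrum (schroedinger_operator V)"
proof -
  \<comment> \<open>Local integrability makes the restrictions of \<open>V\<close> to balls measurable.\<close>
  have "V \<in> borel_measurable lebesgue"
  proof (rule borel_measurable_LIMSEQ_real)
    fix n
    have "V absolutely_integrable_on cball 0 (real n)"
      using assms(1) by (simp add: locally_L1_def)
    then show "(\<lambda>x. indicator (cball 0 (real n)) x *\<^sub>R V x) \<in> borel_measurable lebesgue"
      unfolding set_integrable_def by (rule borel_measurable_integrable)
  next
    fix x :: "real ^ 'n"
    obtain N where "norm x \<le> real N" using real_arch_simple by blast
    then have "\<forall>\<^sub>F n in sequentially. indicator (cball 0 (real n)) x *\<^sub>R V x = V x"
      by (intro eventually_sequentiallyI[of N]) (auto simp: indicator_def)
    then show "(\<lambda>n. indicator (cball 0 (real n)) x *\<^sub>R V x) \<longlonglongrightarrow> V x" by (rule tendsto_eventually)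
  qed
  then interpret nonneg_potential V
    using assms(2) by unfold_locales
  interpret compact_form V
  proof
    fix f :: "nat \<Rightarrow> real ^ 'n \<Rightarrow> complex" and B
    assume f: "\<And>n. f n \<in> form_dom V" and B: "\<And>n. form1.nrm (f n) \<le> B"
    obtain r where "strict_mono (r :: nat \<Rightarrow> nat)" "L2.cauchy (\<lambda>n. f (r n))"
      by (rule compact_embedding_if_thin[OF assms(3) f B])
    then show "\<exists>r::nat \<Rightarrow> nat. strict_mono r \<and> L2.cauchy (\<lambda>n. f (r n))" by (intro exI[of _ r] conjI)
  qed
  show ?thesis by (rule purely_discrete)
qed

end
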